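(* Let $\beta>1$ be a generalised multinacci number. Then for all $(\omega,x)\in X$, $$\frac{\log\lceil\beta\rceil}{\log\beta}+\frac{\log 2}{\log\beta}\Big[1-\limsup_{k\to\infty}\frac{M_k(\omega,x)}{k}\Big]\le \underline d\big(\nu_\beta,(\omega,x)\big)\le\overline d\big(\nu_\beta,(\omega,x)\big)\le \frac{\log\lceil\beta\rceil}{\log\beta}+\frac{\log 2}{\log\beta}\Big[1-\liminf_{k\to\infty}\frac{M_k(\omega,x)}{k}\Big],$$ where the local dimensions are taken with respect to the metric $\rho$ on $X$.
   Context: **Generalised multinacci numbers.** For $\beta>1$ let $I=[0,\frac{\lfloor\beta\rfloor}{\beta-1}]$. The greedy map $T_\beta:I\to I$ is $T_\beta x=\beta x-a_1(x)$, where $a_1(x)=k$ if $x\in[\frac k\beta,\frac{k+1}\beta)$ for some $k\in\{0,\dots,\lfloor\beta\rfloor-1\}$, and $a_1(x)=\lfloor\beta\rfloor$ if $x\in[\frac{\lfloor\beta\rfloor}\beta,\frac{\lfloor\beta\rfloor}{\beta-1}]$. With $a_n(x)=a_1(T_\beta^{n-1}x)$ one has $x=\sum_{n\ge1}a_n(x)\beta^{-n}$, the greedy $\beta$-expansion of $x$. The number $\beta$ is a generalised multinacci number if the greedy expansion of $1$ is finite, $1=\frac{a_1}{\beta}+\cdots+\frac{a_n}{\beta^n}$, with $n\ge2$ and $a_j\ge1$ for all $1\le j\le n$. **Random $\beta$-transformation.** Let $T_kx=\beta x-k$ for $0\le k\le\lfloor\beta\rfloor$, and $E_0=[0,\frac1\beta)$,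 $E_{\lfloor\beta\rfloor}=\big(\frac{\lfloor\beta\rfloor}{\beta(\beta-1)}+\frac{\lfloor\beta\rfloor-1}{\beta},\frac{\lfloor\beta\rfloor}{\beta-1}\big]$, $E_k=\big(\frac{\lfloor\beta\rfloor}{\beta(\beta-1)}+\frac{k-1}\beta,\frac{k+1}\beta\big)$ for $1\le k\le\lfloor\beta\rfloor-1$, $S_k=\big[\frac k\beta,\frac{\lfloor\beta\rfloor}{\beta(\beta-1)}+\frac{k-1}\beta\big]$ for $1\le k\le\lfloor\beta\rfloor$. Put $S=\bigcup_kS_k$ and $\Omega=\{0,1\}^{\mathbb N}$, with left shift $\sigma$. Define $K:\Omega\times I\to\Omega\times I$ by $K(\omega,x)=(\omega,T_kx)$ if $x\in E_k$, and $K(\omega,x)=(\sigma\omega,T_{k-1+\omega_1}x)$ if $x\in S_k$. Let $\pi(\omega,x)=x$. **The measure $\nu_\beta$.** Let $b_1(\omega,x)=k$ if $x\in E_k$, or if $x\in S_k$ and $\omega_1=1$; let $b_1(\omega,x)=k-1$ if $x\in S_k$ and $\omega_1=0$. Let $b_n(\omega,x)=b_1(K^{n-1}(\omega,x))$ and $\phi(\omega,x)=(b_n(\omega,x))_{n\ge1}\in\{0,\dots,\lfloor\beta\rfloor\}^{\mathbb N}$. Let $Z$ be the set of $(\omega,x)$ such that $\pi(K^n(\omega,x))\in S$ for infinitely many $n$; $\phi$ is a bimeasurable bijection from $Z$ onto its image. With $m$ the uniform Bernoulli measure on $\{0,\dots,\lfloor\beta\rfloor\}^{\mathbb N}$ (each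 digit has probability $1/(\lfloor\beta\rfloor+1)$), $\nu_\beta=m\circ\phi$, i.e. $\nu_\beta(A)=m(\phi(A\cap Z))$; it is a $K$-invariant probability measure with $\nu_\beta(Z)=1$. **Coding and metric.** For $\beta$ generalised multinacci the set $$F=\Big\{\pi(K^n(\omega,1)),\ \pi\big(K^n(\omega,\tfrac{\lfloor\beta\rfloor}{\beta-1}-1)\big):n\ge0,\ \omega\in\Omega\Big\}\cup\Big\{\tfrac k\beta,\ \tfrac{\lfloor\beta\rfloor}{\beta(\beta-1)}+\tfrac k\beta:0\le k\le\lfloor\beta\rfloor\Big\}$$ is finite (known). Let $C_1,\dots,C_L$ be the open intervals between consecutive points of $F$, numbered from left to right. Let $X=(\Omega\times I)\setminus\bigcup_{n\ge0}K^{-n}(\Omega\times F)$; then $\nu_\beta(X)=1$. For $(\omega,x)\in X$ and $j\ge1$ let $\alpha_j(\omega,x)=k$ if $\pi(K^{j-1}(\omega,x))\in C_k$. The metric $\rho$ on $X$ is $$\rho\big((\omega,x),(\omega',x')\big)=\beta^{-\min\{k\ge0:\ \omega_{k+1}\ne\omega'_{k+1}\text{ or }\alpha_{k+1}(\omega,x)\ne\alpha_{k+1}(\omega',x')\}}$$ for distinct points (and $0$ for equal points). **Visits to $S$.** $M_k(\omega,x)=\#\{0\le i\le k-1:\pi(K^i(\omega,x))\in S\}$. **Local dimensions.** For a probability measure $\mu$ on a metric space, with $B(z,r)$ the open ball of radius $r$ around $z$, $\underline d(\mu,z)=\liminf_{r\downarrow0}\frac{\log\mu(B(z,r))}{\log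 r}$ and $\overline d(\mu,z)=\limsup_{r\downarrow0}\frac{\log\mu(B(z,r))}{\log r}$; if they coincide the common value is $d(\mu,z)$. *)

theory Defs
  imports "HOL-Probability.Probability"
begin

section \<open>Greedy expansions and generalised multinacci numbers\<close>

definition ndig :: "real \<Rightarrow> nat" where
  "ndig \<beta> = nat \<lfloor>\<beta>\<rfloor>"

definition expI :: "real \<Rightarrow> real set" where
  "expI \<beta> = {0 .. real (ndig \<beta>) / (\<beta> - 1)}"

text \<open>For \<open>x \<ge> 0\<close>, the number \<open>\<lfloor>\<beta> * x\<rfloor>\<close> is the \<open>k\<close> with \<open>k / \<beta> \<le> x < (k + 1) / \<beta>\<close>.\<close>

definition greedy_digit1 :: "real \<Rightarrow> real \<Rightarrow> nat" where
  "greedy_digit1 \<beta> x = (if x < real (ndig \<beta>) / \<beta> then nat \<lfloor>\<beta> * x\<rfloor> else ndig \<beta>)"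

definition greedy_map :: "real \<Rightarrow> real \<Rightarrow> real" where
  "greedy_map \<beta> x = \<beta> * x - real (greedy_digit1 \<beta> x)"

text \<open>Digits are numbered from 1, as are \<open>rand_digit\<close> and \<open>alpha_code\<close> below.\<close>

definition greedy_digit :: "real \<Rightarrow> nat \<Rightarrow> real \<Rightarrow> nat" where
  "greedy_digit \<beta> n x = greedy_digit1 \<beta> ((greedy_map \<beta> ^^ (n - 1)) x)"

definition gen_multinacci :: "real \<Rightarrow> bool" where
  "gen_multinacci \<beta> \<longleftrightarrow> \<beta> > 1 \<and>
     (\<exists>n\<ge>2. (\<forall>j\<in>{1..n}. greedy_digit \<beta> j 1 \<ge> 1) \<and>
            1 = (\<Sum>j=1..n. real (greedy_digit \<beta> j 1) / \<beta> ^ j))"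


section \<open>The random beta-transformation\<close>

text \<open>
  \<open>\<Omega>\<close> is the whole type \<^typ>\<open>nat \<Rightarrow> bool\<close>, with \<^const>\<open>True\<close> standing for 1; the coordinate
  \<open>\<omega>\<^sub>n\<^sub>+\<^sub>1\<close> is \<open>\<omega> n\<close>. The maps below are total functions, but are only meaningful for
  \<open>x \<in> expI \<beta>\<close>, an interval which they leave invariant.
\<close>

type_synonym omega = "nat \<Rightarrow> bool"

definition rand_T :: "real \<Rightarrow> nat \<Rightarrow> real \<Rightarrow> real" where
  "rand_T \<beta> k x = \<beta> * x - real k"

definition rand_E :: "real \<Rightarrow> nat \<Rightarrow> real set" where
  "rand_E \<beta> k =
    (let N = real (ndig \<beta>); c = N / (\<beta> * (\<beta> - 1)) in
     if k = 0 then {0 ..< 1 / \<beta>}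
     else if k = ndig \<beta> then {c + (N - 1) / \<beta> <.. N / (\<beta> - 1)}
     else {c + (real k - 1) / \<beta> <..< (real k + 1) / \<beta>})"

definition rand_S :: "real \<Rightarrow> nat \<Rightarrow> real set" where
  "rand_S \<beta> k = {real k / \<beta> .. real (ndig \<beta>) / (\<beta> * (\<beta> - 1)) + (real k - 1) / \<beta>}"

definition switch_region :: "real \<Rightarrow> real set" where
  "switch_region \<beta> = (\<Union>k\<in>{1..ndig \<beta>}. rand_S \<beta> k)"

text \<open>
  For a generalised multinacci number the sets \<open>E\<^sub>k\<close> and \<open>S\<^sub>k\<close> partition \<open>expI \<beta>\<close>, so the
  indices below are unique.
\<close>

definition E_index :: "real \<Rightarrow> real \<Rightarrow> nat" where
  "E_index \<beta> x = (THE k. k \<in> {0..ndig \<beta>} \<and> x \<in> rand_E \<beta> k)"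

definition S_index :: "real \<Rightarrow> real \<Rightarrow> nat" where
  "S_index \<beta> x = (THE k. k \<in> {1..ndig \<beta>} \<and> x \<in> rand_S \<beta> k)"

definition rand_K :: "real \<Rightarrow> omega \<times> real \<Rightarrow> omega \<times> real" where
  "rand_K \<beta> = (\<lambda>(\<omega>, x).
     if x \<in> switch_region \<beta>
     then (\<lambda>n. \<omega> (Suc n), rand_T \<beta> (S_index \<beta> x - 1 + of_bool (\<omega> 0)) x)
     else (\<omega>, rand_T \<beta> (E_index \<beta> x) x))"


section \<open>The invariant measure\<close>

definition rand_digit1 :: "real \<Rightarrow> omega \<times> real \<Rightarrow> nat" where
  "rand_digit1 \<beta> = (\<lambda>(\<omega>, x).
     if x \<in> switch_region \<beta>
     then (if \<omega> 0 then S_index \<beta> x else S_index \<beta> x - 1)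
     else E_index \<beta> x)"

definition rand_digit :: "real \<Rightarrow> nat \<Rightarrow> omega \<times> real \<Rightarrow> nat" where
  "rand_digit \<beta> n z = rand_digit1 \<beta> ((rand_K \<beta> ^^ (n - 1)) z)"

definition rand_phi :: "real \<Rightarrow> omega \<times> real \<Rightarrow> (nat \<Rightarrow> nat)" where
  "rand_phi \<beta> z = (\<lambda>i. rand_digit \<beta> (Suc i) z)"

definition rand_Z :: "real \<Rightarrow> (omega \<times> real) set" where
  "rand_Z \<beta> = {z \<in> UNIV \<times> expI \<beta>. infinite {n. snd ((rand_K \<beta> ^^ n) z) \<in> switch_region \<beta>}}"

definition digit_measure :: "real \<Rightarrow> (nat \<Rightarrow> nat) measure" where
  "digit_measure \<beta> = (\<Pi>\<^sub>M i\<in>UNIV. uniform_count_measure {0..ndig \<beta>})"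

text \<open>The product sigma-algebra on \<open>\<Omega> \<times> expI \<beta>\<close>.\<close>

definition rand_space :: "real \<Rightarrow> (omega \<times> real) measure" where
  "rand_space \<beta> =
     (\<Pi>\<^sub>M i\<in>UNIV. count_space UNIV) \<Otimes>\<^sub>M restrict_space borel (expI \<beta>)"

definition nu :: "real \<Rightarrow> (omega \<times> real) measure" where
  "nu \<beta> = measure_of (space (rand_space \<beta>)) (sets (rand_space \<beta>))
            (\<lambda>A. emeasure (digit_measure \<beta>) (rand_phi \<beta> ` (A \<inter> rand_Z \<beta>)))"


section \<open>Coding and metric\<close>

definition coding_F :: "real \<Rightarrow> real set" where
  "coding_F \<beta> =
     (\<Union>n. \<Union>\<omega>. {snd ((rand_K \<beta> ^^ n) (\<omega>, 1)),
               snd ((rand_K \<beta> ^^ n) (\<omega>, real (ndig \<beta>) / (\<beta> - 1) - 1))})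
     \<union> (\<Union>k\<in>{0..ndig \<beta>}. {real k / \<beta>, real (ndig \<beta>) / (\<beta> * (\<beta> - 1)) + real k / \<beta>})"

text \<open>
  \<open>C\<^sub>k\<close> for \<open>k \<in> {1..L}\<close> with \<open>L = card (coding_F \<beta>) - 1\<close>. The set \<open>coding_F \<beta>\<close> is finite for
  generalised multinacci \<open>\<beta>\<close>.
\<close>

definition coding_C :: "real \<Rightarrow> nat \<Rightarrow> real set" where
  "coding_C \<beta> k =
     {sorted_list_of_set (coding_F \<beta>) ! (k - 1) <..< sorted_list_of_set (coding_F \<beta>) ! k}"

definition coding_X :: "real \<Rightarrow> (omega \<times> real) set" where
  "coding_X \<beta> = (UNIV \<times> expI \<beta>) - (\<Union>n. (rand_K \<beta> ^^ n) -` (UNIV \<times> coding_F \<beta>))"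

definition alpha_code :: "real \<Rightarrow> nat \<Rightarrow> omega \<times> real \<Rightarrow> nat" where
  "alpha_code \<beta> j z =
     (THE k. k \<in> {1..card (coding_F \<beta>) - 1} \<and> snd ((rand_K \<beta> ^^ (j - 1)) z) \<in> coding_C \<beta> k)"

definition rho :: "real \<Rightarrow> omega \<times> real \<Rightarrow> omega \<times> real \<Rightarrow> real" where
  "rho \<beta> z z' =
     (if z = z' then 0
      else inverse \<beta> ^ (LEAST k. fst z k \<noteq> fst z' k \<or>
                                 alpha_code \<beta> (Suc k) z \<noteq> alpha_code \<beta> (Suc k) z'))"

definition visits :: "real \<Rightarrow> nat \<Rightarrow> omega \<times> real \<Rightarrow> nat" where
  "visits \<beta> k z = card {i. i < k \<and> snd ((rand_K \<beta> ^^ i) z) \<in> switch_region \<beta>}"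


section \<open>Local dimensions\<close>

text \<open>
  Since \<open>ln 0 = 0\<close> in HOL, the quotient is set to \<open>\<infinity>\<close> explicitly for null balls,
  where \<open>log 0 = -\<infinity>\<close> (and \<open>log r < 0\<close> for small \<open>r\<close>).
\<close>

definition local_dim_quot ::
  "'a set \<Rightarrow> ('a \<Rightarrow> 'a \<Rightarrow> real) \<Rightarrow> 'a measure \<Rightarrow> 'a \<Rightarrow> real \<Rightarrow> ereal" where
  "local_dim_quot M d \<mu> z r =
     (let p = measure \<mu> (Metric_space.mball M d z r)
      in if p = 0 then \<infinity> else ereal (ln p / ln r))"

definition lower_local_dim ::
  "'a set \<Rightarrow> ('a \<Rightarrow> 'a \<Rightarrow> real) \<Rightarrow> 'a measure \<Rightarrow> 'a \<Rightarrow> ereal" where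
  "lower_local_dim M d \<mu> z = Liminf (at_right 0) (local_dim_quot M d \<mu> z)"

definition upper_local_dim ::
  "'a set \<Rightarrow> ('a \<Rightarrow> 'a \<Rightarrow> real) \<Rightarrow> 'a measure \<Rightarrow> 'a \<Rightarrow> ereal" where
  "upper_local_dim M d \<mu> z = Limsup (at_right 0) (local_dim_quot M d \<mu> z)"

end

theory Submission
  imports Defs
begin

text \<open>
  Write \<open>N\<close> for the floor of \<open>\<beta>\<close> and \<open>P\<close> for the right end point of the interval. A digit sequence
  \<open>b\<close> encodes the point \<open>(om b, xv b)\<close>, where \<open>xv b\<close> is the sum of \<open>b\<^sub>i / \<beta>\<^sup>i\<close> and \<open>om b\<close> lists the
  choices that \<open>b\<close> makes at its visits to \<open>S\<close>; this coding conjugates the shift with \<open>K\<close>, so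
  \<open>\<nu>\<close> is the image of the Bernoulli measure. The partition points \<open>F\<close> are forward invariant under
  all admissible branches (Markov property) and avoid the interior of each \<open>S\<^sub>k\<close>. Hence a
  \<open>\<rho>\<close>-ball of radius about \<open>1 / \<beta>\<^sup>k\<close> prescribes the first \<open>k\<close> digits, the cell of the \<open>k\<close>-th
  iterate, and the \<open>k + 1 - M\<^sub>k\<close> coordinates among the first \<open>k + 1\<close> coordinates of \<open>\<omega>\<close> which
  the first \<open>k\<close> steps do not use up. Because each \<open>S\<^sub>k\<close> is a single cell whose two images have
  equal mass, the latter are independent fair coins given the cell. So, up to bounded factors, the
  ball has measure \<open>1 / ((N + 1)^k * 2^(k + 1 - M\<^sub>k))\<close>.
\<close>

text \<open>Positivity of the greedy digits of 1 enters through one estimate: until the greedy orbit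
  of 1 reaches 0 it stays at or above 1/\<beta>, and 1/\<beta> is at least \<open>P - 1\<close>. In
  the coordinate y = \<beta>x - k the region S_k is 0 \<le> y \<le> \<open>P - 1\<close>, so this
  orbit meets switch regions only at end points, where the two branches produce nothing but 0, 1,
  \<open>P - 1\<close> and \<open>P\<close>. Together with the reflection x -> \<open>P\<close> - x,
  which exchanges the branches d and \<open>N\<close> - d, this yields a finite set that contains
  \<open>F\<close>, is closed under all branches and misses the interiors of the S_k. The
  measure-theoretic inputs (no atoms, symmetry of the law of \<open>xv\<close> under reflection)
  come from a maximum principle for functions on the line controlled by their average over the
  branches. Independence of the coins must be proved for a class of position sets that survives
  peeling off digits. Unions of cells form such a class because inverse branches map cells into
  cells. The bounded factors are the mass of the last cell, bounded below since there are finitely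
  many cells, and the rounding of a radius to a power of 1/\<beta>.\<close>

section \<open>Gaps of a sorted list and enumeration of an infinite set of naturals\<close>

text \<open>Gives meaning to the definite description in \<open>alpha_code\<close>: off
  \<open>F\<close>, a point of the interval lies in exactly one gap.\<close>

lemma sorted_list_gap:
  fixes xs :: "'a::linorder list"
  assumes "sorted xs" "xs \<noteq> []" "hd xs < x" "x < last xs" "x \<notin> set xs"
  shows "\<exists>!k. k \<in> {1..length xs - 1} \<and> x \<in> {xs ! (k - 1) <..< xs ! k}"
proof -
  have mono: "xs ! i \<le> xs ! j" if "i \<le> j" "j < length xs" for i j
    using assms(1) that by (simp add: sorted_nth_mono)
  define k where "k = (LEAST i. i < length xs \<and> x < xs ! i)"
  have ex: "length xs - 1 < length xs \<and> x < xs ! (length xs - 1)"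
    using assms(2,4) by (simp add: last_conv_nth)
  have k: "k < length xs" "x < xs ! k" using LeastI[of "\<lambda>i. i < length xs \<and> x < xs ! i", OF ex] by (auto simp: k_def)
  have k0: "k \<noteq> 0" using k assms(2,3) by (metis hd_conv_nth less_asym)
  have "\<not> (k - 1 < length xs \<and> x < xs ! (k - 1))"
    using k0 not_less_Least[of "k - 1" "\<lambda>i. i < length xs \<and> x < xs ! i"] by (auto simp: k_def)
  then have "xs ! (k - 1) < x" using k assms(5) by (metis less_imp_diff_less linorder_less_linear nth_mem)
  show ?thesis
  proof (rule ex1I[of _ k])
    show "k \<in> {1..length xs - 1} \<and> x \<in> {xs ! (k - 1) <..< xs ! k}"
      using k k0 \<open>xs ! (k - 1) < x\<close> by auto
    fix k' assume k': "k' \<in> {1..length xs - 1} \<and> x \<in> {xs ! (k' - 1) <..< xs ! k'}"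
    show "k' = k"
    proof (rule ccontr)
      assume "k' \<noteq> k"
      then consider "k' \<le> k - 1" | "k \<le> k' - 1" by linarith
      then show False
      proof cases
        case 1
        then have "xs ! k' \<le> xs ! (k - 1)" using mono k by simp
        then show False using k' \<open>xs ! (k - 1) < x\<close> by auto
      next
        case 2
        then have "xs ! k \<le> xs ! (k' - 1)" using mono k' by auto
        then show False using k k' by auto
      qed
    qed
  qed
qed

text \<open>Used to recover \<omega> from the digits: coordinate j is read at the visit to
  \<open>S\<close> that is preceded by exactly j earlier visits.\<close>

lemma infinite_nth_element:
  fixes A :: "nat set"
  assumes "infinite A"
  shows "\<exists>n\<in>A. card {i\<in>A. i < n} = j"
proof (induction j)
  case 0
  obtain n where "n \<in> A" using assms by fastforce
  then have l: "(LEAST n. n \<in> A) \<in> A" by (rule LeastI)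
  have "{i\<in>A. i < (LEAST n. n \<in> A)} = {}" using not_less_Least by blast
  then have "card {i\<in>A. i < (LEAST n. n \<in> A)} = 0" by simp
  then show ?case using l by blast
next
  case (Suc j)
  then obtain n where n: "n \<in> A" "card {i\<in>A. i < n} = j" by blast
  obtain k where "n < k" "k \<in> A" using assms unfolding infinite_nat_iff_unbounded by blast
  then have m: "n < (LEAST k. n < k \<and> k \<in> A) \<and> (LEAST k. n < k \<and> k \<in> A) \<in> A" (is "n < ?m \<and> _")
    using LeastI[of "\<lambda>k. n < k \<and> k \<in> A" k] by blast
  have l: "\<not> (n < i \<and> i \<in> A)" if "i < ?m" for i using not_less_Least that by blast
  have "{i\<in>A. i < ?m} = insert n {i\<in>A. i < n}"
  proof (intro set_eqI iffI)
    fix i assume "i \<in> {i\<in>A. i < ?m}"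
    then have "i \<in> A" "\<not> n < i" using l[of i] by auto
    then show "i \<in> insert n {i\<in>A. i < n}" by auto
  qed (use n m in auto)
  then have "card {i\<in>A. i < ?m} = Suc j" using n by simp
  then show ?case using m by blast
qed

section \<open>The greedy orbit of 1 and the resulting inequalities\<close>

locale multinacci =
  fixes \<beta> :: real
  assumes gen: "gen_multinacci \<beta>"
begin

abbreviation N :: nat where "N \<equiv> ndig \<beta>"

definition P :: real where "P = real N / (\<beta> - 1)"

lemma beta_gt1: "\<beta> > 1"
  using gen by (simp add: gen_multinacci_def)

lemma N_le: "real N \<le> \<beta>" and less_N1: "\<beta> < real N + 1"
  using beta_gt1 unfolding ndig_def by linarith+

lemma N_ge1: "N \<ge> 1"
  using less_N1 beta_gt1 by linarith

text \<open>\<open>P\<close> is the fixed point of the branch with digit \<open>N\<close>. This is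
  why x -> \<open>P\<close> - x conjugates the branch d to the branch \<open>N\<close> - d, a
  symmetry used throughout.\<close>

lemma beta_P: "\<beta> * P = real N + P"
  using beta_gt1 by (simp add: P_def field_simps)

text \<open>The greedy orbit of 1. The digits \<open>a i\<close> along it are numbered from 0, in
  contrast to \<open>greedy_digit\<close>.\<close>

definition g :: "nat \<Rightarrow> real" where "g i = (greedy_map \<beta> ^^ i) 1"

definition a :: "nat \<Rightarrow> nat" where "a i = greedy_digit1 \<beta> (g i)"

lemma g_0: "g 0 = 1" by (simp add: g_def)

lemma g_Suc: "g (Suc i) = \<beta> * g i - real (a i)"
  by (simp add: g_def a_def greedy_map_def)

lemma g_step: "\<beta> * g i = real (a i) + g (Suc i)"
  by (simp add: g_Suc)

lemma greedy_map_bounds: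
  assumes "0 \<le> x" "x \<le> 1"
  shows "0 \<le> greedy_map \<beta> x" "greedy_map \<beta> x < 1" "greedy_digit1 \<beta> x \<le> N"
proof -
  have bx: "0 \<le> \<beta> * x" "\<beta> * x \<le> \<beta>" using assms beta_gt1 by (auto simp: mult_left_le)
  show "0 \<le> greedy_map \<beta> x" "greedy_map \<beta> x < 1" "greedy_digit1 \<beta> x \<le> N"
  proof -
    consider "x < real N / \<beta>" | "x \<ge> real N / \<beta>" by linarith
    then have "0 \<le> greedy_map \<beta> x \<and> greedy_map \<beta> x < 1 \<and> greedy_digit1 \<beta> x \<le> N"
    proof cases
      case 1
      then have "\<beta> * x < real N" using beta_gt1 by (simp add: field_simps)
      then show ?thesis using 1 bx by (simp add: greedy_map_def greedy_digit1_def) linarith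
    next
      case 2
      then have "\<beta> * x \<ge> real N" using beta_gt1 by (simp add: field_simps)
      then show ?thesis using 2 bx less_N1 by (simp add: greedy_map_def greedy_digit1_def)
    qed
    then show "0 \<le> greedy_map \<beta> x" "greedy_map \<beta> x < 1" "greedy_digit1 \<beta> x \<le> N" by auto
  qed
qed

lemma g_bounds: "0 \<le> g i" "g i \<le> 1"
proof -
  have "0 \<le> g i \<and> g i \<le> 1"
  proof (induction i)
    case (Suc i)
    then show ?case using greedy_map_bounds[of "g i"] by (simp add: g_def)
  qed (simp add: g_0)
  then show "0 \<le> g i" "g i \<le> 1" by auto
qed

lemma g_Suc_less1: "g (Suc i) < 1"
  using greedy_map_bounds[of "g i"] g_bounds[of i] by (simp add: g_def)

lemma a_le: "a i \<le> N"
  using greedy_map_bounds[of "g i"] g_bounds[of i] by (simp add: a_def)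

lemma a_0: "a 0 = N"
  using N_le beta_gt1 by (simp add: a_def g_0 greedy_digit1_def field_simps)

text \<open>The remainder after n digits is \<open>g n\<close> / \<beta>^n, so a finite expansion of
  1 means that the orbit reaches 0.\<close>

lemma greedy_sum: "(\<Sum>j=1..n. real (greedy_digit \<beta> j 1) / \<beta> ^ j) = 1 - g n / \<beta> ^ n"
proof (induction n)
  case (Suc n)
  have "greedy_digit \<beta> (Suc n) 1 = a n" by (simp add: greedy_digit_def a_def g_def)
  then have "(\<Sum>j=1..Suc n. real (greedy_digit \<beta> j 1) / \<beta> ^ j) = 1 - g n / \<beta> ^ n + a n / \<beta> ^ Suc n"
    using Suc by simp
  also have "\<dots> = 1 - g (Suc n) / \<beta> ^ Suc n"
    using beta_gt1 by (simp add: g_Suc field_simps)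
  finally show ?case .
qed (simp add: g_0)

lemma ex_len: "\<exists>n\<ge>2. g n = 0 \<and> (\<forall>i<n. a i \<ge> 1)"
proof -
  obtain n where n: "n \<ge> 2" "\<forall>j\<in>{1..n}. greedy_digit \<beta> j 1 \<ge> 1"
    "1 = (\<Sum>j=1..n. real (greedy_digit \<beta> j 1) / \<beta> ^ j)"
    using gen by (auto simp: gen_multinacci_def)
  have "g n = 0" using n(3) beta_gt1 unfolding greedy_sum by simp
  moreover have "a i \<ge> 1" if "i < n" for i
    using n(2)[rule_format, of "Suc i"] that by (simp add: greedy_digit_def a_def g_def)
  ultimately show ?thesis using n(1) by auto
qed

definition len :: nat where "len = (SOME n. n \<ge> 2 \<and> g n = 0 \<and> (\<forall>i<n. a i \<ge> 1))"

lemma len: "len \<ge> 2" "g len = 0" "i < len \<Longrightarrow> a i \<ge> 1"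
proof -
  have "len \<ge> 2 \<and> g len = 0 \<and> (\<forall>i<len. a i \<ge> 1)"
    unfolding len_def by (rule someI_ex) (use ex_len in auto)
  then show "len \<ge> 2" "g len = 0" "i < len \<Longrightarrow> a i \<ge> 1" by auto
qed

text \<open>Here the positivity of the greedy digits enters: a digit of at least 1 forces \<beta> *
  \<open>g i\<close> \<ge> 1.\<close>

lemma g_ge: "i < len \<Longrightarrow> g i \<ge> 1 / \<beta>"
proof -
  assume "i < len"
  then have "\<beta> * g i \<ge> 1" using g_step[of i] len(3)[of i] g_bounds[of "Suc i"] by linarith
  then show ?thesis using beta_gt1 by (simp add: field_simps)
qed

text \<open>The inequality is a rearrangement of \<beta>(\<beta> - \<open>N\<close>) \<ge> 1, that
  is of \<open>g 1\<close> \<ge> 1/\<beta>, which holds because the expansion of 1 has at least two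
  digits. With \<open>g_ge\<close> it keeps the greedy orbit out of the interiors of the switch
  regions.\<close>

lemma P_le: "P - 1 \<le> 1 / \<beta>"
proof -
  have "g 1 \<ge> 1 / \<beta>" using g_ge len(1) by auto
  then have "\<beta> - real N \<ge> 1 / \<beta>" by (simp add: g_Suc g_0 a_0)
  then have "\<beta> * \<beta> - \<beta> * real N \<ge> 1" using beta_gt1 by (simp add: field_simps)
  then show ?thesis using beta_gt1 by (simp add: P_def field_simps)
qed

lemma N_less: "real N < \<beta>"
proof -
  have "g 1 \<ge> 1 / \<beta>" using g_ge len(1) by auto
  then have "\<beta> - real N \<ge> 1 / \<beta>" by (simp add: g_Suc g_0 a_0)
  moreover have "1 / \<beta> > 0" using beta_gt1 by simp
  ultimately show ?thesis by linarith
qed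

lemma P_gt1: "P > 1"
  using less_N1 beta_gt1 by (simp add: P_def field_simps)

lemma P_less2: "P < 2"
  using P_le beta_gt1 by (smt (verit) divide_less_eq_1)

lemma ceil_beta: "real_of_int \<lceil>\<beta>\<rceil> = real N + 1"
proof -
  have "\<lceil>\<beta>\<rceil> = int N + 1" using N_less less_N1 by (simp add: ceiling_eq_iff)
  then show ?thesis by simp
qed

section \<open>Switch regions, admissible digits and a single step of the random map\<close>

lemma expI_eq: "expI \<beta> = {0..P}" by (simp add: expI_def P_def)

lemma c_eq: "real N / (\<beta> * (\<beta> - 1)) = P / \<beta>" by (simp add: P_def)

text \<open>The condition is read off from the image: branch k maps S_k onto {0..\<open>P\<close> -
  1} and branch k - 1 maps it onto {1..\<open>P\<close>}.\<close>

lemma mem_S: "x \<in> rand_S \<beta> k \<longleftrightarrow> 0 \<le> \<beta> * x - real k \<and> \<beta> * x - real k \<le> P - 1"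
proof -
  have "P / \<beta> + (real k - 1) / \<beta> = (P - 1 + real k) / \<beta>" by (simp add: add_divide_distrib[symmetric] algebra_simps)
  then show ?thesis using beta_gt1
    unfolding rand_S_def c_eq by (auto simp: field_simps)
qed

lemma mem_E:
  assumes "k \<le> N" 
  shows "x \<in> rand_E \<beta> k \<longleftrightarrow> x \<in> {0..P} \<and> (k = 0 \<or> \<beta> * x - real k > P - 1) \<and> (k = N \<or> \<beta> * x - real k < 1)"
proof -
  have e1: "x > P / \<beta> + (real k - 1) / \<beta> \<longleftrightarrow> \<beta> * x - real k > P - 1" for k
    using beta_gt1 by (simp add: field_simps add_divide_distrib[symmetric])
  have e2: "x < (real k + 1) / \<beta> \<longleftrightarrow> \<beta> * x - real k < 1" for k
    using beta_gt1 by (simp add: field_simps)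
  have e3: "P - 1 < \<beta> * x - real k \<Longrightarrow> 0 \<le> x" 
  proof -
    assume "P - 1 < \<beta> * x - real k"
    then have "\<beta> * x > 0" using P_gt1 by linarith
    then show ?thesis using beta_gt1 by (simp add: zero_less_mult_iff)
  qed
  have e4: "\<beta> * x - real k < 1 \<Longrightarrow> k \<noteq> N \<Longrightarrow> x \<le> P"
  proof -
    assume "\<beta> * x - real k < 1" "k \<noteq> N"
    then have "\<beta> * x \<le> real N" using assms by linarith
    then have "\<beta> * x \<le> \<beta> * P" using beta_P P_gt1 by linarith
    then show ?thesis using beta_gt1 by simp
  qed
  have p: "real N / (\<beta> - 1) = P" by (simp add: P_def)
  show ?thesis
  proof (cases "k = 0")
    case True
    then show ?thesis using N_ge1 e2[of 0] e4 unfolding rand_E_def Let_def by auto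
  next
    case False
    then show ?thesis using e1 e2 e3 e4 unfolding rand_E_def Let_def c_eq p
      by (auto simp: not_le)
  qed
qed

definition S :: "real set" where "S = switch_region \<beta>"

lemma mem_switch: "x \<in> S \<longleftrightarrow> (\<exists>k\<in>{1..N}. 0 \<le> \<beta> * x - real k \<and> \<beta> * x - real k \<le> P - 1)"
  by (simp add: S_def switch_region_def mem_S)

text \<open>Off \<open>S\<close> only one digit keeps the image in {0..\<open>P\<close>}: if d and d
  + 1 both did, x would lie in S_(d+1).\<close>

lemma E_index_eq:
  assumes "x \<notin> S" "0 \<le> y" "y \<le> P" "d \<le> N" "\<beta> * x = real d + y"
  shows "E_index \<beta> x = d"
  unfolding E_index_def
proof (rule the_equality)
  have x: "x \<in> {0..P}"
  proof -
    have "0 \<le> \<beta> * x" using assms by simp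
    moreover have "\<beta> * x \<le> \<beta> * P" using assms beta_P by simp
    ultimately show ?thesis using beta_gt1 by (simp add: zero_le_mult_iff)
  qed
  have 1: "d = 0 \<or> y > P - 1"
    using assms unfolding mem_switch by (force simp: not_le)
  have 2: "d = N \<or> y < 1"
  proof (rule ccontr)
    assume "\<not> ?thesis"
    then have "Suc d \<in> {1..N}" "0 \<le> \<beta> * x - real (Suc d)" "\<beta> * x - real (Suc d) \<le> P - 1" using assms by auto
    then show False using assms(1) unfolding mem_switch by blast
  qed
  show "d \<in> {0..N} \<and> x \<in> rand_E \<beta> d" using assms 1 2 x by (simp add: mem_E)
  fix k assume "k \<in> {0..N} \<and> x \<in> rand_E \<beta> k"
  then have k: "k \<le> N" "k = 0 \<or> \<beta> * x - real k > P - 1" "k = N \<or> \<beta> * x - real k < 1" by (auto simp: mem_E)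
  show "k = d"
  proof (rule ccontr)
    assume "k \<noteq> d"
    then consider "k < d" | "d < k" by linarith
    then show False
    proof cases
      assume "k < d"
      then have "real d \<ge> real k + 1" "k \<noteq> N" "d \<noteq> 0" using assms by auto
      then show False using k 1 2 assms P_gt1 by linarith
    next
      assume "d < k"
      then have "real k \<ge> real d + 1" "d \<noteq> N" "k \<noteq> 0" using k by auto
      then show False using k 1 2 assms P_gt1 by linarith
    qed
  qed
qed

lemma S_index_eq:
  assumes "0 \<le> y" "y \<le> P - 1" "1 \<le> d" "d \<le> N" "\<beta> * x = real d + y"
  shows "S_index \<beta> x = d"
  unfolding S_index_def
proof (rule the_equality)
  show "d \<in> {1..N} \<and> x \<in> rand_S \<beta> d" using assms by (simp add: mem_S)
  fix k assume "k \<in> {1..N} \<and> x \<in> rand_S \<beta> k"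
  then show "k = d" using assms P_less2 by (auto simp: mem_S)
qed

lemma digit_exists:
  assumes "x \<in> {0..P}"
  shows "\<exists>d y. d \<le> N \<and> 0 \<le> y \<and> y \<le> P \<and> \<beta> * x = real d + y"
proof (cases "\<beta> * x < real N")
  case True
  have "0 \<le> \<beta> * x" using assms beta_gt1 by simp
  then show ?thesis using True P_gt1
    by (intro exI[of _ "nat \<lfloor>\<beta> * x\<rfloor>"] exI[of _ "\<beta> * x - nat \<lfloor>\<beta> * x\<rfloor>"]) (simp, linarith)
next
  case False
  have "\<beta> * x \<le> \<beta> * P" using assms beta_gt1 by simp
  then show ?thesis using False beta_P
    by (intro exI[of _ N] exI[of _ "\<beta> * x - N"]) simp
qed

lemma x_range: 
  assumes "d \<le> N" "0 \<le> y" "y \<le> P" "\<beta> * x = real d + y"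
  shows "x \<in> {0..P}"
proof -
  have "0 \<le> \<beta> * x" using assms by simp
  moreover have "\<beta> * x \<le> \<beta> * P" using assms beta_P by simp
  ultimately show ?thesis using beta_gt1 by (simp add: zero_le_mult_iff)
qed

text \<open>Since \<open>P\<close> < 2, the images {0..\<open>P\<close> - 1} and
  {1..\<open>P\<close>} of S_k are disjoint, so the position of y tells whether d is the larger or
  the smaller of the two digits.\<close>

lemma digit_S:
  assumes "x \<in> S" "d \<le> N" "0 \<le> y" "y \<le> P" "\<beta> * x = real d + y"
  shows "(y \<le> P - 1 \<and> 1 \<le> d \<and> S_index \<beta> x = d) \<or> (y \<ge> 1 \<and> d < N \<and> S_index \<beta> x = Suc d)"
proof -
  obtain k where k: "k \<in> {1..N}" "0 \<le> \<beta> * x - real k" "\<beta> * x - real k \<le> P - 1"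
    using assms(1) mem_switch by blast
  have ix: "S_index \<beta> x = k" using k by (intro S_index_eq[of "\<beta> * x - real k"]) auto
  have "k = d \<or> k = Suc d"
    using k assms P_less2 by linarith
  then show ?thesis using k ix assms by auto
qed

text \<open>Replaces the indices \<open>E_index\<close> and \<open>S_index\<close> by arithmetic: a
  digit with admissible image is the one taken by the map as soon as the coin agrees, where coin 1
  means the larger digit, hence an image of at most \<open>P - 1\<close>.\<close>

lemma rand_step:
  assumes "d \<le> N" "0 \<le> y" "y \<le> P" "\<beta> * x = real d + y"
    and "x \<in> S \<Longrightarrow> \<omega> 0 \<longleftrightarrow> y \<le> P - 1"
  shows "rand_digit1 \<beta> (\<omega>, x) = d"
    and "rand_K \<beta> (\<omega>, x) = ((if x \<in> S then (\<lambda>n. \<omega> (Suc n)) else \<omega>), y)"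
proof -
  have "rand_digit1 \<beta> (\<omega>, x) = d \<and> rand_K \<beta> (\<omega>, x) = ((if x \<in> S then (\<lambda>n. \<omega> (Suc n)) else \<omega>), y)"
  proof (cases "x \<in> S")
    case True
    then have w: "\<omega> 0 \<longleftrightarrow> y \<le> P - 1" using assms by blast
    from digit_S[OF True assms(1-4)] show ?thesis using w True P_less2 assms(4)
      by (auto simp: rand_digit1_def rand_K_def S_def[symmetric] rand_T_def)
  next
    case False
    then show ?thesis using E_index_eq[OF False assms(2,3,1,4)] assms(4)
      by (auto simp: rand_digit1_def rand_K_def S_def[symmetric] rand_T_def)
  qed
  then show "rand_digit1 \<beta> (\<omega>, x) = d"
    and "rand_K \<beta> (\<omega>, x) = ((if x \<in> S then (\<lambda>n. \<omega> (Suc n)) else \<omega>), y)" by auto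
qed

lemma rand_digit1_props:
  assumes "x \<in> {0..P}"
  shows "rand_digit1 \<beta> (\<omega>, x) \<le> N"
    and "\<beta> * x - real (rand_digit1 \<beta> (\<omega>, x)) \<in> {0..P}"
    and "x \<in> S \<Longrightarrow> \<omega> 0 \<longleftrightarrow> \<beta> * x - real (rand_digit1 \<beta> (\<omega>, x)) \<le> P - 1"
    and "rand_K \<beta> (\<omega>, x) = ((if x \<in> S then (\<lambda>n. \<omega> (Suc n)) else \<omega>),
           \<beta> * x - real (rand_digit1 \<beta> (\<omega>, x)))"
proof -
  have "\<exists>d y. d \<le> N \<and> 0 \<le> y \<and> y \<le> P \<and> \<beta> * x = real d + y \<and> (x \<in> S \<longrightarrow> \<omega> 0 = (y \<le> P - 1))"
  proof (cases "x \<in> S")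
    case False then show ?thesis using digit_exists[OF assms] by blast
  next
    case True
    then obtain k where k: "k \<in> {1..N}" "0 \<le> \<beta> * x - real k" "\<beta> * x - real k \<le> P - 1"
      using mem_switch by blast
    show ?thesis
    proof (cases "\<omega> 0")
      case True
      then show ?thesis using k P_gt1 by (intro exI[of _ k] exI[of _ "\<beta> * x - real k"]) auto
    next
      case False
      then show ?thesis using k P_less2
        by (intro exI[of _ "k-1"] exI[of _ "\<beta> * x - real k + 1"]) (auto simp: of_nat_diff)
    qed
  qed
  then obtain d y where d: "d \<le> N" "0 \<le> y" "y \<le> P" "\<beta> * x = real d + y" "x \<in> S \<Longrightarrow> \<omega> 0 = (y \<le> P - 1)"
    by blast
  note r = rand_step[of d y x \<omega>, OF d]
  show "rand_digit1 \<beta> (\<omega>, x) \<le> N"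
    and "\<beta> * x - real (rand_digit1 \<beta> (\<omega>, x)) \<in> {0..P}"
    and "x \<in> S \<Longrightarrow> \<omega> 0 \<longleftrightarrow> \<beta> * x - real (rand_digit1 \<beta> (\<omega>, x)) \<le> P - 1"
    and "rand_K \<beta> (\<omega>, x) = ((if x \<in> S then (\<lambda>n. \<omega> (Suc n)) else \<omega>),
           \<beta> * x - real (rand_digit1 \<beta> (\<omega>, x)))"
    using r d by auto
qed

subsection \<open>The coding partition\<close>

definition F :: "real set" where "F = coding_F \<beta>"

abbreviation K where "K \<equiv> rand_K \<beta>"

lemma K_range:
  assumes "x \<in> {0..P}"
  shows "snd ((K ^^ n) (\<omega>, x)) \<in> {0..P}"
proof (induction n)
  case (Suc n)
  obtain w y where "(K ^^ n) (\<omega>, x) = (w, y)" by fastforce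
  then show ?case using Suc rand_digit1_props(2,4)[of y w] by simp
qed (use assms in simp)

lemma K_eq:
  assumes "x \<in> {0..P}" "d \<le> N" "\<beta> * x - real d \<in> {0..P}"
    "x \<in> S \<Longrightarrow> \<omega> 0 \<longleftrightarrow> \<beta> * x - real d \<le> P - 1"
  shows "snd (K (\<omega>, x)) = \<beta> * x - real d"
  using rand_step(2)[of d "\<beta> * x - real d" x \<omega>] assms by auto

text \<open>The digits of \<open>\<omega>\<close> not used by the first \<open>n\<close> steps can be chosen freely.\<close>

lemma K_free:
  assumes "x \<in> {0..P}"
  shows "\<exists>\<omega>''. (K ^^ n) (\<omega>'', x) = (\<omega>', snd ((K ^^ n) (\<omega>, x)))"
  using assms
proof (induction n arbitrary: \<omega> x)
  case (Suc n)
  let ?y = "\<beta> * x - real (rand_digit1 \<beta> (\<omega>, x))"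
  note p = rand_digit1_props[OF Suc.prems, of \<omega>]
  from Suc.IH[OF p(2)] obtain w where
    w: "(K ^^ n) (w, ?y) = (\<omega>', snd ((K ^^ n) (if x \<in> S then (\<lambda>n. \<omega> (Suc n)) else \<omega>, ?y)))" by blast
  let ?w = "if x \<in> S then case_nat (\<omega> 0) w else w"
  have "rand_digit1 \<beta> (?w, x) = rand_digit1 \<beta> (\<omega>, x)"
    by (simp add: rand_digit1_def S_def[symmetric])
  then have "K (?w, x) = (w, ?y)"
    using rand_digit1_props(4)[OF Suc.prems, of ?w] by auto
  then have "(K ^^ Suc n) (?w, x) = (\<omega>', snd ((K ^^ Suc n) (\<omega>, x)))"
    using w p(4) by (simp add: funpow_swap1)
  then show ?case by blast
qed simp

lemma mem_F: "f \<in> F \<longleftrightarrow> (\<exists>n \<omega>. f = snd ((K ^^ n) (\<omega>, 1)) \<or> f = snd ((K ^^ n) (\<omega>, P - 1)))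
   \<or> (\<exists>k\<le>N. f = real k / \<beta> \<or> f = (real k + P) / \<beta>)"
proof -
  have "real N / (\<beta> * (\<beta> - 1)) + real k / \<beta> = (real k + P) / \<beta>" for k
    unfolding c_eq by (simp add: add_divide_distrib)
  then show ?thesis unfolding F_def coding_F_def P_def[symmetric]
    by (auto simp: P_def[symmetric])
qed

lemma one_F: "1 \<in> F" 
  unfolding mem_F by (rule disjI1, intro exI[of _ 0] exI[of _ undefined]) simp

lemma s_F: "P - 1 \<in> F"
  unfolding mem_F by (rule disjI1, intro exI[of _ 0] exI[of _ undefined]) simp

lemma k_F: "k \<le> N \<Longrightarrow> real k / \<beta> \<in> F" "k \<le> N \<Longrightarrow> (real k + P) / \<beta> \<in> F"
  unfolding mem_F by auto

lemma ks_F: "1 \<le> k \<Longrightarrow> k \<le> N \<Longrightarrow> (real k + P - 1) / \<beta> \<in> F"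
  using k_F(2)[of "k - 1"] by (simp add: of_nat_diff algebra_simps)

lemma zero_F: "0 \<in> F" using k_F(1)[of 0] by simp

lemma P_F: "P \<in> F"
proof -
  have "P = (real N + P) / \<beta>" using beta_P beta_gt1 by (simp add: field_simps)
  then show ?thesis using k_F(2)[of N] by simp
qed

lemma K_reach:
  assumes "x \<in> {0..P}" "d \<le> N" "\<beta> * x - real d \<in> {0..P}"
  shows "\<exists>\<omega>. snd (K (\<omega>, x)) = \<beta> * x - real d"
  using K_eq[OF assms, of "\<lambda>_. \<beta> * x - real d \<le> P - 1"] by auto

text \<open>The digit d may differ from the one that \<omega> dictates. \<open>K_free\<close>
  changes \<omega> so that the first n positions stay attainable while the next coin favours
  d.\<close>

lemma orbit_closed:
  assumes "x \<in> {0..P}" "d \<le> N" "\<beta> * snd ((K ^^ n) (\<omega>, x)) - real d \<in> {0..P}"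
  shows "\<exists>n' \<omega>'. \<beta> * snd ((K ^^ n) (\<omega>, x)) - real d = snd ((K ^^ n') (\<omega>', x))"
proof -
  let ?y = "snd ((K ^^ n) (\<omega>, x))"
  obtain w where w: "snd (K (w, ?y)) = \<beta> * ?y - real d" using K_reach[OF K_range] assms by blast
  obtain v where "(K ^^ n) (v, x) = (w, ?y)" using K_free assms by blast
  then have "snd ((K ^^ Suc n) (v, x)) = \<beta> * ?y - real d" using w by simp
  then show ?thesis by metis
qed

text \<open>Orbit points are covered by \<open>orbit_closed\<close>. Admissible branches send
  k/\<beta> to 0 or 1 and (k + \<open>P\<close>)/\<beta> to \<open>P\<close> or
  \<open>P - 1\<close>, all of which belong to \<open>F\<close>.\<close>

lemma F_closed:
  assumes "f \<in> F" "d \<le> N" "\<beta> * f - real d \<in> {0..P}"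
  shows "\<beta> * f - real d \<in> F"
proof -
  have s: "1 \<in> {0..P}" "P - 1 \<in> {0..P}" using P_gt1 by auto
  consider (1) n \<omega> where "f = snd ((K ^^ n) (\<omega>, 1))" | (2) n \<omega> where "f = snd ((K ^^ n) (\<omega>, P - 1))"
    | (3) k where "k \<le> N" "f = real k / \<beta>" | (4) k where "k \<le> N" "f = (real k + P) / \<beta>"
    using assms(1) unfolding mem_F by blast
  then show ?thesis
  proof cases
    case 1 then show ?thesis using orbit_closed[OF s(1) assms(2)] assms(3) mem_F by metis
  next
    case 2 then show ?thesis using orbit_closed[OF s(2) assms(2)] assms(3) mem_F by metis
  next
    case 3
    then have "\<beta> * f - real d = real k - real d" using beta_gt1 by simp
    moreover have "k = d \<or> k = Suc d" using assms(3) P_less2 calculation by auto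
    ultimately show ?thesis using zero_F one_F by auto
  next
    case 4
    then have "\<beta> * f - real d = real k + P - real d" using beta_gt1 by simp
    moreover have "d = k \<or> d = Suc k" using assms(3) P_less2 calculation by auto
    ultimately show ?thesis using P_F s_F by auto
  qed
qed

section \<open>A finite set closed under all branches that contains the partition points\<close>

text \<open>\<open>H\<close> collects the greedy orbit of 1 before it reaches 0 and the left end
  points k/\<beta>. \<open>G\<close> completes it under reflection and is an upper bound for
  \<open>F\<close> that is finite by construction.\<close>

definition H :: "real set" where "H = g ` {..<len} \<union> (\<lambda>k. real k / \<beta>) ` {..N}"

definition G :: "real set" where "G = H \<union> (\<lambda>y. P - y) ` H"

lemma G_mirror: "y \<in> G \<Longrightarrow> P - y \<in> G" by (auto simp: G_def)

lemma zero_G: "0 \<in> G" and one_G: "1 \<in> G"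
proof -
  have "0 = real 0 / \<beta>" by simp
  then show "0 \<in> G" unfolding G_def H_def by blast
  have "1 = g 0" "0 < len" using g_0 len(1) by auto
  then show "1 \<in> G" unfolding G_def H_def by blast
qed

lemma P_G: "P \<in> G" and s_G: "P - 1 \<in> G"
  using G_mirror[OF zero_G] G_mirror[OF one_G] by auto

text \<open>By \<open>g_ge\<close> and \<open>P_le\<close> the next greedy point is 0 or lies
  between \<open>P - 1\<close> and 1. Both closure under branches and avoidance of the interiors of
  the S_k follow from this normal form.\<close>

lemma H_form:
  assumes "h \<in> H"
  obtains k y where "k \<le> N" "\<beta> * h = real k + y" "y = 0 \<or> y \<in> H \<and> P - 1 \<le> y \<and> y < 1"
proof -
  from assms consider i where "i < len" "h = g i" | k where "k \<le> N" "h = real k / \<beta>"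
    unfolding H_def by blast
  then show ?thesis
  proof cases
    case 1
    show ?thesis
    proof (cases "Suc i < len")
      case True
      have "g (Suc i) \<in> H \<and> P - 1 \<le> g (Suc i) \<and> g (Suc i) < 1"
        using True g_ge[of "Suc i"] P_le g_Suc_less1[of i] by (auto simp: H_def)
      then show ?thesis using that[of "a i" "g (Suc i)"] 1 g_step[of i] a_le by auto
    next
      case False
      then have "Suc i = len" using 1 by simp
      then show ?thesis using that[of "a i" 0] 1 g_step[of i] a_le len(2) by auto
    qed
  next
    case 2 then show ?thesis using that[of k 0] beta_gt1 by auto
  qed
qed

text \<open>Besides the digit k of the normal form only k - 1 can be admissible. It gives 1 + y
  \<le> \<open>P\<close>, which leaves y = 0 or y = \<open>P - 1\<close>, with image 1 or
  \<open>P\<close>.\<close>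

lemma H_closed:
  assumes "h \<in> H" "\<beta> * h - real d \<in> {0..P}"
  shows "\<beta> * h - real d \<in> G"
proof -
  obtain k y where k: "k \<le> N" "\<beta> * h = real k + y" "y = 0 \<or> y \<in> H \<and> P - 1 \<le> y \<and> y < 1"
    using H_form[OF assms(1)] by blast
  have "d = k \<or> k = Suc d" using k assms(2) P_less2 P_gt1 by auto
  then show ?thesis
  proof
    assume "d = k" then show ?thesis using k zero_G by (auto simp: G_def)
  next
    assume d: "k = Suc d"
    then have e: "\<beta> * h - real d = 1 + y" using k by simp
    show ?thesis
    proof (cases "y = 0")
      case True then show ?thesis using e one_G by simp
    next
      case False
      then have "y = P - 1" using k e assms(2) by auto
      then show ?thesis using e P_G by simp
    qed
  qed
qed

lemma G_closed:
  assumes "h \<in> G" "d \<le> N" "\<beta> * h - real d \<in> {0..P}"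
  shows "\<beta> * h - real d \<in> G"
proof (cases "h \<in> H")
  case True then show ?thesis using H_closed assms by blast
next
  case False
  then obtain y where y: "y \<in> H" "h = P - y" using assms(1) by (auto simp: G_def)
  have e: "\<beta> * h - real d = P - (\<beta> * y - real (N - d))"
    using beta_P assms(2) by (simp add: y(2) right_diff_distrib of_nat_diff)
  then have "\<beta> * y - real (N - d) \<in> {0..P}" using assms(3) by auto
  then show ?thesis using e G_mirror H_closed[OF y(1)] by simp
qed

lemma orbit_G:
  assumes "x \<in> G" "x \<in> {0..P}"
  shows "snd ((K ^^ n) (\<omega>, x)) \<in> G"
proof (induction n)
  case (Suc n)
  obtain w y where w: "(K ^^ n) (\<omega>, x) = (w, y)" by fastforce
  then have "y \<in> {0..P}" using K_range[OF assms(2), of n \<omega>] by simp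
  then show ?case using Suc w rand_digit1_props[of y w] G_closed[of y] by simp
qed (use assms in simp)

text \<open>The starting points 1 and \<open>P - 1\<close> lie in \<open>G\<close>, and (k +
  \<open>P\<close>)/\<beta> is the reflection of (\<open>N\<close> - k)/\<beta>.\<close>

lemma F_subset_G: "F \<subseteq> G"
proof
  fix f assume "f \<in> F"
  then consider (1) n \<omega> where "f = snd ((K ^^ n) (\<omega>, 1))" | (2) n \<omega> where "f = snd ((K ^^ n) (\<omega>, P - 1))"
    | (3) k where "k \<le> N" "f = real k / \<beta>" | (4) k where "k \<le> N" "f = (real k + P) / \<beta>"
    unfolding mem_F by blast
  then show "f \<in> G"
  proof cases
    case 1 then show ?thesis using orbit_G[OF one_G] P_gt1 by auto
  next
    case 2 then show ?thesis using orbit_G[OF s_G] P_gt1 by auto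
  next
    case 3 then show ?thesis by (auto simp: G_def H_def)
  next
    case 4
    then have "\<beta> * f = real k + P" using beta_gt1 by simp
    moreover have "\<beta> * (P - real (N - k) / \<beta>) = \<beta> * P - real (N - k)"
      using beta_gt1 by (simp add: right_diff_distrib)
    ultimately have "\<beta> * f = \<beta> * (P - real (N - k) / \<beta>)"
      using 4(1) beta_P by (simp add: of_nat_diff)
    then have "f = P - real (N - k) / \<beta>" using beta_gt1 by simp
    moreover have "real (N - k) / \<beta> \<in> G" by (auto simp: G_def H_def)
    ultimately show ?thesis using G_mirror by simp
  qed
qed

lemma finite_F: "finite F"
  using F_subset_G by (rule finite_subset) (simp add: G_def H_def)

text \<open>In the normal form \<beta>h - k is y plus an integer, where y = 0 or
  \<open>P - 1\<close> \<le> y < 1. No such number lies strictly between 0 and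
  \<open>P - 1\<close>.\<close>

lemma H_not_S:
  assumes "h \<in> H"
  shows "\<not> (0 < \<beta> * h - real k \<and> \<beta> * h - real k < P - 1)"
proof -
  obtain j y where j: "j \<le> N" "\<beta> * h = real j + y" "y = 0 \<or> y \<in> H \<and> P - 1 \<le> y \<and> y < 1"
    using H_form[OF assms(1)] by blast
  consider "k \<le> j" | "k \<ge> Suc j" by linarith
  then show ?thesis using j P_less2 P_gt1 
  proof cases
    case 1 
    then consider "k = j" | "real j \<ge> real k + 1" by (auto simp: le_less) linarith
    then show ?thesis using j P_less2 by cases auto
  next
    case 2
    then have "real k \<ge> real j + 1" by simp
    then show ?thesis using j by auto
  qed
qed

text \<open>For points outside \<open>H\<close>, reflection carries S_k to S_(N+1-k) and reduces the
  claim to \<open>H_not_S\<close>.\<close>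

lemma F_not_S:
  assumes "f \<in> F" "1 \<le> k" "k \<le> N"
  shows "\<not> (0 < \<beta> * f - real k \<and> \<beta> * f - real k < P - 1)"
proof (cases "f \<in> H")
  case True then show ?thesis using H_not_S by blast
next
  case False
  then obtain y where y: "y \<in> H" "f = P - y" using assms(1) F_subset_G by (auto simp: G_def)
  have "\<beta> * f - real k = P - 1 - (\<beta> * y - real (Suc N - k))"
    using beta_P assms(3) by (simp add: y(2) right_diff_distrib of_nat_diff)
  then show ?thesis using H_not_S[OF y(1), of "Suc N - k"] by auto
qed

section \<open>Cells of the partition and the Markov property\<close>

text \<open>Comparing positions relative to every point of \<open>F\<close> replaces the enumeration
  of the gaps: off \<open>F\<close> this is the gap around x, and at a point of \<open>F\<close> in
  the interval it is that single point.\<close>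

definition cell :: "real \<Rightarrow> real set" where
  "cell x = {y \<in> {0..P}. \<forall>f\<in>F. (f < y \<longleftrightarrow> f < x) \<and> (y < f \<longleftrightarrow> x < f)}"

lemma cell_self: "x \<in> {0..P} \<Longrightarrow> x \<in> cell x" by (simp add: cell_def)

lemma cell_range: "y \<in> cell x \<Longrightarrow> y \<in> {0..P}" by (simp add: cell_def)

lemma cell_eq: "y \<in> cell x \<Longrightarrow> cell y = cell x" by (auto simp: cell_def)

lemma cell_not_F: "y \<in> cell x \<Longrightarrow> x \<notin> F \<Longrightarrow> y \<notin> F"
  unfolding cell_def using linorder_neq_iff[of y x] by blast

text \<open>Markov property: since \<open>F\<close> is forward closed, inverse branches map cells into cells.\<close>

lemma cell_pull:
  assumes "d \<le> N" "x' \<in> {0..P}" "y' \<in> cell x'" "\<beta> * x = real d + x'" "\<beta> * y = real d + y'"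
  shows "y \<in> cell x"
proof -
  have yr: "y' \<in> {0..P}" using assms(3) cell_range by blast
  then have "y \<in> {0..P}" using x_range[of d y' y] assms by auto
  moreover have "(f < y \<longleftrightarrow> f < x) \<and> (y < f \<longleftrightarrow> x < f)" if f: "f \<in> F" for f
  proof -
    let ?f = "\<beta> * f - real d"
    have e: "f < y \<longleftrightarrow> ?f < y'" "f < x \<longleftrightarrow> ?f < x'" "y < f \<longleftrightarrow> y' < ?f" "x < f \<longleftrightarrow> x' < ?f"
    proof -
      have "f < y \<longleftrightarrow> \<beta> * f < \<beta> * y" "f < x \<longleftrightarrow> \<beta> * f < \<beta> * x" "y < f \<longleftrightarrow> \<beta> * y < \<beta> * f" "x < f \<longleftrightarrow> \<beta> * x < \<beta> * f"
        using beta_gt1 by simp_all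
      then show "f < y \<longleftrightarrow> ?f < y'" "f < x \<longleftrightarrow> ?f < x'" "y < f \<longleftrightarrow> y' < ?f" "x < f \<longleftrightarrow> x' < ?f"
        using assms(4,5) by auto
    qed
    show ?thesis
    proof (cases "?f \<in> {0..P}")
      case True
      then have "?f \<in> F" using F_closed f assms(1) by blast
      then have "(?f < y' \<longleftrightarrow> ?f < x') \<and> (y' < ?f \<longleftrightarrow> x' < ?f)" using assms(3) by (simp add: cell_def)
      then show ?thesis by (simp add: e)
    next
      case False
      then have "(?f < y' \<longleftrightarrow> ?f < x') \<and> (y' < ?f \<longleftrightarrow> x' < ?f)" using assms(2) yr by auto
      then show ?thesis by (simp add: e)
    qed
  qed
  ultimately show ?thesis unfolding cell_def by blast
qed

lemma pull_not_F:
  assumes "d \<le> N" "x' \<in> {0..P}" "x' \<notin> F" "\<beta> * x = real d + x'"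
  shows "x \<notin> F"
  using F_closed[of x d] assms by auto

text \<open>\<open>F\<close> contains all k/\<beta> with k \<le> \<open>N\<close> and the right end
  point of S_N, so no gap holds two points at distance 1/\<beta> or more.\<close>

lemma cell_diff:
  assumes "x \<in> {0..P}" "x \<notin> F" "y \<in> cell x"
  shows "y < x + 1 / \<beta>"
proof (rule ccontr)
  assume "\<not> ?thesis"
  then have xy: "\<beta> * y \<ge> \<beta> * x + 1" using beta_gt1 by (simp add: field_simps)
  have yF: "y \<notin> F" and yr: "y \<in> {0..P}" using cell_not_F cell_range assms by auto
  show False
  proof (cases "\<beta> * y < real N + 1")
    case True
    have y0: "0 \<le> \<beta> * y" using yr beta_gt1 by simp
    define k where "k = nat \<lfloor>\<beta> * y\<rfloor>"
    have k: "real k \<le> \<beta> * y" "\<beta> * y < real k + 1" using y0 by (auto simp: k_def)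
    then have "k \<le> N" using True by linarith
    then have f: "real k / \<beta> \<in> F" using k_F by blast
    have "\<not> y < real k / \<beta>" using k beta_gt1 by (simp add: field_simps)
    then have "\<not> x < real k / \<beta>" using f assms(3) by (auto simp: cell_def)
    then show False using k xy beta_gt1 by (simp add: field_simps)
  next
    case False
    \<comment> \<open>From (\<open>N\<close> + 1)/\<beta> on, the right end point of S_N plays the
      role of the separating multiple of 1/\<beta>; if x lies beyond it, then y exceeds
      \<open>P\<close>.\<close>
    have f: "(real N + P - 1) / \<beta> \<in> F" using ks_F N_ge1 by auto
    have "(real N + P - 1) / \<beta> < y" using False P_less2 beta_gt1 by (simp add: field_simps)
    then have "(real N + P - 1) / \<beta> < x" using f assms(3) by (auto simp: cell_def)
    then have "real N + P - 1 < \<beta> * x" using beta_gt1 by (simp add: field_simps)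
    then have "\<beta> * y > \<beta> * P" using xy beta_P by simp
    then show False using yr beta_gt1 by simp
  qed
qed

text \<open>Pulling y' back along the digit of x gives a point z in the cell of x'. Hence z and x'
  differ by less than 1/\<beta>, and their digits by less than 1.\<close>

lemma cell_digit:
  assumes "d \<le> N" "d' \<le> N" "x \<in> {0..P}" "x \<notin> F" "x' \<in> cell x" "y \<in> {0..P}" "y' \<in> cell y"
    "\<beta> * x = real d + y" "\<beta> * x' = real d' + y'"
  shows "d = d'"
proof -
  define z where "z = (real d + y') / \<beta>"
  have z: "\<beta> * z = real d + y'" using beta_gt1 by (simp add: z_def)
  have "z \<in> cell x" using cell_pull[OF assms(1,6,7,8) z] .
  then have zc: "cell z = cell x'" using cell_eq assms(5) by auto
  have r: "z \<in> {0..P}" "x' \<in> {0..P}" "z \<notin> F" "x' \<notin> F"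
    using \<open>z \<in> cell x\<close> assms(4,5) cell_range cell_not_F by blast+
  have "x' < z + 1 / \<beta>" "z < x' + 1 / \<beta>" using cell_diff r zc cell_self by blast+
  then have "\<beta> * x' < \<beta> * z + 1" "\<beta> * z < \<beta> * x' + 1" using beta_gt1 by (simp_all add: field_simps)
  then have "real d' < real d + 1" "real d < real d' + 1" using z assms(9) by linarith+
  then show ?thesis by linarith
qed

lemma cell_S:
  assumes "y \<in> cell x" shows "y \<in> S \<longleftrightarrow> x \<in> S"
proof -
  have "0 \<le> \<beta> * y - real k \<and> \<beta> * y - real k \<le> P - 1 \<longleftrightarrow> 0 \<le> \<beta> * x - real k \<and> \<beta> * x - real k \<le> P - 1"
    if k: "k \<in> {1..N}" for k
  proof -
    have e: "0 \<le> \<beta> * y - real k \<longleftrightarrow> \<not> y < real k / \<beta>" 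
      "\<beta> * y - real k \<le> P - 1 \<longleftrightarrow> \<not> (real k + P - 1) / \<beta> < y" for y
      using beta_gt1 by (auto simp: field_simps)
    have "real k / \<beta> \<in> F" "(real k + P - 1) / \<beta> \<in> F" using k_F ks_F k by auto
    then show ?thesis using assms unfolding e cell_def by blast
  qed
  then show ?thesis unfolding mem_switch by blast
qed

text \<open>By \<open>F_not_S\<close> no partition point separates two points of S_k, and avoiding
  \<open>F\<close> excludes its end points.\<close>

lemma S_cell:
  assumes "x \<notin> F" "y \<notin> F" "k \<in> {1..N}" "0 \<le> \<beta> * x - real k" "\<beta> * x - real k \<le> P - 1"
    "0 \<le> \<beta> * y - real k" "\<beta> * y - real k \<le> P - 1"
  shows "y \<in> cell x"
proof -
  have strict: "0 < \<beta> * z - real k \<and> \<beta> * z - real k < P - 1" 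
    if "z \<notin> F" "0 \<le> \<beta> * z - real k" "\<beta> * z - real k \<le> P - 1" for z
  proof -
    have "z \<noteq> real k / \<beta>" "z \<noteq> (real k + P - 1) / \<beta>" using k_F ks_F assms(3) that(1) by auto
    then have "\<beta> * z \<noteq> real k" "\<beta> * z \<noteq> real k + P - 1" using beta_gt1 by (auto simp: field_simps)
    then show ?thesis using that by auto
  qed
  have "y \<in> {0..P}" using assms by (intro x_range[of k "\<beta> * y - real k"]) auto
  moreover have "(f < y \<longleftrightarrow> f < x) \<and> (y < f \<longleftrightarrow> x < f)" if "f \<in> F" for f
  proof -
    have "\<beta> * f - real k \<le> 0 \<or> \<beta> * f - real k \<ge> P - 1" using F_not_S[OF that, of k] assms(3) by auto
    then have "(\<beta> * f < \<beta> * y \<longleftrightarrow> \<beta> * f < \<beta> * x) \<and> (\<beta> * y < \<beta> * f \<longleftrightarrow> \<beta> * x < \<beta> * f)"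
      using strict[OF assms(1,4,5)] strict[OF assms(2,6,7)] by auto
    then show ?thesis using beta_gt1 by simp
  qed
  ultimately show ?thesis unfolding cell_def by blast
qed

definition code :: "real \<Rightarrow> nat" where
  "code x = (THE k. k \<in> {1..card (coding_F \<beta>) - 1} \<and> x \<in> coding_C \<beta> k)"

text \<open>Translates equality of gap numbers into equality of cells, so that the ordering of
  \<open>F\<close> can be forgotten afterwards.\<close>

lemma code_eq_iff:
  assumes "x \<in> {0..P}" "x \<notin> F" "y \<in> {0..P}" "y \<notin> F"
  shows "code x = code y \<longleftrightarrow> y \<in> cell x"
proof -
  define xs where "xs = sorted_list_of_set F"
  have xs: "set xs = F" "sorted xs" "length xs = card F" using finite_F by (auto simp: xs_def)
  have ne: "xs \<noteq> []" using xs(1) zero_F by auto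
  have mono: "xs ! i \<le> xs ! j" if "i \<le> j" "j < length xs" for i j
    using xs(2) that by (simp add: sorted_nth_mono)
  have ends: "hd xs \<le> 0" "P \<le> last xs"
  proof -
    obtain i where "i < length xs" "xs ! i = 0"
      using zero_F unfolding xs(1)[symmetric] in_set_conv_nth by blast
    moreover obtain j where "j < length xs" "xs ! j = P"
      using P_F unfolding xs(1)[symmetric] in_set_conv_nth by blast
    ultimately show "hd xs \<le> 0" "P \<le> last xs" using mono[of 0 i] mono[of j "length xs - 1"] ne
      by (auto simp: hd_conv_nth last_conv_nth)
  qed
  have C: "coding_C \<beta> k = {xs ! (k - 1) <..< xs ! k}" for k by (simp add: coding_C_def xs_def F_def)
  have ex1: "\<exists>!k. k \<in> {1..card (coding_F \<beta>) - 1} \<and> x \<in> coding_C \<beta> k" if "x \<in> {0..P}" "x \<notin> F" for x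
  proof -
    have "x \<noteq> 0" "x \<noteq> P" using that(2) zero_F P_F by blast+
    then have "hd xs < x" "x < last xs"
      using that(1) ends by auto
    then show ?thesis using sorted_list_gap[OF xs(2) ne, of x] that xs unfolding C F_def[symmetric] by simp
  qed
  have code: "code x \<in> {1..length xs - 1} \<and> x \<in> {xs ! (code x - 1) <..< xs ! (code x)}" if "x \<in> {0..P}" "x \<notin> F" for x
    using theI'[OF ex1[OF that], folded code_def] unfolding C xs(3) F_def .
  show ?thesis
  proof
    assume e: "code x = code y"
    have "(f < y \<longleftrightarrow> f < x) \<and> (y < f \<longleftrightarrow> x < f)" if "f \<in> F" for f
    proof -
      have "f \<in> set xs" using that xs(1) by simp
      then obtain i where i: "i < length xs" "f = xs ! i" by (metis in_set_conv_nth)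
      have cx: "code x < length xs" "xs ! (code x - 1) < x" "x < xs ! code x"
        using code[OF assms(1,2)] by auto
      have cy: "xs ! (code x - 1) < y" "y < xs ! code x"
        using code[OF assms(3,4)] unfolding e by auto
      consider "i \<le> code x - 1" | "code x \<le> i" by linarith
      then show ?thesis
      proof cases
        case 1
        then have "f \<le> xs ! (code x - 1)" using i mono cx(1) by simp
        then show ?thesis using cx cy by linarith
      next
        case 2
        then have "f \<ge> xs ! (code x)" using i mono by simp
        then show ?thesis using cx cy by linarith
      qed
    qed
    then show "y \<in> cell x" using assms(3) unfolding cell_def by blast
  next
    assume y: "y \<in> cell x"
    have cx: "code x \<in> {1..length xs - 1}" "x \<in> {xs ! (code x - 1) <..< xs ! (code x)}" using code[OF assms(1,2)] by auto
    then have "code x - 1 < length xs" "code x < length xs" by auto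
    then have "xs ! (code x - 1) \<in> F" "xs ! (code x) \<in> F" using nth_mem xs(1) by blast+
    then have "xs ! (code x - 1) < y \<longleftrightarrow> xs ! (code x - 1) < x" "y < xs ! (code x) \<longleftrightarrow> x < xs ! (code x)"
      using y unfolding cell_def by blast+
    then have "y \<in> {xs ! (code x - 1) <..< xs ! (code x)}" using cx(2) by simp
    then show "code x = code y"
      using the1_equality[OF ex1[OF assms(3,4)], of "code x", folded code_def] cx(1)
      by (simp add: C xs(3) F_def)
  qed
qed

text \<open>A cell is determined by which partition points lie to its left and which to its
  right.\<close>

lemma cell_finite: "finite (range cell)"
proof -
  define h where "h = (\<lambda>(U, V). {y \<in> {0..P}. {f\<in>F. f < y} = U \<and> {f\<in>F. y < f} = V})"
  have "cell x = h ({f\<in>F. f < x}, {f\<in>F. x < f})" for x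
  proof -
    have "(\<forall>f\<in>F. (f < y \<longleftrightarrow> f < x) \<and> (y < f \<longleftrightarrow> x < f)) \<longleftrightarrow>
        {f\<in>F. f < y} = {f\<in>F. f < x} \<and> {f\<in>F. y < f} = {f\<in>F. x < f}" for y
      unfolding set_eq_iff by blast
    then show ?thesis by (simp add: cell_def h_def)
  qed
  then have "range cell \<subseteq> h ` (Pow F \<times> Pow F)" by blast
  moreover have "finite (h ` (Pow F \<times> Pow F))" using finite_F by simp
  ultimately show ?thesis by (rule finite_subset)
qed

subsection \<open>Digit sequences and their values\<close>

text \<open>At a point \<open>p\<close> where \<open>f\<close> is nearly maximal, \<open>f\<close> is also nearly maximal at the images of
  \<open>p\<close> under \<open>T\<^sub>0\<^sup>l\<close> and \<open>T\<^sub>N\<^sup>l\<close>; for large \<open>l\<close> one of them lies outside \<open>{0..P}\<close>.\<close>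

lemma subharmonic_zero:
  fixes f :: "real \<Rightarrow> real"
  assumes nn: "\<And>p. 0 \<le> f p" and bd: "\<And>p. f p \<le> B"
    and out: "\<And>p. p \<notin> {0..P} \<Longrightarrow> f p = 0"
    and av: "\<And>p. (real N + 1) * f p \<le> (\<Sum>d\<le>N. f (\<beta> * p - real d))"
  shows "f p = 0"
proof -
  define a where "a = (SUP p. f p)"
  have bdd: "bdd_above (range f)" using bd by (intro bdd_aboveI2[of _ f B]) auto
  have le_a: "f p \<le> a" for p unfolding a_def by (rule cSUP_upper[OF _ bdd]) simp
  have "a \<le> 0"
  proof (rule ccontr)
    assume "\<not> ?thesis"
    then have a: "a > 0" by simp
    obtain l where l: "2 < \<beta> ^ l" using beta_gt1 real_arch_pow by blast
    \<comment> \<open>A step multiplies the deficit from the supremum by at most \<open>N\<close> +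
      1, so after l steps it is at most a/2.\<close>
    define e where "e = a / (2 * (real N + 1) ^ l)"
    have e: "e > 0" using a by (simp add: e_def)
    have "\<exists>p\<in>UNIV. a - e < f p" unfolding a_def
      by (subst less_cSUP_iff[symmetric, OF _ bdd]) (use e in \<open>simp_all add: a_def\<close>)
    then obtain p where p: "f p > a - e" by blast
    \<comment> \<open>All other summands are at most the supremum, so a single summand has to bear
      the whole deficit of the sum.\<close>
    have step: "f (\<beta> * p - real d) \<ge> a - (real N + 1) * e'" if "f p \<ge> a - e'" "d \<le> N" for p e' d
    proof -
      have "(\<Sum>d\<le>N. f (\<beta> * p - real d)) = f (\<beta> * p - real d) + (\<Sum>d\<in>{..N} - {d}. f (\<beta> * p - real d))"
        using that by (subst sum.remove[of _ d]) auto
      also have "(\<Sum>d\<in>{..N} - {d}. f (\<beta> * p - real d)) \<le> (\<Sum>d\<in>{..N} - {d}. a)"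
        by (intro sum_mono le_a)
      also have "\<dots> = real N * a" using that by simp
      finally have "(real N + 1) * f p \<le> f (\<beta> * p - real d) + real N * a" using av[of p] by simp
      moreover have "(real N + 1) * f p \<ge> (real N + 1) * (a - e')" using that by (intro mult_left_mono) auto
      ultimately show ?thesis by (simp add: algebra_simps)
    qed
    have i1: "f (\<beta> ^ i * p) \<ge> a - (real N + 1) ^ i * e" for i
    proof (induction i)
      case (Suc i) then show ?case using step[of "(real N + 1) ^ i * e" "\<beta> ^ i * p" 0] by (simp add: mult_ac)
    qed (use p in simp)
    have i2: "f (P - \<beta> ^ i * (P - p)) \<ge> a - (real N + 1) ^ i * e" for i
    proof (induction i)
      case (Suc i)
      have "\<beta> * (P - \<beta> ^ i * (P - p)) - real N = P - \<beta> ^ Suc i * (P - p)"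
        using beta_P by (simp add: algebra_simps)
      then show ?case using step[OF Suc, of N] by (simp add: mult_ac)
    qed (use p in simp)
    have "(real N + 1) ^ l * e = a / 2" using a by (simp add: e_def)
    then have "f (\<beta> ^ l * p) > 0" "f (P - \<beta> ^ l * (P - p)) > 0" using i1[of l] i2[of l] a by auto
    then have "\<beta> ^ l * p \<in> {0..P}" "P - \<beta> ^ l * (P - p) \<in> {0..P}" using out by (metis less_irrefl)+
    \<comment> \<open>Sum of \<beta>^l p \<le> \<open>P\<close> and \<beta>^l (\<open>P\<close> - p)
      \<le> \<open>P\<close>; this contradicts the choice of l with \<beta>^l > 2.\<close>
    then have "\<beta> ^ l * P \<le> 2 * P" by (simp add: algebra_simps)
    then show False using l P_gt1 by simp
  qed
  then show ?thesis using nn[of p] le_a[of p] by linarith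
qed

section \<open>The Bernoulli measure on digit sequences\<close>

definition U :: "nat measure" where "U = uniform_count_measure {0..N}"
definition D :: "(nat \<Rightarrow> nat) measure" where "D = digit_measure \<beta>"

lemma D_eq: "D = PiM UNIV (\<lambda>_. U)" by (simp add: D_def digit_measure_def U_def)

lemma space_U: "space U = {0..N}" and sets_U: "sets U = Pow {0..N}"
  by (simp_all add: U_def space_uniform_count_measure sets_uniform_count_measure)

lemma space_D: "b \<in> space D \<longleftrightarrow> (\<forall>i. b i \<le> N)"
  by (auto simp: D_eq space_PiM space_U)

lemma prob_U: "prob_space U" unfolding U_def by (rule prob_space_uniform_count_measure) auto

lemma seq_space: "sequence_space U"
proof -
  interpret prob_space U by (rule prob_U)
  show ?thesis by unfold_locales
qed

lemma prob_D: "prob_space D"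
  unfolding D_eq by (rule prob_space_PiM) (rule prob_U)

sublocale D: prob_space D by (rule prob_D)

definition pr :: "((nat \<Rightarrow> nat) \<Rightarrow> bool) \<Rightarrow> real" where "pr Q = measure D {b\<in>space D. Q b}"

abbreviation cons :: "nat \<Rightarrow> (nat \<Rightarrow> nat) \<Rightarrow> nat \<Rightarrow> nat" where "cons d b \<equiv> case_nat d b"

definition shiftn :: "nat \<Rightarrow> (nat \<Rightarrow> nat) \<Rightarrow> nat \<Rightarrow> nat" where "shiftn n b = (\<lambda>i. b (n + i))"

lemma cons_space: "d \<le> N \<Longrightarrow> b \<in> space D \<Longrightarrow> cons d b \<in> space D"
  by (auto simp: space_D split: nat.split)

lemma shiftn_space: "b \<in> space D \<Longrightarrow> shiftn n b \<in> space D"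
  by (auto simp: space_D shiftn_def)

lemma shiftn_0: "shiftn 0 b = b" by (simp add: shiftn_def)

lemma shiftn_shiftn: "shiftn n (shiftn m b) = shiftn (n + m) b"
  by (simp add: shiftn_def add_ac)

lemma shiftn_cons: "shiftn (Suc n) (cons d b) = shiftn n b"
  by (simp add: shiftn_def)

lemma component_measurable: "(\<lambda>b. b i) \<in> measurable D U"
  unfolding D_eq by measurable

lemma shiftn_measurable[measurable]: "shiftn n \<in> measurable D D"
  unfolding D_eq by (rule measurable_PiM_single') (auto simp: shiftn_def space_PiM space_U PiE_iff)

lemma cons_measurable[measurable]: 
  assumes "d \<le> N" shows "cons d \<in> measurable D D"
  unfolding D_eq
proof (rule measurable_PiM_single')
  show "(\<lambda>b. cons d b i) \<in> measurable (PiM UNIV (\<lambda>_. U)) U" for i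
    using assms by (cases i) (auto simp: space_U)
  show "cons d \<in> space (PiM UNIV (\<lambda>_. U)) \<rightarrow> (\<Pi>\<^sub>E i\<in>UNIV. space U)"
    using assms by (auto simp: space_PiM space_U PiE_iff split: nat.split)
qed

text \<open>Conditioning on the first digit: prepending an independent uniform digit preserves the
  product measure. Later computations of probabilities peel off digits one at a time through this
  identity.\<close>

lemma pr_step:
  assumes [measurable]: "Measurable.pred D Q"
  shows "pr Q = (\<Sum>d\<le>N. pr (\<lambda>b. Q (cons d b))) / (real N + 1)"
proof -
  have iter: "distr (U \<Otimes>\<^sub>M D) D (\<lambda>(s, b). case_nat s b) = D"
    using sequence_space.PiM_iter[OF seq_space] unfolding D_eq .
  let ?A = "{b\<in>space D. Q b}"
  have A: "?A \<in> sets D" by measurable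
  have mc: "(\<lambda>(s, b). case_nat s b) \<in> measurable (U \<Otimes>\<^sub>M D) D"
    unfolding D_eq by measurable
  have "emeasure D ?A = emeasure (distr (U \<Otimes>\<^sub>M D) D (\<lambda>(s, b). case_nat s b)) ?A"
    unfolding iter ..
  also have "\<dots> = emeasure (U \<Otimes>\<^sub>M D) ((\<lambda>(s, b). case_nat s b) -` ?A \<inter> space (U \<Otimes>\<^sub>M D))"
    by (rule emeasure_distr[OF mc A])
  also have "\<dots> = (\<integral>\<^sup>+d. emeasure D (Pair d -` ((\<lambda>(s, b). case_nat s b) -` ?A \<inter> space (U \<Otimes>\<^sub>M D))) \<partial>U)"
    by (rule D.emeasure_pair_measure_alt) (rule measurable_sets[OF mc A])
  also have "\<dots> = (\<integral>\<^sup>+d. ennreal (pr (\<lambda>b. Q (cons d b))) \<partial>U)"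
  proof (rule nn_integral_cong)
    fix d assume d: "d \<in> space U"
    then have "Pair d -` ((\<lambda>(s, b). case_nat s b) -` ?A \<inter> space (U \<Otimes>\<^sub>M D)) = {b\<in>space D. Q (cons d b)}"
      using cons_space by (auto simp: space_pair_measure space_U)
    then show "emeasure D (Pair d -` ((\<lambda>(s, b). case_nat s b) -` ?A \<inter> space (U \<Otimes>\<^sub>M D))) = ennreal (pr (\<lambda>b. Q (cons d b)))"
      by (simp add: pr_def D.emeasure_eq_measure)
  qed
  also have "\<dots> = (\<Sum>d\<in>{0..N}. ennreal (pr (\<lambda>b. Q (cons d b))) * ennreal (1 / (real N + 1)))"
    unfolding U_def uniform_count_measure_def
    by (subst nn_integral_point_measure_finite) (auto simp: mult_ac add_ac)
  also have "\<dots> = ennreal (\<Sum>d\<in>{0..N}. pr (\<lambda>b. Q (cons d b)) * (1 / (real N + 1)))"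
    by (simp add: ennreal_mult'[symmetric] pr_def sum_ennreal)
  finally have "ennreal (pr Q) = ennreal (\<Sum>d\<in>{0..N}. pr (\<lambda>b. Q (cons d b)) * (1 / (real N + 1)))"
    by (simp add: pr_def D.emeasure_eq_measure)
  then have "pr Q = (\<Sum>d\<in>{0..N}. pr (\<lambda>b. Q (cons d b)) * (1 / (real N + 1)))"
    by (subst (asm) ennreal_inj) (auto simp: pr_def intro!: sum_nonneg)
  then show ?thesis by (simp add: sum_divide_distrib atLeast0AtMost)
qed

lemma pr_cong: "(\<And>b. b \<in> space D \<Longrightarrow> Q b \<longleftrightarrow> R b) \<Longrightarrow> pr Q = pr R"
  unfolding pr_def by (metis (mono_tags, lifting) Collect_cong)

lemma pr_mono: "Measurable.pred D R \<Longrightarrow> (\<And>b. b \<in> space D \<Longrightarrow> Q b \<Longrightarrow> R b) \<Longrightarrow> pr Q \<le> pr R"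
  unfolding pr_def by (rule D.finite_measure_mono) auto

lemma pr_nonneg: "0 \<le> pr Q" and pr_le1: "pr Q \<le> 1"
  unfolding pr_def by auto

lemma pr_False: "pr (\<lambda>b. False) = 0" and pr_True: "pr (\<lambda>b. True) = 1"
  unfolding pr_def by (simp_all add: D.prob_space)

lemma pr_shiftn:
  assumes [measurable]: "Measurable.pred D Q"
  shows "pr (\<lambda>b. Q (shiftn n b)) = pr Q"
proof (induction n)
  case (Suc n)
  have "Measurable.pred D (\<lambda>b. Q (shiftn (Suc n) b))" by measurable
  then have "pr (\<lambda>b. Q (shiftn (Suc n) b)) = pr (\<lambda>b. Q (shiftn n b))"
    by (subst pr_step) (simp_all add: shiftn_cons add.commute)
  then show ?case using Suc by simp
qed (simp add: shiftn_0)

section \<open>The value of a digit sequence and its distribution\<close>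

definition xv :: "(nat \<Rightarrow> nat) \<Rightarrow> real" where "xv b = (\<Sum>i. real (b i) / \<beta> ^ Suc i)"

lemma geom: "(\<lambda>i. real N / \<beta> ^ Suc i) sums P"
proof -
  have "(\<lambda>i. (1 / \<beta>) ^ i) sums (1 / (1 - 1 / \<beta>))" using beta_gt1 by (intro geometric_sums) auto
  then have "(\<lambda>i. (real N / \<beta>) * (1 / \<beta>) ^ i) sums ((real N / \<beta>) * (1 / (1 - 1 / \<beta>)))" by (rule sums_mult)
  moreover have "(real N / \<beta>) * (1 / (1 - 1 / \<beta>)) = P" using beta_gt1 by (simp add: P_def field_simps)
  ultimately show ?thesis by (simp add: power_one_over field_simps)
qed

lemma xv_summable: "b \<in> space D \<Longrightarrow> summable (\<lambda>i. real (b i) / \<beta> ^ Suc i)"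
  by (rule summable_comparison_test'[OF sums_summable[OF geom], of 0])
     (use beta_gt1 in \<open>auto simp: space_D intro!: divide_right_mono\<close>)

lemma xv_range: "b \<in> space D \<Longrightarrow> xv b \<in> {0..P}"
proof -
  assume b: "b \<in> space D"
  have "xv b \<le> (\<Sum>i. real N / \<beta> ^ Suc i)" unfolding xv_def
    by (rule suminf_le[OF _ xv_summable[OF b] sums_summable[OF geom]])
       (use b beta_gt1 in \<open>auto simp: space_D intro!: divide_right_mono\<close>)
  also have "\<dots> = P" using geom sums_unique by metis
  finally have "xv b \<le> P" .
  moreover have "0 \<le> xv b" unfolding xv_def
    by (rule suminf_nonneg) (use xv_summable[OF b] beta_gt1 in auto)
  ultimately show ?thesis by simp
qed

lemma xv_step: "b \<in> space D \<Longrightarrow> \<beta> * xv b = real (b 0) + xv (shiftn 1 b)"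
proof -
  assume b: "b \<in> space D"
  have s: "(\<lambda>i. \<beta> * (real (b i) / \<beta> ^ Suc i)) = (\<lambda>i. real (b i) / \<beta> ^ i)"
    using beta_gt1 by (auto simp: field_simps)
  have sm: "summable (\<lambda>i. real (b i) / \<beta> ^ i)"
    using summable_mult[OF xv_summable[OF b], of \<beta>] unfolding s .
  have "\<beta> * xv b = (\<Sum>i. real (b i) / \<beta> ^ i)" unfolding xv_def
    by (subst suminf_mult[OF xv_summable[OF b], symmetric]) (simp only: s)
  also have "\<dots> = (\<Sum>i. real (b (Suc i)) / \<beta> ^ Suc i) + real (b 0)"
    using suminf_split_head[OF sm] by simp
  finally show ?thesis by (simp add: xv_def shiftn_def)
qed

lemma xv_cons: "d \<le> N \<Longrightarrow> b \<in> space D \<Longrightarrow> \<beta> * xv (cons d b) = real d + xv b"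
  using xv_step[OF cons_space, of d b] by (simp add: shiftn_cons shiftn_0)

lemma xv_measurable[measurable]: "xv \<in> borel_measurable D"
proof -
  have "(\<lambda>b. real (b i)) \<in> borel_measurable D" for i
    by (rule measurable_compose[OF component_measurable]) (auto simp: measurable_def sets_U space_U)
  then show ?thesis unfolding xv_def[abs_def] by (intro borel_measurable_suminf borel_measurable_divide) auto
qed

lemma S_sets[measurable]: "S \<in> sets borel"
  unfolding S_def switch_region_def rand_S_def by measurable

abbreviation X :: "nat \<Rightarrow> (nat \<Rightarrow> nat) \<Rightarrow> real" where "X n b \<equiv> xv (shiftn n b)"

text \<open>The mass of the point p is exactly the average of the masses of the points \<beta>p - d
  and vanishes outside the interval, so \<open>subharmonic_zero\<close> applies.\<close>

lemma no_atoms: "pr (\<lambda>b. xv b = p) = 0"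
proof (rule subharmonic_zero[where B=1 and f="\<lambda>p. pr (\<lambda>b. xv b = p)"])
  show "pr (\<lambda>b. xv b = p) = 0" if "p \<notin> {0..P}" for p
  proof -
    have "pr (\<lambda>b. xv b = p) = pr (\<lambda>b. False)" by (rule pr_cong) (use xv_range that in blast)
    then show ?thesis using pr_False by simp
  qed
  show "(real N + 1) * pr (\<lambda>b. xv b = p) \<le> (\<Sum>d\<le>N. pr (\<lambda>b. xv b = \<beta> * p - real d))" for p
  proof -
    have "pr (\<lambda>b. xv (cons d b) = p) = pr (\<lambda>b. xv b = \<beta> * p - real d)" if "d \<le> N" for d
    proof (rule pr_cong)
      fix b assume b: "b \<in> space D"
      have "xv (cons d b) = p \<longleftrightarrow> \<beta> * xv (cons d b) = \<beta> * p" using beta_gt1 by simp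
      then show "xv (cons d b) = p \<longleftrightarrow> xv b = \<beta> * p - real d" using xv_cons[OF that b] by auto
    qed
    then show ?thesis by (subst pr_step) (simp_all)
  qed
qed (auto simp: pr_nonneg pr_le1)

text \<open>The law of \<open>xv\<close> is symmetric under x -> \<open>P\<close> - x. After
  reindexing the second sum by d -> \<open>N\<close> - d, the difference of the two distribution
  functions satisfies the averaging identity, so its absolute value falls under
  \<open>subharmonic_zero\<close>.\<close>

lemma mirror: "pr (\<lambda>b. xv b \<le> p) = pr (\<lambda>b. xv b \<ge> P - p)"
proof -
  let ?h = "\<lambda>p. pr (\<lambda>b. xv b \<le> p) - pr (\<lambda>b. xv b \<ge> P - p)"
  have "\<bar>?h p\<bar> = 0"
  proof (rule subharmonic_zero[where B=2 and f="\<lambda>p. \<bar>?h p\<bar>"])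
    show "\<bar>?h p\<bar> \<le> 2" for p using pr_nonneg pr_le1 by (smt (verit))
    show "\<bar>?h p\<bar> = 0" if "p \<notin> {0..P}" for p
    proof -
      have "pr (\<lambda>b. xv b \<le> p) = pr (\<lambda>b. xv b \<ge> P - p)"
        by (rule pr_cong) (use xv_range that in fastforce)
      then show ?thesis by simp
    qed
    show "(real N + 1) * \<bar>?h p\<bar> \<le> (\<Sum>d\<le>N. \<bar>?h (\<beta> * p - real d)\<bar>)" for p
    proof -
      have "pr (\<lambda>b. xv (cons d b) \<le> p) = pr (\<lambda>b. xv b \<le> \<beta> * p - real d)" if "d \<le> N" for d
      proof (rule pr_cong)
        fix b assume b: "b \<in> space D"
        have "xv (cons d b) \<le> p \<longleftrightarrow> \<beta> * xv (cons d b) \<le> \<beta> * p" using beta_gt1 by simp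
        then show "xv (cons d b) \<le> p \<longleftrightarrow> xv b \<le> \<beta> * p - real d" using xv_cons[OF that b] by auto
      qed
      then have 1: "(real N + 1) * pr (\<lambda>b. xv b \<le> p) = (\<Sum>d\<le>N. pr (\<lambda>b. xv b \<le> \<beta> * p - real d))"
        by (subst pr_step) simp_all
      have "pr (\<lambda>b. xv (cons d b) \<ge> P - p) = pr (\<lambda>b. xv b \<ge> P - (\<beta> * p - real (N - d)))" if "d \<le> N" for d
      proof (rule pr_cong)
        fix b assume b: "b \<in> space D"
        have "xv (cons d b) \<ge> P - p \<longleftrightarrow> \<beta> * xv (cons d b) \<ge> \<beta> * (P - p)" using beta_gt1 by simp
        also have "\<beta> * (P - p) = real N + P - \<beta> * p" using beta_P by (simp add: right_diff_distrib)
        finally show "xv (cons d b) \<ge> P - p \<longleftrightarrow> xv b \<ge> P - (\<beta> * p - real (N - d))"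
          using xv_cons[OF that b] that by (auto simp: of_nat_diff)
      qed
      then have "(real N + 1) * pr (\<lambda>b. xv b \<ge> P - p) = (\<Sum>d\<le>N. pr (\<lambda>b. xv b \<ge> P - (\<beta> * p - real (N - d))))"
        by (subst pr_step) simp_all
      also have "\<dots> = (\<Sum>d\<le>N. pr (\<lambda>b. xv b \<ge> P - (\<beta> * p - real d)))"
        by (rule sum.reindex_bij_witness[of _ "\<lambda>d. N - d" "\<lambda>d. N - d"]) auto
      finally have "(real N + 1) * ?h p = (\<Sum>d\<le>N. ?h (\<beta> * p - real d))"
        using 1 by (simp add: right_diff_distrib sum_subtractf)
      moreover have "(real N + 1) * \<bar>?h p\<bar> = \<bar>(real N + 1) * ?h p\<bar>" by (simp add: abs_mult)
      ultimately have "(real N + 1) * \<bar>?h p\<bar> = \<bar>\<Sum>d\<le>N. ?h (\<beta> * p - real d)\<bar>" by (simp only:)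
      also have "\<dots> \<le> (\<Sum>d\<le>N. \<bar>?h (\<beta> * p - real d)\<bar>)" by (rule sum_abs)
      finally show ?thesis .
    qed
  qed auto
  then show ?thesis by simp
qed

text \<open>The two events are the images of an arbitrary S_k under its two branches; this equality
  is what makes the coins fair.\<close>

lemma pr_S_halves: "pr (\<lambda>b. xv b \<le> P - 1) = pr (\<lambda>b. xv b \<ge> 1)"
  using mirror[of "P - 1"] by simp

section \<open>Almost every orbit keeps visiting the switch region and avoids the partition
  points\<close>

definition never :: "(nat \<Rightarrow> nat) \<Rightarrow> bool" where "never b \<longleftrightarrow> (\<forall>n. X n b \<notin> S)"

lemma never_measurable[measurable]: "Measurable.pred D never"
  unfolding never_def[abs_def] by measurable

definition prepend :: "nat list \<Rightarrow> (nat \<Rightarrow> nat) \<Rightarrow> nat \<Rightarrow> nat" where "prepend w b = foldr case_nat w b"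

lemma prepend_space: "set w \<subseteq> {..N} \<Longrightarrow> b \<in> space D \<Longrightarrow> prepend w b \<in> space D"
  by (induction w) (auto simp: prepend_def cons_space)

lemma prepend_measurable: "set w \<subseteq> {..N} \<Longrightarrow> prepend w \<in> measurable D D"
  unfolding prepend_def[abs_def]
proof (induction w)
  case (Cons d w)
  then show ?case using measurable_compose[OF _ cons_measurable[of d], of "\<lambda>b. foldr case_nat w b" D] by auto
qed simp

lemma never_prepend: "never (prepend w b) \<Longrightarrow> never b"
proof (induction w)
  case (Cons d w)
  have "X (Suc n) (prepend (d # w) b) = X n (prepend w b)" for n
    by (simp add: prepend_def shiftn_cons)
  then show ?case using Cons unfolding never_def by metis
qed (simp add: prepend_def)

text \<open>Prepending a digit can only shrink the event, yet the average over all digits keeps its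
  probability, so no finite word lowers it. A word that forces a visit to \<open>S\<close> therefore
  shows that the probability is 0.\<close>

lemma never_null: "pr never = 0"
proof -
  have all: "pr (\<lambda>b. never (prepend w b)) = pr never" if "set w \<subseteq> {..N}" for w
    using that
  proof (induction w rule: rev_induct)
    case (snoc d w)
    let ?f = "\<lambda>d. pr (\<lambda>b. never (prepend (w @ [d]) b))"
    note [measurable] = prepend_measurable
    have le: "?f d \<le> pr never" if "d \<le> N" for d
      by (rule pr_mono) (use never_prepend in auto)
    have "pr never = pr (\<lambda>b. never (prepend w b))" using snoc by simp
    also have "\<dots> = (\<Sum>d\<le>N. pr (\<lambda>b. never (prepend w (cons d b)))) / (real N + 1)"
    proof (rule pr_step)
      have [measurable]: "prepend w \<in> measurable D D" using snoc by (intro prepend_measurable) auto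
      show "Measurable.pred D (\<lambda>b. never (prepend w b))" by measurable
    qed
    also have "(\<lambda>d. pr (\<lambda>b. never (prepend w (cons d b)))) = ?f" by (simp add: prepend_def)
    finally have "(\<Sum>d\<le>N. pr never - ?f d) = 0" by (simp add: sum_subtractf field_simps)
    then have "\<forall>d\<in>{..N}. pr never - ?f d = 0"
      by (subst (asm) sum_nonneg_eq_0_iff) (use le in auto)
    then show ?case using snoc by auto
  qed (simp add: prepend_def)
  obtain l where l: "P / (P - 1) < \<beta> ^ l" using beta_gt1 real_arch_pow by blast
  \<comment> \<open>The l zeros push the value down to at most \<open>P\<close> / \<beta>^l \<le>
    \<open>P - 1\<close>; with the digit 1 in front, the point lies in S_1.\<close>
  define w where "w = 1 # replicate l (0::nat)"
  have w: "set w \<subseteq> {..N}" using N_ge1 by (auto simp: w_def)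
  have zeros: "\<beta> ^ i * xv (prepend (replicate i 0) b) = xv b" if "b \<in> space D" for b i
  proof (induction i)
    case (Suc i)
    have "prepend (replicate i 0) b \<in> space D" by (rule prepend_space) (use that in auto)
    then have "\<beta> * xv (prepend (replicate (Suc i) 0) b) = xv (prepend (replicate i 0) b)"
      using xv_cons[of 0 "prepend (replicate i 0) b"] by (simp add: prepend_def)
    moreover have "\<beta> ^ Suc i * xv (prepend (replicate (Suc i) 0) b) = \<beta> ^ i * (\<beta> * xv (prepend (replicate (Suc i) 0) b))"
      by (simp only: power_Suc2 mult.assoc)
    ultimately show ?case using Suc by (simp only:)
  qed (simp add: prepend_def)
  have "\<not> never (prepend w b)" if b: "b \<in> space D" for b
  proof -
    let ?c = "prepend (replicate l 0) b"
    have c: "?c \<in> space D" by (rule prepend_space) (use b in auto)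
    have "\<beta> ^ l * xv ?c \<le> P" using zeros[OF b, of l] xv_range[OF b] by simp
    also have "P \<le> \<beta> ^ l * (P - 1)" using l P_gt1 by (simp add: field_simps)
    finally have "xv ?c \<le> P - 1" using beta_gt1 by simp
    moreover have "\<beta> * xv (cons 1 ?c) = 1 + xv ?c" using xv_cons[of 1 ?c] N_ge1 c by simp
    ultimately have "xv (cons 1 ?c) \<in> S" unfolding mem_switch using N_ge1 xv_range[OF c] by (intro bexI[of _ 1]) auto
    moreover have "prepend w b = cons 1 ?c" by (simp add: prepend_def w_def)
    ultimately show ?thesis unfolding never_def by (metis shiftn_0)
  qed
  then have "pr (\<lambda>b. never (prepend w b)) = pr (\<lambda>b. False)" by (intro pr_cong) auto
  then show ?thesis using all[OF w] pr_False by simp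
qed

text \<open>The full-measure set that \<open>psi\<close> sends into both \<open>rand_Z\<close> and
  \<open>coding_X\<close>. Infinitely many visits to \<open>S\<close> are expressed by saying that
  every tail has one.\<close>

definition good :: "(nat \<Rightarrow> nat) \<Rightarrow> bool" where
  "good b \<longleftrightarrow> (\<forall>n. X n b \<notin> F) \<and> (\<forall>n. \<not> never (shiftn n b))"

lemma pr_AE: "Measurable.pred D Q \<Longrightarrow> pr Q = 0 \<Longrightarrow> AE b in D. \<not> Q b"
  unfolding pr_def by (subst AE_iff_measurable[OF _ refl]) (auto simp: D.emeasure_eq_measure pred_def)

lemma AE_good: "AE b in D. good b"
proof -
  have 1: "AE b in D. X n b \<noteq> f" for n f
  proof (rule pr_AE)
    show "pr (\<lambda>b. X n b = f) = 0" using pr_shiftn[of "\<lambda>b. xv b = f" n] no_atoms by simp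
  qed measurable
  have "AE b in D. \<forall>n. \<forall>f\<in>F. X n b \<noteq> f"
    using 1 finite_F by (subst AE_all_countable, intro allI, subst AE_ball_countable) (auto intro: countable_finite)
  moreover have 2: "AE b in D. \<not> never (shiftn n b)" for n
    using pr_shiftn[OF never_measurable, of n] never_null by (intro pr_AE) auto
  have "AE b in D. \<forall>n. \<not> never (shiftn n b)" using 2 by (simp add: AE_all_countable)
  ultimately show ?thesis by eventually_elim (auto simp: good_def)
qed

lemma F_sets[measurable]: "F \<in> sets borel" using finite_F by (simp add: finite_imp_closed)

lemma good_measurable[measurable]: "Measurable.pred D good"
  unfolding good_def[abs_def] by measurable

lemma pr_good: "Measurable.pred D Q \<Longrightarrow> pr (\<lambda>b. good b \<and> Q b) = pr Q"
  unfolding pr_def by (rule D.finite_measure_eq_AE) (use AE_good in auto)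

subsection \<open>Independence of the choices\<close>

lemma X_0: "X 0 b = xv b" by (simp add: shiftn_0)

lemma X_cons: "X (Suc n) (cons d b) = X n b" by (simp add: shiftn_cons)

lemma X_Suc: "X (Suc n) b = X n (shiftn 1 b)" by (simp add: shiftn_shiftn)

fun hits :: "nat \<Rightarrow> (nat \<Rightarrow> nat) \<Rightarrow> nat" where
  "hits 0 b = 0"
| "hits (Suc n) b = hits n b + (if X n b \<in> S then 1 else 0)"

text \<open>\<open>om b j\<close> is the choice made by \<open>b\<close> at its \<open>(j + 1)\<close>-st visit to \<open>S\<close>.\<close>

definition om :: "(nat \<Rightarrow> nat) \<Rightarrow> nat \<Rightarrow> bool" where
  "om b j \<longleftrightarrow> (\<exists>n. hits n b = j \<and> X n b \<in> S \<and> X (Suc n) b \<le> P - 1)"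

lemma hits_Suc: "hits (Suc n) b = (if xv b \<in> S then 1 else 0) + hits n (shiftn 1 b)"
proof (induction n)
  case (Suc n)
  have "hits (Suc (Suc n)) b = hits (Suc n) b + (if X n (shiftn 1 b) \<in> S then 1 else 0)"
    by (simp add: X_Suc)
  then show ?case using Suc by simp
qed (simp add: X_0)

lemma om_step: "om b = (if xv b \<in> S then case_nat (xv (shiftn 1 b) \<le> P - 1) (om (shiftn 1 b)) else om (shiftn 1 b))"
proof
  fix j
  have "om b j \<longleftrightarrow> (hits 0 b = j \<and> X 0 b \<in> S \<and> X (Suc 0) b \<le> P - 1) \<or>
    (\<exists>n. hits (Suc n) b = j \<and> X (Suc n) b \<in> S \<and> X (Suc (Suc n)) b \<le> P - 1)"
    unfolding om_def by (metis not0_implies_Suc)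
  also have "\<dots> \<longleftrightarrow> (j = 0 \<and> xv b \<in> S \<and> xv (shiftn 1 b) \<le> P - 1) \<or>
    (\<exists>n. (if xv b \<in> S then 1 else 0) + hits n (shiftn 1 b) = j \<and> X n (shiftn 1 b) \<in> S \<and> X (Suc n) (shiftn 1 b) \<le> P - 1)"
    unfolding hits_Suc X_Suc X_0 by auto
  also have "\<dots> \<longleftrightarrow> (if xv b \<in> S then case_nat (xv (shiftn 1 b) \<le> P - 1) (om (shiftn 1 b)) else om (shiftn 1 b)) j"
    unfolding om_def by (cases j) auto
  finally show "om b j = (if xv b \<in> S then case_nat (xv (shiftn 1 b) \<le> P - 1) (om (shiftn 1 b)) else om (shiftn 1 b)) j" .
qed

lemma om_cons: "om (cons d b) = (if xv (cons d b) \<in> S then case_nat (xv b \<le> P - 1) (om b) else om b)"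
  using om_step[of "cons d b"] shiftn_cons[of 0 d b] by (simp add: shiftn_0)

lemma hits_measurable[measurable]: "Measurable.pred D (\<lambda>b. hits n b = j)"
proof (induction n arbitrary: j)
  case (Suc n)
  note [measurable] = Suc
  have "(\<lambda>b. hits (Suc n) b = j) = (\<lambda>b. if X n b \<in> S then j > 0 \<and> hits n b = j - 1 else hits n b = j)"
    by (auto simp: fun_eq_iff)
  then show ?case by simp
qed simp

lemma om_measurable[measurable]: "Measurable.pred D (\<lambda>b. om b j)"
  unfolding om_def by measurable

text \<open>The direction from b to the longer sequence rests on \<open>pull_not_F\<close>: a digit
  put in front cannot move the point into \<open>F\<close>, since \<open>F\<close> is closed under
  branches.\<close>

lemma good_cons:
  assumes "d \<le> N" "b \<in> space D"
  shows "good (cons d b) \<longleftrightarrow> good b"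
proof
  assume g: "good (cons d b)"
  have "X n b \<notin> F" "\<not> never (shiftn n b)" for n
    using g X_cons[of n d b] shiftn_cons[of n d b] unfolding good_def by metis+
  then show "good b" by (simp add: good_def)
next
  assume g: "good b"
  have "X n (cons d b) \<notin> F" for n
  proof (cases n)
    case 0
    have "xv b \<notin> F" using g X_0 unfolding good_def by metis
    then have "xv (cons d b) \<notin> F" using pull_not_F[OF assms(1) xv_range[OF assms(2)]] xv_cons[OF assms] by blast
    then show ?thesis using 0 X_0 by simp
  next
    case (Suc m) then show ?thesis using g X_cons unfolding good_def by metis
  qed
  moreover have "\<not> never (shiftn n (cons d b))" for n
  proof (cases n)
    case 0
    have "\<not> never b" using g shiftn_0 unfolding good_def by metis
    then show ?thesis using 0 never_prepend[of "[d]" b] by (auto simp: prepend_def shiftn_0)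
  next
    case (Suc m) then show ?thesis using g shiftn_cons unfolding good_def by metis
  qed
  ultimately show "good (cons d b)" by (simp add: good_def)
qed

lemma cell_sets[measurable]: "cell x \<in> sets borel"
proof -
  have "cell x = {0..P} \<inter> (\<Inter>f\<in>F. {y. (f < y \<longleftrightarrow> f < x) \<and> (y < f \<longleftrightarrow> x < f)})"
    unfolding cell_def by blast
  also have "\<dots> \<in> sets borel"
  proof (rule sets.Int)
    show "(\<Inter>f\<in>F. {y. (f < y \<longleftrightarrow> f < x) \<and> (y < f \<longleftrightarrow> x < f)}) \<in> sets borel"
    proof (rule sets.finite_INT)
      show "F \<noteq> {}" using zero_F by blast
      fix f
      have "{y. (f < y \<longleftrightarrow> f < x) \<and> (y < f \<longleftrightarrow> x < f)} = {y\<in>space borel. (f < y \<longleftrightarrow> f < x) \<and> (y < f \<longleftrightarrow> x < f)}"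
        by simp
      also have "\<dots> \<in> sets borel" by measurable
      finally show "{y. (f < y \<longleftrightarrow> f < x) \<and> (y < f \<longleftrightarrow> x < f)} \<in> sets borel" .
    qed (rule finite_F)
  qed simp
  finally show ?thesis .
qed

text \<open>On the interval and off \<open>F\<close>, the set is a union of cells. Points of
  \<open>F\<close> may belong to it or not, since they carry no mass.\<close>

definition sat :: "real set \<Rightarrow> bool" where
  "sat C \<longleftrightarrow> C \<in> sets borel \<and> (\<forall>x\<in>{0..P} - F. \<forall>y\<in>cell x. x \<in> C \<longrightarrow> y \<in> C)"

lemma satD: "sat C \<Longrightarrow> x \<in> {0..P} \<Longrightarrow> x \<notin> F \<Longrightarrow> y \<in> cell x \<Longrightarrow> x \<in> C \<Longrightarrow> y \<in> C"
  unfolding sat_def by blast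

lemma sat_Int: "sat A \<Longrightarrow> sat B \<Longrightarrow> sat (A \<inter> B)"
  unfolding sat_def by auto

lemma sat_S: "sat S" and sat_Compl_S: "sat (- S)"
  unfolding sat_def using S_sets cell_S by (auto simp: borel_comp)

lemma sat_cell: "sat (cell x)"
  unfolding sat_def using cell_sets cell_eq cell_range by blast

text \<open>\<open>P - 1\<close> is a partition point, so the outcome of the coin is visible from
  the cell of the image. The parameter t covers both outcomes.\<close>

lemma sat_low: "sat {y. (y \<le> P - 1) = t}"
proof -
  have "{y. (y \<le> P - 1) = t} = {y\<in>space borel. (y \<le> P - 1) = t}" by simp
  also have "\<dots> \<in> sets borel" by measurable
  finally have 1: "{y. (y \<le> P - 1) = t} \<in> sets borel" .
  have "(y \<le> P - 1) = (x \<le> P - 1)" if "y \<in> cell x" for x y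
  proof -
    have "P - 1 < y \<longleftrightarrow> P - 1 < x" using that s_F unfolding cell_def by blast
    then show ?thesis by linarith
  qed
  then show ?thesis unfolding sat_def using 1 by blast
qed

text \<open>Inverse branches map cells into cells, so peeling off a digit stays within the class of
  saturated sets.\<close>

lemma sat_pull:
  assumes C: "sat C" and d: "d \<le> N"
  shows "sat {y. (real d + y) / \<beta> \<in> C}"
proof -
  have "C \<in> sets borel" using C by (simp add: sat_def)
  have m: "(\<lambda>y. (real d + y) / \<beta>) \<in> borel_measurable borel" by measurable
  have "{y. (real d + y) / \<beta> \<in> C} = (\<lambda>y. (real d + y) / \<beta>) -` C \<inter> space borel" by auto
  also have "\<dots> \<in> sets borel" by (rule measurable_sets[OF m \<open>C \<in> sets borel\<close>])
  finally have 1: "{y. (real d + y) / \<beta> \<in> C} \<in> sets borel" .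
  have "(real d + y) / \<beta> \<in> C" if x: "x \<in> {0..P}" "x \<notin> F" "y \<in> cell x" "(real d + x) / \<beta> \<in> C" for x y
  proof -
    have e: "\<beta> * ((real d + z) / \<beta>) = real d + z" for z using beta_gt1 by simp
    have "(real d + x) / \<beta> \<in> {0..P}" using x_range[OF d _ _ e, of x] x by auto
    moreover have "(real d + x) / \<beta> \<notin> F" using pull_not_F[OF d x(1,2) e] .
    moreover have "(real d + y) / \<beta> \<in> cell ((real d + x) / \<beta>)" using cell_pull[OF d x(1,3) e e] .
    ultimately show ?thesis using satD[OF C] x(4) by blast
  qed
  then show ?thesis unfolding sat_def using 1 by blast
qed

lemma xv_cons': "d \<le> N \<Longrightarrow> b \<in> space D \<Longrightarrow> xv (cons d b) = (real d + xv b) / \<beta>"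
  using xv_cons[of d b] beta_gt1 by (simp add: field_simps)

definition first_hit :: "nat \<Rightarrow> (nat \<Rightarrow> nat) \<Rightarrow> bool" where
  "first_hit n b \<longleftrightarrow> X n b \<in> S \<and> (\<forall>i<n. X i b \<notin> S)"

lemma first_hit_measurable[measurable]: "Measurable.pred D (first_hit n)"
  unfolding first_hit_def[abs_def] by measurable

lemma first_hit_cons: "first_hit (Suc n) (cons d b) \<longleftrightarrow> xv (cons d b) \<notin> S \<and> first_hit n b"
  unfolding first_hit_def All_less_Suc2 X_cons X_0 by blast

text \<open>Almost every sequence has a first visit to \<open>S\<close>, so its time partitions the
  event. This locates the first coin in the digit sequence.\<close>

lemma first_hit_sums:
  assumes [measurable]: "Measurable.pred D Q"
  shows "(\<lambda>n. pr (\<lambda>b. good b \<and> Q b \<and> first_hit n b)) sums pr Q"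
proof -
  let ?A = "\<lambda>n. {b\<in>space D. good b \<and> Q b \<and> first_hit n b}"
  have "disjoint_family ?A"
    unfolding disjoint_family_on_def first_hit_def by (auto simp: set_eq_iff) (metis linorder_neqE_nat)
  then have "(\<lambda>n. measure D (?A n)) sums measure D (\<Union>n. ?A n)"
    by (intro D.finite_measure_UNION) auto
  moreover have "(\<Union>n. ?A n) = {b\<in>space D. good b \<and> Q b}"
  proof -
    have "\<exists>n. first_hit n b" if "good b" for b
    proof -
      have "\<not> never b" using that shiftn_0 unfolding good_def by metis
      then obtain n where n: "X n b \<in> S" unfolding never_def by blast
      show ?thesis unfolding first_hit_def
        using LeastI[of "\<lambda>n. X n b \<in> S", OF n] not_less_Least[of _ "\<lambda>n. X n b \<in> S"] by blast
    qed
    then show ?thesis by blast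
  qed
  ultimately show ?thesis using pr_good[of Q] unfolding pr_def by simp
qed

text \<open>Off \<open>F\<close>, a saturated set contains all of S_k or none of it. The low images
  of S_d and the high images of S_(d+1) have the same mass h, so each branch collects h once for
  every S_k in the set.\<close>

lemma S_halves_sat:
  assumes C: "sat C"
  shows "(\<Sum>d\<le>N. pr (\<lambda>b. good b \<and> (real d + xv b) / \<beta> \<in> C \<inter> S \<and> (xv b \<le> P - 1) = t)) =
     (\<Sum>d\<le>N. pr (\<lambda>b. good b \<and> (real d + xv b) / \<beta> \<in> C \<inter> S)) / 2"
proof -
  have [measurable]: "C \<in> sets borel" using C by (simp add: sat_def)
  \<comment> \<open>The k for which S_k meets \<open>C\<close> off \<open>F\<close>, and hence is
    contained in it off \<open>F\<close>.\<close>
  define \<kappa> where "\<kappa> = {k\<in>{1..N}. \<exists>x\<in>C. x \<notin> F \<and> 0 \<le> \<beta> * x - real k \<and> \<beta> * x - real k \<le> P - 1}"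
  have key: "x \<in> C" if "k \<in> \<kappa>" "x \<notin> F" "0 \<le> \<beta> * x - real k" "\<beta> * x - real k \<le> P - 1" for x k
  proof -
    obtain x' where x': "x' \<in> C" "x' \<notin> F" "0 \<le> \<beta> * x' - real k" "\<beta> * x' - real k \<le> P - 1" and k: "k \<in> {1..N}"
      using \<open>k \<in> \<kappa>\<close> unfolding \<kappa>_def by blast
    have "x' \<in> {0..P}" by (rule x_range[of k "\<beta> * x' - real k"]) (use k x' in auto)
    then show ?thesis using satD[OF C _ x'(2) S_cell[OF x'(2) that(2) k x'(3,4) that(3,4)] x'(1)] by blast
  qed
  have inS: "x \<in> S" if "k \<in> \<kappa>" "0 \<le> \<beta> * x - real k" "\<beta> * x - real k \<le> P - 1" for x k
    using that unfolding \<kappa>_def mem_switch by blast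
  have y: "xv b \<in> {0..P} \<and> xv b \<notin> F \<and> (real d + xv b) / \<beta> \<notin> F \<and> \<beta> * ((real d + xv b) / \<beta>) = real d + xv b" 
    if "b \<in> space D" "good b" "d \<le> N" for b d
  proof -
    have e: "\<beta> * ((real d + xv b) / \<beta>) = real d + xv b" using beta_gt1 by simp
    have "xv b \<notin> F" using that(2) X_0 unfolding good_def by metis
    then show ?thesis using pull_not_F[OF that(3) _ _ e] xv_range[OF that(1)] e by blast
  qed
  define h where "h = pr (\<lambda>b. xv b \<le> P - 1)"
  have h': "h = pr (\<lambda>b. xv b \<ge> 1)" by (simp add: h_def pr_S_halves)
  let ?R = "\<lambda>t d. pr (\<lambda>b. good b \<and> (real d + xv b) / \<beta> \<in> C \<inter> S \<and> (xv b \<le> P - 1) = t)"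
  have T: "?R True d = (if d \<in> \<kappa> then h else 0)" if d: "d \<le> N" for d
  proof -
    have "?R True d = pr (\<lambda>b. good b \<and> (d \<in> \<kappa> \<and> xv b \<le> P - 1))"
    proof (rule pr_cong, rule conj_cong, rule refl)
      fix b assume b: "b \<in> space D" "good b"
      let ?x = "(real d + xv b) / \<beta>"
      note yb = y[OF b d]
      show "?x \<in> C \<inter> S \<and> (xv b \<le> P - 1) = True \<longleftrightarrow> d \<in> \<kappa> \<and> xv b \<le> P - 1"
      proof
        assume a: "?x \<in> C \<inter> S \<and> (xv b \<le> P - 1) = True"
        then have "1 \<le> d" using digit_S[of ?x d "xv b"] d yb P_less2 by auto
        moreover have "0 \<le> \<beta> * ?x - real d \<and> \<beta> * ?x - real d \<le> P - 1" using yb a by auto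
        ultimately show "d \<in> \<kappa> \<and> xv b \<le> P - 1" using a d yb unfolding \<kappa>_def by auto
      next
        assume a: "d \<in> \<kappa> \<and> xv b \<le> P - 1"
        then have "0 \<le> \<beta> * ?x - real d \<and> \<beta> * ?x - real d \<le> P - 1" using yb by auto
        then show "?x \<in> C \<inter> S \<and> (xv b \<le> P - 1) = True" using a key[of d ?x] inS[of d ?x] yb by blast
      qed
    qed
    also have "\<dots> = pr (\<lambda>b. d \<in> \<kappa> \<and> xv b \<le> P - 1)" by (rule pr_good) measurable
    finally show ?thesis by (auto simp: h_def pr_False)
  qed
  have FF: "?R False d = (if Suc d \<in> \<kappa> then h else 0)" if d: "d \<le> N" for d
  proof -
    have "?R False d = pr (\<lambda>b. good b \<and> (Suc d \<in> \<kappa> \<and> xv b \<ge> 1))"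
    proof (rule pr_cong, rule conj_cong, rule refl)
      fix b assume b: "b \<in> space D" "good b"
      let ?x = "(real d + xv b) / \<beta>"
      note yb = y[OF b d]
      show "?x \<in> C \<inter> S \<and> (xv b \<le> P - 1) = False \<longleftrightarrow> Suc d \<in> \<kappa> \<and> xv b \<ge> 1"
      proof
        assume a: "?x \<in> C \<inter> S \<and> (xv b \<le> P - 1) = False"
        then have s: "d < N" "1 \<le> xv b" using digit_S[of ?x d "xv b"] d yb by auto
        moreover have "0 \<le> \<beta> * ?x - real (Suc d) \<and> \<beta> * ?x - real (Suc d) \<le> P - 1" using yb s by auto
        ultimately show "Suc d \<in> \<kappa> \<and> xv b \<ge> 1" using a d yb unfolding \<kappa>_def by auto
      next
        assume a: "Suc d \<in> \<kappa> \<and> xv b \<ge> 1"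
        then have "0 \<le> \<beta> * ?x - real (Suc d) \<and> \<beta> * ?x - real (Suc d) \<le> P - 1" using yb by auto
        moreover have "(xv b \<le> P - 1) = False" using a P_less2 by auto
        ultimately show "?x \<in> C \<inter> S \<and> (xv b \<le> P - 1) = False" using a key[of "Suc d" ?x] inS[of "Suc d" ?x] yb by blast
      qed
    qed
    also have "\<dots> = pr (\<lambda>b. Suc d \<in> \<kappa> \<and> xv b \<ge> 1)" by (rule pr_good) measurable
    finally show ?thesis by (auto simp: h' pr_False)
  qed
  \<comment> \<open>The larger digit at S_k is k and the smaller one k - 1; since \<kappa> lies in
    {1..\<open>N\<close>}, shifting the index loses no term.\<close>
  have eq: "(\<Sum>d\<le>N. ?R True d) = (\<Sum>d\<le>N. ?R False d)"
  proof -
    have "0 \<notin> \<kappa>" "Suc N \<notin> \<kappa>" by (auto simp: \<kappa>_def)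
    then have "(\<Sum>d\<le>N. if d \<in> \<kappa> then h else 0) = (\<Sum>d\<le>Suc N. if d \<in> \<kappa> then h else 0)" by simp
    also have "\<dots> = (\<Sum>d\<le>N. if Suc d \<in> \<kappa> then h else 0)"
      using \<open>0 \<notin> \<kappa>\<close> by (subst sum.atMost_Suc_shift) simp
    finally show ?thesis using T FF by simp
  qed
  have "pr (\<lambda>b. good b \<and> (real d + xv b) / \<beta> \<in> C \<inter> S) = ?R True d + ?R False d" for d
    unfolding pr_def
    by (subst D.finite_measure_Union[symmetric]) (auto intro!: arg_cong[where f="measure D"])
  then have "(\<Sum>d\<le>N. pr (\<lambda>b. good b \<and> (real d + xv b) / \<beta> \<in> C \<inter> S)) = (\<Sum>d\<le>N. ?R True d) + (\<Sum>d\<le>N. ?R False d)"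
    by (simp only: sum.distrib)
  then show ?thesis using eq by (cases t) auto
qed

text \<open>On unions of cells the choices at \<open>S\<close> are fair coin tosses independent of the position.
  This fails for general Borel sets: the two branches of \<open>S\<^sub>k\<close> map onto the two intervals
  \<open>{0..P - 1}\<close> and \<open>{1..P}\<close>, which have equal mass, but they are exchanged by a reflection and
  not by a translation.\<close>

lemma om_indep:
  assumes "sat C"
  shows "pr (\<lambda>b. (\<forall>i<j. om b i = \<eta> i) \<and> xv b \<in> C) = pr (\<lambda>b. xv b \<in> C) / 2 ^ j"
  using assms
proof (induction j arbitrary: \<eta> C)
  case (Suc j)
  let ?A = "\<lambda>\<eta> j b. \<forall>i<j. om b i = (\<eta> :: nat \<Rightarrow> bool) i"
  have A_S: "?A \<eta> (Suc j) (cons d b) \<longleftrightarrow> (xv b \<le> P - 1) = \<eta> 0 \<and> ?A (\<lambda>i. \<eta> (Suc i)) j b" if "xv (cons d b) \<in> S" for d b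
    using that unfolding All_less_Suc2 om_cons by simp
  have A_nS: "?A \<eta> (Suc j) (cons d b) \<longleftrightarrow> ?A \<eta> (Suc j) b" if "xv (cons d b) \<notin> S" for d b
    using that unfolding om_cons by simp
  \<comment> \<open>Induction on the time of the first visit, for all saturated sets at once. A step
    outside \<open>S\<close> leaves \<open>om\<close> unchanged and replaces \<open>C\<close> by its
    pull-back; the visit itself consumes one coin and leaves j coins to the outer
    hypothesis.\<close>
  have step: "pr (\<lambda>b. good b \<and> (?A \<eta> (Suc j) b \<and> xv b \<in> C) \<and> first_hit n b) =
      pr (\<lambda>b. good b \<and> xv b \<in> C \<and> first_hit n b) / 2 ^ Suc j" if "sat C" for n C
    using that
  proof (induction n arbitrary: C)
    case 0
    have [measurable]: "C \<in> sets borel" using 0 by (simp add: sat_def)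
    have fh: "first_hit 0 b \<longleftrightarrow> xv b \<in> S" for b by (simp add: first_hit_def X_0)
    have "pr (\<lambda>b. good (cons d b) \<and> (?A \<eta> (Suc j) (cons d b) \<and> xv (cons d b) \<in> C) \<and> xv (cons d b) \<in> S) =
        pr (\<lambda>b. good b \<and> (real d + xv b) / \<beta> \<in> C \<inter> S \<and> (xv b \<le> P - 1) = \<eta> 0) / 2 ^ j" if d: "d \<le> N" for d
    proof -
      \<comment> \<open>The remainders for which the digit d leads to a point of \<open>C\<close> in
        \<open>S\<close> whose coin shows \<eta> 0. The outer hypothesis applies because this set is
        again saturated.\<close>
      let ?C = "{y. (real d + y) / \<beta> \<in> C \<inter> S} \<inter> {y. (y \<le> P - 1) = \<eta> 0}"
      have sC: "sat ?C" using sat_Int sat_low sat_pull sat_S 0 d by blast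
      have [measurable]: "?C \<in> sets borel" using sC by (simp add: sat_def)
      have "pr (\<lambda>b. good (cons d b) \<and> (?A \<eta> (Suc j) (cons d b) \<and> xv (cons d b) \<in> C) \<and> xv (cons d b) \<in> S) =
         pr (\<lambda>b. good b \<and> (?A (\<lambda>i. \<eta> (Suc i)) j b \<and> xv b \<in> ?C))"
      proof (rule pr_cong)
        fix b assume b: "b \<in> space D"
        show "(good (cons d b) \<and> (?A \<eta> (Suc j) (cons d b) \<and> xv (cons d b) \<in> C) \<and> xv (cons d b) \<in> S) \<longleftrightarrow>
          (good b \<and> (?A (\<lambda>i. \<eta> (Suc i)) j b \<and> xv b \<in> ?C))"
        proof (cases "xv (cons d b) \<in> S")
          case True
          show ?thesis unfolding A_S[OF True] good_cons[OF d b]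
            using True xv_cons'[OF d b] by auto
        next
          case False then show ?thesis using xv_cons'[OF d b] by auto
        qed
      qed
      also have "\<dots> = pr (\<lambda>b. ?A (\<lambda>i. \<eta> (Suc i)) j b \<and> xv b \<in> ?C)" by (rule pr_good) measurable
      also have "\<dots> = pr (\<lambda>b. xv b \<in> ?C) / 2 ^ j" using Suc.IH[OF sC] .
      also have "pr (\<lambda>b. xv b \<in> ?C) = pr (\<lambda>b. good b \<and> xv b \<in> ?C)" by (rule pr_good[symmetric]) measurable
      also have "\<dots> = pr (\<lambda>b. good b \<and> (real d + xv b) / \<beta> \<in> C \<inter> S \<and> (xv b \<le> P - 1) = \<eta> 0)"
        by (rule pr_cong) auto
      finally show ?thesis .
    qed
    then have "pr (\<lambda>b. good b \<and> (?A \<eta> (Suc j) b \<and> xv b \<in> C) \<and> xv b \<in> S) =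
       (\<Sum>d\<le>N. pr (\<lambda>b. good b \<and> (real d + xv b) / \<beta> \<in> C \<inter> S \<and> (xv b \<le> P - 1) = \<eta> 0)) / 2 ^ j / (real N + 1)"
      by (subst pr_step) (simp_all add: sum_divide_distrib)
    also have "\<dots> = (\<Sum>d\<le>N. pr (\<lambda>b. good b \<and> (real d + xv b) / \<beta> \<in> C \<inter> S)) / (real N + 1) / 2 ^ Suc j"
      unfolding S_halves_sat[OF 0] by simp
    also have "(\<Sum>d\<le>N. pr (\<lambda>b. good b \<and> (real d + xv b) / \<beta> \<in> C \<inter> S)) / (real N + 1) =
      (\<Sum>d\<le>N. pr (\<lambda>b. good (cons d b) \<and> xv (cons d b) \<in> C \<and> xv (cons d b) \<in> S)) / (real N + 1)"
    proof (rule arg_cong[where f="\<lambda>x. x / (real N + 1)"], rule sum.cong[OF refl], rule pr_cong)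
      fix d b assume "d \<in> {..N}" "b \<in> space D"
      then have d: "d \<le> N" "b \<in> space D" by auto
      show "(good b \<and> (real d + xv b) / \<beta> \<in> C \<inter> S) = (good (cons d b) \<and> xv (cons d b) \<in> C \<and> xv (cons d b) \<in> S)"
        unfolding good_cons[OF d] xv_cons'[OF d] by blast
    qed
    also have "\<dots> = pr (\<lambda>b. good b \<and> xv b \<in> C \<and> xv b \<in> S)" by (rule pr_step[symmetric]) measurable
    finally show ?case unfolding fh .
  next
    case (Suc n)
    have [measurable]: "C \<in> sets borel" using Suc by (simp add: sat_def)
    let ?C = "\<lambda>d. {y. (real d + y) / \<beta> \<in> C \<inter> - S}"
    have sC: "sat (?C d)" if "d \<le> N" for d using sat_Int sat_pull sat_Compl_S Suc.prems that by blast
    have "pr (\<lambda>b. good b \<and> (?A \<eta> (Suc j) b \<and> xv b \<in> C) \<and> first_hit (Suc n) b) =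
      (\<Sum>d\<le>N. pr (\<lambda>b. good (cons d b) \<and> (?A \<eta> (Suc j) (cons d b) \<and> xv (cons d b) \<in> C) \<and> first_hit (Suc n) (cons d b))) / (real N + 1)"
      by (rule pr_step) measurable
    also have "\<dots> = (\<Sum>d\<le>N. pr (\<lambda>b. good b \<and> (?A \<eta> (Suc j) b \<and> xv b \<in> ?C d) \<and> first_hit n b)) / (real N + 1)"
    proof (rule arg_cong[where f="\<lambda>x. x / (real N + 1)"], rule sum.cong[OF refl], rule pr_cong)
      fix d b assume "d \<in> {..N}" "b \<in> space D"
      then have d: "d \<le> N" "b \<in> space D" by auto
      show "(good (cons d b) \<and> (?A \<eta> (Suc j) (cons d b) \<and> xv (cons d b) \<in> C) \<and> first_hit (Suc n) (cons d b)) \<longleftrightarrow>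
        (good b \<and> (?A \<eta> (Suc j) b \<and> xv b \<in> ?C d) \<and> first_hit n b)"
      proof (cases "xv (cons d b) \<in> S")
        case False
        show ?thesis unfolding A_nS[OF False] good_cons[OF d] first_hit_cons
          using False xv_cons'[OF d] by auto
      next
        case True then show ?thesis using xv_cons'[OF d] unfolding first_hit_cons by auto
      qed
    qed
    also have "\<dots> = (\<Sum>d\<le>N. pr (\<lambda>b. good b \<and> xv b \<in> ?C d \<and> first_hit n b) / 2 ^ Suc j) / (real N + 1)"
      using Suc.IH[OF sC] by simp
    also have "\<dots> = (\<Sum>d\<le>N. pr (\<lambda>b. good b \<and> xv b \<in> ?C d \<and> first_hit n b)) / (real N + 1) / 2 ^ Suc j"
      by (simp only: sum_divide_distrib[symmetric] divide_divide_eq_left mult.commute)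
    also have "(\<Sum>d\<le>N. pr (\<lambda>b. good b \<and> xv b \<in> ?C d \<and> first_hit n b)) / (real N + 1) =
      (\<Sum>d\<le>N. pr (\<lambda>b. good (cons d b) \<and> xv (cons d b) \<in> C \<and> first_hit (Suc n) (cons d b))) / (real N + 1)"
    proof (rule arg_cong[where f="\<lambda>x. x / (real N + 1)"], rule sum.cong[OF refl], rule pr_cong)
      fix d b assume "d \<in> {..N}" "b \<in> space D"
      then have d: "d \<le> N" "b \<in> space D" by auto
      show "(good b \<and> xv b \<in> ?C d \<and> first_hit n b) = (good (cons d b) \<and> xv (cons d b) \<in> C \<and> first_hit (Suc n) (cons d b))"
        unfolding good_cons[OF d] first_hit_cons xv_cons'[OF d] by auto
    qed
    also have "\<dots> = pr (\<lambda>b. good b \<and> xv b \<in> C \<and> first_hit (Suc n) b)" by (rule pr_step[symmetric]) measurable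
    finally show ?case .
  qed
  have [measurable]: "C \<in> sets borel" using Suc.prems by (simp add: sat_def)
  have 1: "(\<lambda>n. pr (\<lambda>b. good b \<and> xv b \<in> C \<and> first_hit n b)) sums pr (\<lambda>b. xv b \<in> C)"
    by (rule first_hit_sums) measurable
  have 2: "(\<lambda>n. pr (\<lambda>b. good b \<and> (?A \<eta> (Suc j) b \<and> xv b \<in> C) \<and> first_hit n b)) sums pr (\<lambda>b. ?A \<eta> (Suc j) b \<and> xv b \<in> C)"
    by (rule first_hit_sums) measurable
  have "(\<lambda>n. pr (\<lambda>b. good b \<and> (?A \<eta> (Suc j) b \<and> xv b \<in> C) \<and> first_hit n b)) sums (pr (\<lambda>b. xv b \<in> C) / 2 ^ Suc j)"
    unfolding step[OF Suc.prems] by (rule sums_divide[OF 1])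
  then show ?case using 2 sums_unique2 by blast
qed simp

subsection \<open>The measure of cylinders\<close>

lemma rand_step_b:
  assumes "b \<in> space D"
  shows "rand_digit1 \<beta> (om b, xv b) = b 0" and "K (om b, xv b) = (om (shiftn 1 b), xv (shiftn 1 b))"
proof -
  have d: "b 0 \<le> N" using assms by (simp add: space_D)
  have y: "0 \<le> xv (shiftn 1 b)" "xv (shiftn 1 b) \<le> P" using xv_range[OF shiftn_space[OF assms, of 1]] by auto
  have o: "om b 0 = (xv (shiftn 1 b) \<le> P - 1)" if "xv b \<in> S" using that by (subst om_step) simp
  show "rand_digit1 \<beta> (om b, xv b) = b 0"
    using rand_step(1)[OF d y xv_step[OF assms], of "om b"] o by blast
  have "(if xv b \<in> S then (\<lambda>n. om b (Suc n)) else om b) = om (shiftn 1 b)"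
    by (subst (1 2) om_step) auto
  then show "K (om b, xv b) = (om (shiftn 1 b), xv (shiftn 1 b))"
    using rand_step(2)[OF d y xv_step[OF assms], of "om b"] o by simp
qed

definition psi :: "(nat \<Rightarrow> nat) \<Rightarrow> omega \<times> real" where "psi b = (om b, xv b)"

lemma K_psi: "b \<in> space D \<Longrightarrow> (K ^^ n) (psi b) = psi (shiftn n b)"
proof (induction n)
  case (Suc n)
  then show ?case using rand_step_b(2)[OF shiftn_space[of b n]] by (simp add: psi_def shiftn_shiftn)
qed (simp add: shiftn_0)

lemma phi_psi: "b \<in> space D \<Longrightarrow> rand_phi \<beta> (psi b) = b"
proof
  fix i assume b: "b \<in> space D"
  show "rand_phi \<beta> (psi b) i = b i"
    using rand_step_b(1)[OF shiftn_space[OF b, of i], folded psi_def]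
    by (simp add: rand_phi_def rand_digit_def K_psi[OF b]) (simp add: shiftn_def)
qed

lemma rand_phi_K: "rand_phi \<beta> (K z) = shiftn 1 (rand_phi \<beta> z)"
  by (simp add: rand_phi_def shiftn_def rand_digit_def fun_eq_iff funpow_swap1)

lemma rand_phi_0: "rand_phi \<beta> z 0 = rand_digit1 \<beta> z"
  by (simp add: rand_phi_def rand_digit_def)

lemma phi_space:
  assumes "snd z \<in> {0..P}"
  shows "rand_phi \<beta> z \<in> space D"
  unfolding space_D
proof
  fix i
  obtain w y where w: "(K ^^ i) z = (w, y)" by fastforce
  then have "y \<in> {0..P}" using K_range[of "snd z" i "fst z"] assms by simp
  then show "rand_phi \<beta> z i \<le> N" using rand_digit1_props(1)[of y w] w by (simp add: rand_phi_def rand_digit_def)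
qed

lemma K_snd:
  assumes "snd z \<in> {0..P}"
  shows "snd (K z) \<in> {0..P}" "\<beta> * snd z = real (rand_digit1 \<beta> z) + snd (K z)"
    "snd z \<in> S \<Longrightarrow> fst z 0 \<longleftrightarrow> snd (K z) \<le> P - 1"
    "fst (K z) = (if snd z \<in> S then (\<lambda>n. fst z (Suc n)) else fst z)"
  using rand_digit1_props[of "snd z" "fst z"] assms by auto

text \<open>Both quantities obey the same affine recursion along the orbit, so their difference
  grows by the factor \<beta> at each step although it can never exceed \<open>P\<close>.\<close>

lemma xv_phi:
  assumes "snd z \<in> {0..P}"
  shows "xv (rand_phi \<beta> z) = snd z"
proof -
  have diff: "\<beta> ^ n * \<bar>xv (rand_phi \<beta> z) - snd z\<bar> \<le> P" for n
    using assms
  proof (induction n arbitrary: z)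
    case 0 then show ?case using xv_range[OF phi_space[OF 0]] by auto
  next
    case (Suc n)
    have "\<beta> * xv (rand_phi \<beta> z) = real (rand_digit1 \<beta> z) + xv (rand_phi \<beta> (K z))"
      using xv_step[OF phi_space[OF Suc.prems]] by (simp add: rand_phi_0 rand_phi_K)
    then have "\<beta> * (xv (rand_phi \<beta> z) - snd z) = xv (rand_phi \<beta> (K z)) - snd (K z)"
      using K_snd(2)[OF Suc.prems] by (simp add: right_diff_distrib)
    then have "\<beta> * \<bar>xv (rand_phi \<beta> z) - snd z\<bar> = \<bar>xv (rand_phi \<beta> (K z)) - snd (K z)\<bar>"
      using beta_gt1 by (metis abs_mult abs_of_pos less_trans zero_less_one)
    then have "\<beta> ^ Suc n * \<bar>xv (rand_phi \<beta> z) - snd z\<bar> = \<beta> ^ n * \<bar>xv (rand_phi \<beta> (K z)) - snd (K z)\<bar>"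
      by (simp only: power_Suc2 mult.assoc)
    then show ?case using Suc.IH[OF K_snd(1)[OF Suc.prems]] by (simp only:)
  qed
  show ?thesis
  proof (rule ccontr)
    assume "\<not> ?thesis"
    then have e: "\<bar>xv (rand_phi \<beta> z) - snd z\<bar> > 0" by simp
    obtain n where "P / \<bar>xv (rand_phi \<beta> z) - snd z\<bar> < \<beta> ^ n" using beta_gt1 real_arch_pow by blast
    then show False using diff[of n] e by (simp add: field_simps)
  qed
qed

lemma K_range': "snd z \<in> {0..P} \<Longrightarrow> snd ((K ^^ n) z) \<in> {0..P}"
  using K_range[of "snd z" n "fst z"] by simp

text \<open>The coin read by a visit at time n is the coordinate of \<omega> indexed by the number
  of earlier visits, and it can be recovered from the digit taken there.\<close>

lemma om_phi_hit:
  assumes "snd z \<in> {0..P}" "snd ((K ^^ n) z) \<in> S"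
  shows "om (rand_phi \<beta> z) (card {i. i < n \<and> snd ((K ^^ i) z) \<in> S}) = fst z (card {i. i < n \<and> snd ((K ^^ i) z) \<in> S})"
  using assms
proof (induction n arbitrary: z)
  case 0
  then have "om (rand_phi \<beta> z) 0 = (xv (rand_phi \<beta> (K z)) \<le> P - 1)"
    by (subst om_step) (simp add: xv_phi rand_phi_K)
  then show ?case using K_snd[OF 0(1)] 0 xv_phi by simp
next
  case (Suc n)
  let ?c = "\<lambda>n z. card {i. i < n \<and> snd ((K ^^ i) z) \<in> S}"
  have c: "?c (Suc n) z = (if snd z \<in> S then 1 else 0) + ?c n (K z)"
  proof -
    have "{i. i < Suc n \<and> snd ((K ^^ i) z) \<in> S} = 
      (if snd z \<in> S then {0} else {}) \<union> Suc ` {i. i < n \<and> snd ((K ^^ i) (K z)) \<in> S}" (is "_ = ?R")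
    proof (rule set_eqI)
      fix i show "i \<in> {i. i < Suc n \<and> snd ((K ^^ i) z) \<in> S} \<longleftrightarrow> i \<in> ?R"
        by (cases i) (auto simp: funpow_swap1)
    qed
    then show ?thesis by (simp add: card_image)
  qed
  have "snd ((K ^^ n) (K z)) \<in> S" using Suc.prems(2) by (simp add: funpow_swap1)
  note IH = Suc.IH[OF K_snd(1)[OF Suc.prems(1)] this]
  have "om (rand_phi \<beta> z) = (if snd z \<in> S then case_nat (xv (rand_phi \<beta> (K z)) \<le> P - 1) (om (rand_phi \<beta> (K z))) else om (rand_phi \<beta> (K z)))"
    by (subst om_step) (simp add: xv_phi[OF Suc.prems(1)] rand_phi_K)
  then show ?case using IH K_snd(4)[OF Suc.prems(1)] unfolding c by simp
qed

text \<open>With infinitely many visits to \<open>S\<close> every coordinate of \<omega> is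
  eventually read, so the digits determine all of it.\<close>

lemma psi_phi:
  assumes "z \<in> rand_Z \<beta>"
  shows "psi (rand_phi \<beta> z) = z"
proof -
  have r: "snd z \<in> {0..P}" using assms by (auto simp: rand_Z_def expI_eq)
  have inf: "infinite {n. snd ((K ^^ n) z) \<in> S}" using assms by (simp add: rand_Z_def S_def)
  have "om (rand_phi \<beta> z) j = fst z j" for j
  proof -
    obtain n where n: "snd ((K ^^ n) z) \<in> S" "card {i\<in>{n. snd ((K ^^ n) z) \<in> S}. i < n} = j"
      using infinite_nth_element[OF inf, of j] by blast
    have "{i\<in>{n. snd ((K ^^ n) z) \<in> S}. i < n} = {i. i < n \<and> snd ((K ^^ i) z) \<in> S}" by auto
    then show ?thesis using om_phi_hit[OF r n(1)] n(2) by simp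
  qed
  then show ?thesis using xv_phi[OF r] by (simp add: psi_def prod_eq_iff fun_eq_iff)
qed

lemma space_rand: "space (rand_space \<beta>) = UNIV \<times> {0..P}"
  by (simp add: rand_space_def space_pair_measure space_PiM space_restrict_space expI_eq PiE_UNIV_domain)

lemma psi_measurable[measurable]: "psi \<in> measurable D (rand_space \<beta>)"
  unfolding psi_def[abs_def] rand_space_def
proof (rule measurable_Pair)
  show "om \<in> measurable D (PiM UNIV (\<lambda>i. count_space UNIV))"
  proof (rule measurable_PiM_single')
    show "(\<lambda>b. om b i) \<in> measurable D (count_space UNIV)" for i by measurable
  qed auto
  show "xv \<in> measurable D (restrict_space borel (expI \<beta>))"
    by (rule measurable_restrict_space2) (use xv_range in \<open>auto simp: expI_eq\<close>)
qed

lemma psi_Z_iff: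
  assumes "b \<in> space D"
  shows "psi b \<in> rand_Z \<beta> \<longleftrightarrow> (\<forall>m. \<exists>n\<ge>m. X n b \<in> S)"
proof -
  have "psi b \<in> rand_Z \<beta> \<longleftrightarrow> snd (psi b) \<in> {0..P} \<and> infinite {n. snd ((K ^^ n) (psi b)) \<in> S}"
    by (simp add: rand_Z_def expI_eq S_def mem_Times_iff)
  moreover have "snd ((K ^^ n) (psi b)) = X n b" for n using K_psi[OF assms] by (simp add: psi_def)
  moreover have "snd (psi b) \<in> {0..P}" using xv_range[OF assms] by (simp add: psi_def)
  ultimately show ?thesis by (simp add: infinite_nat_iff_unbounded_le)
qed

lemma psi_Z:
  assumes "b \<in> space D" "good b"
  shows "psi b \<in> rand_Z \<beta>"
  unfolding psi_Z_iff[OF assms(1)]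
proof
  fix m
  have "\<not> never (shiftn m b)" using assms(2) unfolding good_def by blast
  then obtain n where "X (n + m) b \<in> S" unfolding never_def shiftn_shiftn by blast
  then show "\<exists>n\<ge>m. X n b \<in> S" by (intro exI[of _ "n + m"]) auto
qed

text \<open>On \<open>rand_Z\<close> the maps \<open>rand_phi\<close> and \<open>psi\<close> invert
  each other, so the image under \<open>rand_phi\<close> is a preimage under \<open>psi\<close>.
  Restricting to \<open>rand_Z\<close> costs only a null set, since good sequences are sent into
  it.\<close>

lemma nu_eq: "nu \<beta> = distr D (rand_space \<beta>) psi"
  unfolding nu_def distr_def
proof (rule measure_of_eq)
  show "sets (rand_space \<beta>) \<subseteq> Pow (space (rand_space \<beta>))" by (rule sets.space_closed)
  fix A assume "A \<in> sigma_sets (space (rand_space \<beta>)) (sets (rand_space \<beta>))"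
  then have A: "A \<in> sets (rand_space \<beta>)" by (simp add: sets.sigma_sets_eq)
  then have pA: "psi -` A \<inter> space D \<in> sets D" by (rule measurable_sets[OF psi_measurable])
  have im: "rand_phi \<beta> ` (A \<inter> rand_Z \<beta>) = {b\<in>space D. psi b \<in> A \<inter> rand_Z \<beta>}"
  proof (intro set_eqI iffI)
    fix b assume "b \<in> rand_phi \<beta> ` (A \<inter> rand_Z \<beta>)"
    then obtain z where z: "z \<in> A \<inter> rand_Z \<beta>" "b = rand_phi \<beta> z" by blast
    then have "snd z \<in> {0..P}" by (auto simp: rand_Z_def expI_eq)
    then show "b \<in> {b\<in>space D. psi b \<in> A \<inter> rand_Z \<beta>}" using z psi_phi phi_space by auto
  next
    fix b assume "b \<in> {b\<in>space D. psi b \<in> A \<inter> rand_Z \<beta>}"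
    then show "b \<in> rand_phi \<beta> ` (A \<inter> rand_Z \<beta>)" using phi_psi[of b] by (metis (mono_tags, lifting) image_eqI mem_Collect_eq)
  qed
  have "{b\<in>space D. psi b \<in> A \<inter> rand_Z \<beta>} \<in> sets D"
  proof -
    have "{b\<in>space D. psi b \<in> A \<inter> rand_Z \<beta>} = {b\<in>space D. psi b \<in> A \<and> (\<forall>m. \<exists>n\<ge>m. X n b \<in> S)}"
      using psi_Z_iff by blast
    also have "\<dots> \<in> sets D" using A by measurable
    finally show ?thesis .
  qed
  then show "emeasure (digit_measure \<beta>) (rand_phi \<beta> ` (A \<inter> rand_Z \<beta>)) = emeasure D (psi -` A \<inter> space D)"
    unfolding im D_def[symmetric]
    by (intro emeasure_eq_AE) (use AE_good AE_space psi_Z pA in \<open>auto elim!: eventually_elim2\<close>)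
qed

lemma measure_nu:
  assumes "A \<in> sets (rand_space \<beta>)"
  shows "measure (nu \<beta>) A = pr (\<lambda>b. psi b \<in> A)"
  unfolding nu_eq pr_def using assms by (subst measure_distr) (auto intro!: arg_cong[where f="measure D"])

section \<open>Positive lower bounds for the masses of cells\<close>

text \<open>Sequences that share their first l digits with e have values within \<open>P\<close> /
  \<beta>^l of each other, and they have mass (\<open>N\<close> + 1)^(-l).\<close>

lemma pr_near:
  assumes "e \<in> space D"
  shows "(1 / (real N + 1)) ^ l \<le> pr (\<lambda>b. \<bar>xv b - xv e\<bar> \<le> P / \<beta> ^ l)"
  using assms
proof (induction l arbitrary: e)
  case 0
  have "pr (\<lambda>b. \<bar>xv b - xv e\<bar> \<le> P / \<beta> ^ 0) = pr (\<lambda>b. True)"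
  proof (rule pr_cong)
    fix b assume "b \<in> space D"
    then show "(\<bar>xv b - xv e\<bar> \<le> P / \<beta> ^ 0) = True" using xv_range[OF 0] xv_range[of b] by auto
  qed
  then show ?case by (simp add: pr_True)
next
  case (Suc l)
  have d: "e 0 \<le> N" using Suc.prems by (simp add: space_D)
  let ?f = "\<lambda>d. pr (\<lambda>b. \<bar>xv (cons d b) - xv e\<bar> \<le> P / \<beta> ^ Suc l)"
  have "(1 / (real N + 1)) ^ Suc l \<le> pr (\<lambda>b. \<bar>xv b - xv (shiftn 1 e)\<bar> \<le> P / \<beta> ^ l) / (real N + 1)"
    using Suc.IH[OF shiftn_space[OF Suc.prems, of 1]] by (simp add: divide_right_mono)
  also have "pr (\<lambda>b. \<bar>xv b - xv (shiftn 1 e)\<bar> \<le> P / \<beta> ^ l) = ?f (e 0)"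
  proof (rule pr_cong)
    fix b assume b: "b \<in> space D"
    have "\<beta> * (xv (cons (e 0) b) - xv e) = xv b - xv (shiftn 1 e)"
      using xv_cons[OF d b] xv_step[OF Suc.prems] by (simp add: right_diff_distrib)
    then have "\<beta> * \<bar>xv (cons (e 0) b) - xv e\<bar> = \<bar>xv b - xv (shiftn 1 e)\<bar>"
      using beta_gt1 by (metis abs_mult abs_of_pos less_trans zero_less_one)
    then have "\<bar>xv b - xv (shiftn 1 e)\<bar> \<le> P / \<beta> ^ l \<longleftrightarrow> \<beta> * \<bar>xv (cons (e 0) b) - xv e\<bar> \<le> \<beta> * (P / \<beta> ^ Suc l)"
      using beta_gt1 by simp
    then show "\<bar>xv b - xv (shiftn 1 e)\<bar> \<le> P / \<beta> ^ l \<longleftrightarrow> \<bar>xv (cons (e 0) b) - xv e\<bar> \<le> P / \<beta> ^ Suc l"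
      using beta_gt1 by (simp only: mult_le_cancel_left_pos)
  qed
  also have "?f (e 0) / (real N + 1) \<le> (\<Sum>d\<le>N. ?f d) / (real N + 1)"
    by (intro divide_right_mono member_le_sum) (use d pr_nonneg in auto)
  also have "\<dots> = pr (\<lambda>b. \<bar>xv b - xv e\<bar> \<le> P / \<beta> ^ Suc l)" by (rule pr_step[symmetric]) measurable
  finally show ?case .
qed

text \<open>A point off the finite set \<open>F\<close> has positive distance from it, so a short
  interval given by \<open>pr_near\<close> stays inside the cell.\<close>

lemma cell_pos:
  assumes "x \<in> {0..P}" "x \<notin> F"
  shows "pr (\<lambda>b. xv b \<in> cell x) > 0"
proof -
  \<comment> \<open>Some digit sequence with value x; the coins chosen for it are arbitrary.\<close>
  define e where "e = rand_phi \<beta> (undefined, x)"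
  have e: "e \<in> space D" "xv e = x" using phi_space[of "(undefined, x)"] xv_phi[of "(undefined, x)"] assms by (auto simp: e_def)
  have "closed F" using finite_F by (rule finite_imp_closed)
  then have "open (- F)" by (simp add: open_Compl)
  then obtain \<delta> where \<delta>: "\<delta> > 0" "ball x \<delta> \<subseteq> - F" using assms(2) by (meson ComplI openE)
  obtain l where "P / \<delta> < \<beta> ^ l" using beta_gt1 real_arch_pow by blast
  then have l: "P / \<beta> ^ l < \<delta>" using \<delta> beta_gt1 by (simp add: field_simps)
  have "0 < (1 / (real N + 1)) ^ l" by simp
  also have "\<dots> \<le> pr (\<lambda>b. \<bar>xv b - xv e\<bar> \<le> P / \<beta> ^ l)" by (rule pr_near[OF e(1)])
  also have "\<dots> \<le> pr (\<lambda>b. xv b \<in> cell x)"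
  proof (rule pr_mono)
    fix b assume b: "b \<in> space D" "\<bar>xv b - xv e\<bar> \<le> P / \<beta> ^ l"
    then have d: "\<bar>xv b - x\<bar> < \<delta>" using l e by simp
    have "(f < xv b \<longleftrightarrow> f < x) \<and> (xv b < f \<longleftrightarrow> x < f)" if "f \<in> F" for f
    proof -
      have "\<not> \<bar>x - f\<bar> < \<delta>" using that \<delta>(2) by (auto simp: ball_def dist_real_def)
      then show ?thesis using d by auto
    qed
    then show "xv b \<in> cell x" using xv_range[OF b(1)] unfolding cell_def by blast
  qed measurable
  finally show ?thesis .
qed

text \<open>Uniform because there are finitely many cells. This constant bounds the error term q in
  \<open>local_dim_quot_eq\<close>.\<close>

lemma cell_lower: "\<exists>c>0. \<forall>x\<in>{0..P} - F. c \<le> pr (\<lambda>b. xv b \<in> cell x)"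
proof -
  let ?A = "cell ` ({0..P} - F)"
  have fin: "finite ?A" by (rule finite_subset[OF _ cell_finite]) auto
  let ?c = "Min (insert 1 ((\<lambda>C. pr (\<lambda>b. xv b \<in> C)) ` ?A))"
  have "?c > 0" using fin cell_pos by (subst Min_gr_iff) auto
  moreover have "?c \<le> pr (\<lambda>b. xv b \<in> cell x)" if "x \<in> {0..P} - F" for x
    using fin that by (intro Min_le) auto
  ultimately show ?thesis by blast
qed

section \<open>Cylinders of coins and cells\<close>

lemma coding_X_eq: "z \<in> coding_X \<beta> \<longleftrightarrow> snd z \<in> {0..P} \<and> (\<forall>n. snd ((K ^^ n) z) \<notin> F)"
  unfolding coding_X_def expI_eq F_def by (auto simp: mem_Times_iff)

lemma coding_X_K: "z \<in> coding_X \<beta> \<Longrightarrow> K z \<in> coding_X \<beta>"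
  unfolding coding_X_eq using K_snd(1) by (metis comp_apply funpow_Suc_right)

lemma visits_Suc: "visits \<beta> (Suc k) z = (if snd z \<in> S then 1 else 0) + visits \<beta> k (K z)"
proof -
  have "{i. i < Suc k \<and> snd ((K ^^ i) z) \<in> S} = 
    (if snd z \<in> S then {0} else {}) \<union> Suc ` {i. i < k \<and> snd ((K ^^ i) (K z)) \<in> S}" (is "_ = ?R")
  proof (rule set_eqI)
    fix i show "i \<in> {i. i < Suc k \<and> snd ((K ^^ i) z) \<in> S} \<longleftrightarrow> i \<in> ?R"
      by (cases i) (auto simp: funpow_swap1)
  qed
  then show ?thesis by (simp add: visits_def S_def[symmetric] card_image)
qed

text \<open>The numbers of prescribed coins and of steps are separate parameters, because a step
  from \<open>S\<close> lowers both while any other step lowers only k. Balls correspond to j = k +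
  1.\<close>

definition cyl :: "nat \<Rightarrow> nat \<Rightarrow> omega \<times> real \<Rightarrow> (nat \<Rightarrow> nat) \<Rightarrow> bool" where
  "cyl j k z b \<longleftrightarrow> (\<forall>i<j. om b i = fst z i) \<and> (\<forall>i\<le>k. X i b \<in> cell (snd ((K ^^ i) z)))"

lemma cyl_measurable[measurable]: "Measurable.pred D (cyl j k z)"
  unfolding cyl_def[abs_def] by measurable

text \<open>The cells at times 0 and 1 force the digit by \<open>cell_digit\<close>; conversely the
  digit and the cell at time 1 determine the cell at time 0 by \<open>cell_pull\<close>.\<close>

lemma cyl_step:
  assumes z: "z \<in> coding_X \<beta>" and j: "snd z \<in> S \<Longrightarrow> j \<ge> 1" and d: "d \<le> N" and b: "b \<in> space D"
  shows "cyl j (Suc k) z (cons d b) \<longleftrightarrow> d = rand_digit1 \<beta> z \<and> cyl (j - (if snd z \<in> S then 1 else 0)) k (K z) b"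
proof -
  let ?y = "snd (K z)"
  have zr: "snd z \<in> {0..P}" and zF: "snd z \<notin> F" using z unfolding coding_X_eq by (auto dest: spec[of _ 0])
  note Kz = K_snd[OF zr]
  have dz: "rand_digit1 \<beta> z \<le> N" using rand_digit1_props(1)[OF zr, of "fst z"] by simp
  have split: "(\<forall>i\<le>Suc k. X i (cons d b) \<in> cell (snd ((K ^^ i) z))) \<longleftrightarrow>
     xv (cons d b) \<in> cell (snd z) \<and> (\<forall>i\<le>k. X i b \<in> cell (snd ((K ^^ i) (K z))))"
  proof -
    have "(\<forall>i\<le>Suc k. Q i) \<longleftrightarrow> Q 0 \<and> (\<forall>i\<le>k. Q (Suc i))" for Q by (metis Suc_le_mono le0 not0_implies_Suc)
    then show ?thesis by (simp only: X_cons X_0 funpow_simps_right comp_apply) (simp add: id_def)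
  qed
  have imp: "d = rand_digit1 \<beta> z" if "xv (cons d b) \<in> cell (snd z)" "xv b \<in> cell ?y"
    using cell_digit[OF dz d zr zF that(1) Kz(1) that(2) Kz(2) xv_cons[OF d b]] by simp
  have pull: "xv (cons d b) \<in> cell (snd z)" if "d = rand_digit1 \<beta> z" "xv b \<in> cell ?y"
    using cell_pull[OF d Kz(1) that(2)] Kz(2) xv_cons[OF d b] that(1) by simp
  have first: "xv b \<in> cell ?y" if "\<forall>i\<le>k. X i b \<in> cell (snd ((K ^^ i) (K z)))"
    using that[rule_format, of 0] by (simp add: X_0)
  have om: "(\<forall>i<j. om (cons d b) i = fst z i) \<longleftrightarrow> (\<forall>i<j - (if snd z \<in> S then 1 else 0). om b i = fst (K z) i)"
    if a: "xv (cons d b) \<in> cell (snd z)" "xv b \<in> cell ?y"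
  proof (cases "snd z \<in> S")
    case False
    then have "xv (cons d b) \<notin> S" using cell_S[OF a(1)] by simp
    then show ?thesis using False Kz(4) by (simp add: om_cons)
  next
    case True
    then have s: "xv (cons d b) \<in> S" using cell_S[OF a(1)] by simp
    obtain j' where j': "j = Suc j'" using j[OF True] by (cases j) auto
    have "P - 1 < xv b \<longleftrightarrow> P - 1 < ?y" using a(2) s_F unfolding cell_def by blast
    then have "fst z 0 = (xv b \<le> P - 1)" using Kz(3)[OF True] by auto
    then show ?thesis using True s Kz(4) unfolding j' All_less_Suc2 by (simp add: om_cons)
  qed
  show ?thesis unfolding cyl_def split using imp pull first om by blast
qed

text \<open>Each step selects one digit and contributes 1/(\<open>N\<close> + 1). In the base case
  the coins left over are handled by \<open>om_indep\<close>; the bound on the visits keeps the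
  natural subtraction exact.\<close>

lemma pr_cyl:
  assumes "z \<in> coding_X \<beta>" "visits \<beta> k z \<le> j"
  shows "pr (cyl j k z) = pr (\<lambda>b. xv b \<in> cell (snd ((K ^^ k) z))) / ((real N + 1) ^ k * 2 ^ (j - visits \<beta> k z))"
  using assms
proof (induction k arbitrary: j z)
  case 0
  have "pr (cyl j 0 z) = pr (\<lambda>b. (\<forall>i<j. om b i = fst z i) \<and> xv b \<in> cell (snd z))"
    by (rule pr_cong) (simp add: cyl_def X_0)
  also have "\<dots> = pr (\<lambda>b. xv b \<in> cell (snd z)) / 2 ^ j" by (rule om_indep[OF sat_cell])
  finally show ?case by (simp add: visits_def)
next
  case (Suc k)
  let ?j = "j - (if snd z \<in> S then 1 else 0)"
  have jS: "snd z \<in> S \<Longrightarrow> j \<ge> 1" using Suc.prems(2) unfolding visits_Suc by simp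
  have zr: "snd z \<in> {0..P}" using Suc.prems(1) unfolding coding_X_eq by auto
  have dz: "rand_digit1 \<beta> z \<le> N" using rand_digit1_props(1)[OF zr, of "fst z"] by simp
  have "pr (cyl j (Suc k) z) = (\<Sum>d\<le>N. pr (\<lambda>b. cyl j (Suc k) z (cons d b))) / (real N + 1)"
    by (rule pr_step) measurable
  also have "(\<Sum>d\<le>N. pr (\<lambda>b. cyl j (Suc k) z (cons d b))) = (\<Sum>d\<le>N. if d = rand_digit1 \<beta> z then pr (cyl ?j k (K z)) else 0)"
  proof (rule sum.cong[OF refl])
    fix d assume "d \<in> {..N}"
    then have d: "d \<le> N" by simp
    have "pr (\<lambda>b. cyl j (Suc k) z (cons d b)) = pr (\<lambda>b. d = rand_digit1 \<beta> z \<and> cyl ?j k (K z) b)"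
      by (rule pr_cong) (rule cyl_step[OF Suc.prems(1) jS d])
    also have "\<dots> = (if d = rand_digit1 \<beta> z then pr (cyl ?j k (K z)) else 0)"
      using pr_False by auto
    finally show "pr (\<lambda>b. cyl j (Suc k) z (cons d b)) = (if d = rand_digit1 \<beta> z then pr (cyl ?j k (K z)) else 0)" .
  qed
  also have "\<dots> = pr (cyl ?j k (K z))" using dz by simp
  also have "\<dots> = pr (\<lambda>b. xv b \<in> cell (snd ((K ^^ k) (K z)))) / ((real N + 1) ^ k * 2 ^ (?j - visits \<beta> k (K z)))"
    by (rule Suc.IH[OF coding_X_K[OF Suc.prems(1)]]) (use Suc.prems(2) in \<open>simp add: visits_Suc\<close>)
  also have "?j - visits \<beta> k (K z) = j - visits \<beta> (Suc k) z" by (simp add: visits_Suc)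
  finally show ?case by (simp add: funpow_swap1 mult_ac)
qed

subsection \<open>Balls and local dimensions\<close>

lemma snd_rand_measurable: "snd \<in> borel_measurable (rand_space \<beta>)"
  unfolding rand_space_def
  by (rule measurable_compose[OF measurable_snd]) (rule measurable_restrict_space1, simp)

lemma fst_rand_measurable: "fst \<in> measurable (rand_space \<beta>) (PiM UNIV (\<lambda>_. count_space UNIV))"
  unfolding rand_space_def by (rule measurable_fst)

lemma fst_component_measurable: "(\<lambda>z. fst z i) \<in> measurable (rand_space \<beta>) (count_space UNIV)"
  by (rule measurable_compose[OF fst_rand_measurable]) (rule measurable_component_singleton, simp)

text \<open>\<open>rand_step\<close> and \<open>rand_digit1_props\<close> describe the event that
  the digit is d by inequalities in the position and the first coin.\<close>

lemma rand_digit1_measurable: "rand_digit1 \<beta> \<in> measurable (rand_space \<beta>) (count_space UNIV)"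
proof -
  note [measurable] = snd_rand_measurable fst_component_measurable
  have "rand_digit1 \<beta> -` {d} \<inter> space (rand_space \<beta>) \<in> sets (rand_space \<beta>)" for d
  proof -
    have "rand_digit1 \<beta> -` {d} \<inter> space (rand_space \<beta>) = {z\<in>space (rand_space \<beta>). d \<le> N \<and>
       0 \<le> \<beta> * snd z - real d \<and> \<beta> * snd z - real d \<le> P \<and> (snd z \<in> S \<longrightarrow> (fst z 0 \<longleftrightarrow> \<beta> * snd z - real d \<le> P - 1))}"
    proof (intro set_eqI iffI)
      fix z assume "z \<in> rand_digit1 \<beta> -` {d} \<inter> space (rand_space \<beta>)"
      then show "z \<in> {z\<in>space (rand_space \<beta>). d \<le> N \<and>
       0 \<le> \<beta> * snd z - real d \<and> \<beta> * snd z - real d \<le> P \<and> (snd z \<in> S \<longrightarrow> (fst z 0 \<longleftrightarrow> \<beta> * snd z - real d \<le> P - 1))}"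
        using rand_digit1_props(1-3)[of "snd z" "fst z"] by (auto simp: space_rand mem_Times_iff)
    next
      fix z assume z: "z \<in> {z\<in>space (rand_space \<beta>). d \<le> N \<and>
       0 \<le> \<beta> * snd z - real d \<and> \<beta> * snd z - real d \<le> P \<and> (snd z \<in> S \<longrightarrow> (fst z 0 \<longleftrightarrow> \<beta> * snd z - real d \<le> P - 1))}"
      then show "z \<in> rand_digit1 \<beta> -` {d} \<inter> space (rand_space \<beta>)"
        using rand_step(1)[of d "\<beta> * snd z - real d" "snd z" "fst z"] by auto
    qed
    also have "\<dots> \<in> sets (rand_space \<beta>)" by measurable
    finally show ?thesis .
  qed
  then show ?thesis by (simp add: measurable_count_space_eq2_countable)
qed

lemma K_measurable: "K \<in> measurable (rand_space \<beta>) (rand_space \<beta>)"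
proof -
  note [measurable] = snd_rand_measurable fst_component_measurable rand_digit1_measurable
  let ?f = "\<lambda>z. ((\<lambda>n. if snd z \<in> S then fst z (Suc n) else fst z n), \<beta> * snd z - real (rand_digit1 \<beta> z))"
  have "?f \<in> measurable (rand_space \<beta>) (PiM UNIV (\<lambda>_. count_space UNIV) \<Otimes>\<^sub>M restrict_space borel (expI \<beta>))"
  proof (rule measurable_Pair)
    show "(\<lambda>z. (\<lambda>n. if snd z \<in> S then fst z (Suc n) else fst z n)) \<in> measurable (rand_space \<beta>) (PiM UNIV (\<lambda>_. count_space UNIV))"
    proof (rule measurable_PiM_single')
      show "(\<lambda>z. if snd z \<in> S then fst z (Suc n) else fst z n) \<in> measurable (rand_space \<beta>) (count_space UNIV)" for n
        by (rule measurable_If[OF fst_component_measurable fst_component_measurable]) measurable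
    qed auto
    show "(\<lambda>z. \<beta> * snd z - real (rand_digit1 \<beta> z)) \<in> measurable (rand_space \<beta>) (restrict_space borel (expI \<beta>))"
    proof (rule measurable_restrict_space2)
      show "(\<lambda>z. \<beta> * snd z - real (rand_digit1 \<beta> z)) \<in> space (rand_space \<beta>) \<rightarrow> expI \<beta>"
        using rand_digit1_props(2) by (auto simp: space_rand expI_eq)
    qed measurable
  qed
  moreover have "K z = ?f z" if "z \<in> space (rand_space \<beta>)" for z
    using rand_digit1_props(4)[of "snd z" "fst z"] that by (auto simp: space_rand mem_Times_iff)
  ultimately show ?thesis using measurable_cong[of "rand_space \<beta>" K ?f] by (simp add: rand_space_def)
qed

lemma K_funpow_measurable: "(K ^^ n) \<in> measurable (rand_space \<beta>) (rand_space \<beta>)"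
proof (induction n)
  case (Suc n) show ?case using measurable_compose[OF Suc K_measurable] by (simp add: o_def)
qed (simp add: id_def[symmetric])

lemma orbit_measurable: "(\<lambda>z. snd ((K ^^ n) z)) \<in> borel_measurable (rand_space \<beta>)"
  by (rule measurable_compose[OF K_funpow_measurable snd_rand_measurable])

section \<open>The metric and its balls\<close>

definition agree :: "nat \<Rightarrow> omega \<times> real \<Rightarrow> omega \<times> real \<Rightarrow> bool" where
  "agree n z z' \<longleftrightarrow> (\<forall>i<n. fst z i = fst z' i \<and> alpha_code \<beta> (Suc i) z = alpha_code \<beta> (Suc i) z')"

lemma alpha_code_eq_iff:
  assumes "z \<in> coding_X \<beta>" "z' \<in> coding_X \<beta>"
  shows "alpha_code \<beta> (Suc i) z = alpha_code \<beta> (Suc i) z' \<longleftrightarrow> snd ((K ^^ i) z') \<in> cell (snd ((K ^^ i) z))"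
proof -
  have "alpha_code \<beta> (Suc i) z = code (snd ((K ^^ i) z))" for z by (simp add: alpha_code_def code_def)
  moreover have "snd ((K ^^ i) z) \<in> {0..P} \<and> snd ((K ^^ i) z) \<notin> F" if "z \<in> coding_X \<beta>" for z
    using that K_range' unfolding coding_X_eq by blast
  ultimately show ?thesis using code_eq_iff assms by simp
qed

text \<open>Makes the \<open>LEAST\<close> in \<open>rho\<close> a genuine minimum for distinct
  points. Cells at consecutive times determine all digits and hence the position, while \<omega> is
  compared directly.\<close>

lemma agree_all:
  assumes z: "z \<in> coding_X \<beta>" and z': "z' \<in> coding_X \<beta>" and "\<And>n. agree n z z'"
  shows "z = z'"
proof -
  have ag: "fst z i = fst z' i" "snd ((K ^^ i) z') \<in> cell (snd ((K ^^ i) z))" for i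
    using assms(3)[of "Suc i"] alpha_code_eq_iff[OF z z'] unfolding agree_def by auto
  have r: "snd z \<in> {0..P}" "snd z' \<in> {0..P}" using z z' unfolding coding_X_eq by auto
  have "rand_phi \<beta> z i = rand_phi \<beta> z' i" for i
  proof -
    have o: "snd ((K ^^ i) w) \<in> {0..P}" if "snd w \<in> {0..P}" for w by (rule K_range'[OF that])
    have d: "rand_digit1 \<beta> w \<le> N" if "snd w \<in> {0..P}" for w
      using rand_digit1_props(1)[OF that, of "fst w"] by simp
    have "rand_digit1 \<beta> ((K ^^ i) z) = rand_digit1 \<beta> ((K ^^ i) z')"
    proof (rule cell_digit[OF d[OF o[OF r(1)]] d[OF o[OF r(2)]] o[OF r(1)]])
      show "snd ((K ^^ i) z) \<notin> F" using z unfolding coding_X_eq by blast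
      show "snd ((K ^^ i) z') \<in> cell (snd ((K ^^ i) z))" by (rule ag)
      show "snd (K ((K ^^ i) z)) \<in> {0..P}" by (rule K_snd(1)[OF o[OF r(1)]])
      show "snd (K ((K ^^ i) z')) \<in> cell (snd (K ((K ^^ i) z)))" using ag(2)[of "Suc i"] by simp
    qed (use K_snd(2)[OF o] r in auto)
    then show ?thesis by (simp add: rand_phi_def rand_digit_def)
  qed
  then have "rand_phi \<beta> z = rand_phi \<beta> z'" by blast
  then have "snd z = snd z'" using xv_phi[OF r(1)] xv_phi[OF r(2)] by simp
  moreover have "fst z = fst z'" using ag(1) by blast
  ultimately show ?thesis by (simp add: prod_eq_iff)
qed

lemma inverse_power_le_iff: "inverse \<beta> ^ m \<le> inverse \<beta> ^ n \<longleftrightarrow> n \<le> m"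
  using power_decreasing_iff[of "inverse \<beta>" m n] beta_gt1 by (simp add: inverse_less_1_iff)

lemma rho_le_iff:
  assumes z: "z \<in> coding_X \<beta>" and z': "z' \<in> coding_X \<beta>"
  shows "rho \<beta> z z' \<le> inverse \<beta> ^ n \<longleftrightarrow> agree n z z'"
proof (cases "z = z'")
  case True then show ?thesis using beta_gt1 by (simp add: rho_def agree_def)
next
  case False
  let ?Q = "\<lambda>k. fst z k \<noteq> fst z' k \<or> alpha_code \<beta> (Suc k) z \<noteq> alpha_code \<beta> (Suc k) z'"
  have "\<exists>k. ?Q k" using agree_all[OF z z'] False unfolding agree_def by blast
  then have "?Q (LEAST k. ?Q k)" by (rule LeastI_ex)
  then have "n \<le> (LEAST k. ?Q k) \<longleftrightarrow> agree n z z'"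
    (is "n \<le> ?L \<longleftrightarrow> _")
  proof -
    assume L: "?Q ?L"
    show "n \<le> ?L \<longleftrightarrow> agree n z z'"
    proof
      assume "n \<le> ?L"
      then have "\<not> ?Q i" if "i < n" for i using not_less_Least[of i ?Q] that by linarith
      then show "agree n z z'" unfolding agree_def by blast
    next
      assume "agree n z z'"
      then show "n \<le> ?L" using L unfolding agree_def by (meson not_le)
    qed
  qed
  then show ?thesis using False inverse_power_le_iff by (simp add: rho_def)
qed

lemma rho_power: "z \<noteq> z' \<Longrightarrow> \<exists>n. rho \<beta> z z' = inverse \<beta> ^ n"
  by (auto simp: rho_def)

lemma rho_refl: "rho \<beta> z z = 0"
  by (simp add: rho_def)

lemma rho_pos: "z \<noteq> z' \<Longrightarrow> 0 < rho \<beta> z z'"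
  using rho_power[of z z'] beta_gt1 by auto

lemma rho_nonneg: "0 \<le> rho \<beta> z z'"
  using rho_pos[of z z'] by (cases "z = z'") (auto simp: rho_def)

lemma metric_rho: "Metric_space (coding_X \<beta>) (rho \<beta>)"
proof
  show "0 \<le> rho \<beta> x y" for x y by (rule rho_nonneg)
  show "rho \<beta> x y = rho \<beta> y x" for x y by (simp add: rho_def eq_commute)
  show "rho \<beta> x y = 0 \<longleftrightarrow> x = y" for x y
    using rho_pos[of x y] by (cases "x = y") (simp_all add: rho_refl)
  fix x y z assume X: "x \<in> coding_X \<beta>" "y \<in> coding_X \<beta>" "z \<in> coding_X \<beta>"
  show "rho \<beta> x z \<le> rho \<beta> x y + rho \<beta> y z"
  proof (cases "x = y \<or> y = z")
    case True
    then show ?thesis by (auto simp: rho_def)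
  next
    case False
    obtain n m where nm: "rho \<beta> x y = inverse \<beta> ^ n" "rho \<beta> y z = inverse \<beta> ^ m"
      using rho_power False by metis
    then have "agree n x y" "agree m y z" using rho_le_iff[of x y n] rho_le_iff[of y z m] X by auto
    \<comment> \<open>Agreement up to the smaller of the two levels is transitive; this gives the
      ultrametric inequality.\<close>
    then have "agree (min n m) x z" unfolding agree_def by auto
    then have "rho \<beta> x z \<le> inverse \<beta> ^ min n m" using rho_le_iff X by blast
    also have "\<dots> \<le> rho \<beta> x y + rho \<beta> y z" using rho_nonneg[of x y] rho_nonneg[of y z] by (cases "n \<le> m") (simp_all add: nm)
    finally show ?thesis .
  qed
qed

text \<open>Apart from 0 the metric takes only values \<beta>^(-n), so being less than r, with r at
  most \<beta>^(-k), means being at most \<beta>^(-k-1).\<close>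

lemma mball_eq:
  assumes z: "z \<in> coding_X \<beta>" and r: "inverse \<beta> ^ Suc k < r" "r \<le> inverse \<beta> ^ k"
  shows "Metric_space.mball (coding_X \<beta>) (rho \<beta>) z r = {z' \<in> coding_X \<beta>. agree (Suc k) z z'}"
proof -
  have "rho \<beta> z z' < r \<longleftrightarrow> agree (Suc k) z z'" if z': "z' \<in> coding_X \<beta>" for z'
  proof
    assume "agree (Suc k) z z'"
    then have "rho \<beta> z z' \<le> inverse \<beta> ^ Suc k" using rho_le_iff z z' by blast
    then show "rho \<beta> z z' < r" using r by linarith
  next
    assume a: "rho \<beta> z z' < r"
    show "agree (Suc k) z z'"
    proof (cases "z = z'")
      case False
      then obtain n where n: "rho \<beta> z z' = inverse \<beta> ^ n" using rho_power by blast
      then have "\<not> inverse \<beta> ^ k \<le> inverse \<beta> ^ n" using a r by linarith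
      then have "Suc k \<le> n" unfolding inverse_power_le_iff by simp
      then have "rho \<beta> z z' \<le> inverse \<beta> ^ Suc k" unfolding n inverse_power_le_iff .
      then show ?thesis using rho_le_iff z z' by blast
    qed (simp add: agree_def)
  qed
  then show ?thesis using Metric_space.in_mball[OF metric_rho] z by blast
qed

text \<open>Coordinates and cells both carry the indices 0 to k: this prescribes k + 1 coins but
  involves only k steps of the map.\<close>

lemma measure_agree:
  assumes z: "z \<in> coding_X \<beta>"
  shows "measure (nu \<beta>) {z' \<in> coding_X \<beta>. agree (Suc k) z z'} = pr (cyl (Suc k) k z)"
proof -
  note [measurable] = orbit_measurable fst_component_measurable
  let ?B = "{z' \<in> coding_X \<beta>. agree (Suc k) z z'}"
  let ?R = "\<lambda>z'. (\<forall>n. snd ((K ^^ n) z') \<notin> F) \<and>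
     (\<forall>i<Suc k. fst z' i = fst z i \<and> snd ((K ^^ i) z') \<in> cell (snd ((K ^^ i) z)))"
  have R: "z' \<in> ?B \<longleftrightarrow> z' \<in> space (rand_space \<beta>) \<and> ?R z'" for z'
    using alpha_code_eq_iff[OF z, of z'] unfolding agree_def
    by (auto simp: coding_X_eq space_rand mem_Times_iff)
  then have "?B = {z' \<in> space (rand_space \<beta>). ?R z'}" by blast
  also have "\<dots> \<in> sets (rand_space \<beta>)" by measurable
  finally have B: "?B \<in> sets (rand_space \<beta>)" .
  have "measure (nu \<beta>) ?B = pr (\<lambda>b. psi b \<in> ?B)" by (rule measure_nu[OF B])
  also have "\<dots> = pr (\<lambda>b. good b \<and> psi b \<in> ?B)"
    by (rule pr_good[symmetric]) (use B in measurable)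
  also have "\<dots> = pr (\<lambda>b. good b \<and> cyl (Suc k) k z b)"
  proof (rule pr_cong, rule conj_cong, rule refl)
    fix b assume b: "b \<in> space D" "good b"
    have K: "snd ((K ^^ n) (psi b)) = X n b" for n using K_psi[OF b(1)] by (simp add: psi_def)
    have "psi b \<in> space (rand_space \<beta>)" using xv_range[OF b(1)] by (simp add: space_rand psi_def)
    moreover have "\<forall>n. X n b \<notin> F" using b(2) by (simp add: good_def)
    ultimately show "psi b \<in> ?B \<longleftrightarrow> cyl (Suc k) k z b"
      unfolding R cyl_def K by (auto simp: psi_def less_Suc_eq_le)
  qed
  also have "\<dots> = pr (cyl (Suc k) k z)" by (rule pr_good) measurable
  finally show ?thesis .
qed

lemma visits_le: "visits \<beta> k z \<le> k"
proof -
  have "visits \<beta> k z \<le> card {..<k}" unfolding visits_def by (intro card_mono) auto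
  then show ?thesis by simp
qed

text \<open>The term q is minus the logarithm of the mass of the cell reached at time k; its bound c
  depends neither on the point nor on the scale.\<close>

lemma local_dim_quot_eq:
  "\<exists>c>0. \<forall>z\<in>coding_X \<beta>. \<forall>k r. inverse \<beta> ^ Suc k < r \<longrightarrow> r \<le> inverse \<beta> ^ k \<longrightarrow>
      (\<exists>q\<ge>0. q \<le> c \<and> local_dim_quot (coding_X \<beta>) (rho \<beta>) (nu \<beta>) z r =
        ereal ((real k * ln (real N + 1) + (real k + 1 - real (visits \<beta> k z)) * ln 2 + q) / - ln r))"
proof -
  obtain c0 where c0: "c0 > 0" "\<And>x. x \<in> {0..P} - F \<Longrightarrow> c0 \<le> pr (\<lambda>b. xv b \<in> cell x)" using cell_lower by blast
  show ?thesis
  \<comment> \<open>Adding 1 keeps the constant positive even if c0 = 1.\<close>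
  proof (rule exI[of _ "\<bar>ln c0\<bar> + 1"], intro conjI ballI allI impI)
    show "\<bar>ln c0\<bar> + 1 > 0" by simp
    fix z k r assume z: "z \<in> coding_X \<beta>" and r: "inverse \<beta> ^ Suc k < r" "r \<le> inverse \<beta> ^ k"
    let ?\<mu> = "pr (\<lambda>b. xv b \<in> cell (snd ((K ^^ k) z)))"
    have x: "snd ((K ^^ k) z) \<in> {0..P} - F" using z K_range' unfolding coding_X_eq by blast
    have mu: "c0 \<le> ?\<mu>" "?\<mu> \<le> 1" using c0(2)[OF x] pr_le1 by auto
    have vk: "visits \<beta> k z \<le> k" by (rule visits_le)
    have p: "measure (nu \<beta>) (Metric_space.mball (coding_X \<beta>) (rho \<beta>) z r) =
      ?\<mu> / ((real N + 1) ^ k * 2 ^ (Suc k - visits \<beta> k z))" (is "?p = _")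
      unfolding mball_eq[OF z r] measure_agree[OF z] by (rule pr_cyl[OF z]) (use vk in simp)
    have p0: "?p > 0" unfolding p using mu c0(1) by simp
    have "ln ?p = ln ?\<mu> - (real k * ln (real N + 1) + real (Suc k - visits \<beta> k z) * ln 2)"
      unfolding p using mu c0(1) by (simp add: ln_div ln_mult ln_realpow)
    also have "real (Suc k - visits \<beta> k z) = real k + 1 - real (visits \<beta> k z)" using vk by (simp add: of_nat_diff)
    finally have "- ln ?p = real k * ln (real N + 1) + (real k + 1 - real (visits \<beta> k z)) * ln 2 + (- ln ?\<mu>)"
      by simp
    then have "ln ?p / ln r = (real k * ln (real N + 1) + (real k + 1 - real (visits \<beta> k z)) * ln 2 + (- ln ?\<mu>)) / - ln r"
      using minus_divide_divide[of "ln ?p" "ln r"] by (simp only:)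
    moreover have "0 \<le> - ln ?\<mu>" "- ln ?\<mu> \<le> \<bar>ln c0\<bar> + 1"
    proof -
      have m0: "?\<mu> > 0" using mu c0(1) by linarith
      show "0 \<le> - ln ?\<mu>" using m0 mu(2) by simp
      have "ln c0 \<le> ln ?\<mu>" using mu(1) m0 c0(1) by (subst ln_le_cancel_iff)
      then show "- ln ?\<mu> \<le> \<bar>ln c0\<bar> + 1" by linarith
    qed
    ultimately show "\<exists>q\<ge>0. q \<le> \<bar>ln c0\<bar> + 1 \<and> local_dim_quot (coding_X \<beta>) (rho \<beta>) (nu \<beta>) z r =
        ereal ((real k * ln (real N + 1) + (real k + 1 - real (visits \<beta> k z)) * ln 2 + q) / - ln r)"
      using p0 unfolding local_dim_quot_def Let_def by (intro exI[of _ "- ln ?\<mu>"]) auto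
  qed
qed

section \<open>From radii to scales and the limit estimates\<close>

lemma scale_exists:
  assumes "0 < r" "r \<le> inverse \<beta> ^ n"
  shows "\<exists>k\<ge>n. inverse \<beta> ^ Suc k < r \<and> r \<le> inverse \<beta> ^ k"
proof -
  obtain m where "inverse r < \<beta> ^ m" using beta_gt1 real_arch_pow by blast
  then have "inverse (\<beta> ^ m) < inverse (inverse r)" using assms(1) by (intro less_imp_inverse_less) auto
  then have m: "inverse \<beta> ^ m < r" by (simp add: power_inverse)
  define l where "l = (LEAST m. inverse \<beta> ^ m < r)"
  have l: "inverse \<beta> ^ l < r" unfolding l_def by (rule LeastI[of "\<lambda>m. inverse \<beta> ^ m < r", OF m])
  have "\<not> inverse \<beta> ^ n \<le> inverse \<beta> ^ l" using l assms(2) by linarith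
  then have "n < l" unfolding inverse_power_le_iff by simp
  moreover have "\<not> inverse \<beta> ^ (l - 1) < r" 
    using not_less_Least[of "l - 1" "\<lambda>m. inverse \<beta> ^ m < r"] calculation unfolding l_def[symmetric] by simp
  ultimately show ?thesis using l by (intro exI[of _ "l - 1"]) auto
qed

lemma eventually_scale:
  assumes "eventually Q sequentially" 
    and "\<And>k r. 0 < r \<Longrightarrow> Q k \<Longrightarrow> inverse \<beta> ^ Suc k < r \<Longrightarrow> r \<le> inverse \<beta> ^ k \<Longrightarrow> R r"
  shows "eventually R (at_right 0)"
proof -
  obtain n where n: "\<And>k. k \<ge> n \<Longrightarrow> Q k" using assms(1) unfolding eventually_sequentially by blast
  have "0 < inverse \<beta> ^ n" using beta_gt1 by simp
  then have "eventually (\<lambda>r. r \<in> {0<..<inverse \<beta> ^ n}) (at_right 0)" by (rule eventually_at_right_real)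
  then show ?thesis
  proof eventually_elim
    case (elim r)
    then obtain k where "k \<ge> n" "inverse \<beta> ^ Suc k < r" "r \<le> inverse \<beta> ^ k" using scale_exists[of r n] by auto
    then show ?case using assms(2)[of r k] n elim by auto
  qed
qed

text \<open>On scale k one has -ln r \<ge> k ln \<beta>; the extra coin and q go into an error of
  order 1/k.\<close>

lemma quot_upper:
  assumes "0 \<le> q" "q \<le> c" "1 \<le> k" "m \<le> real k" "inverse \<beta> ^ Suc k < r" "r \<le> inverse \<beta> ^ k" "0 < r"
  shows "(real k * ln (real N + 1) + (real k + 1 - m) * ln 2 + q) / - ln r \<le>
    ln (real N + 1) / ln \<beta> + ln 2 / ln \<beta> * (1 - m / real k) + (ln 2 + c) / ln \<beta> / real k"
proof -
  have lb: "ln \<beta> > 0" using beta_gt1 by simp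
  have "ln r \<le> ln (inverse \<beta> ^ k)" using assms by simp
  also have "\<dots> = - (real k * ln \<beta>)" using beta_gt1 by (simp add: ln_realpow ln_inverse)
  finally have t: "real k * ln \<beta> \<le> - ln r" by simp
  have num: "0 \<le> real k * ln (real N + 1) + (real k + 1 - m) * ln 2 + q"
    using assms by (intro add_nonneg_nonneg mult_nonneg_nonneg) auto
  have "(real k * ln (real N + 1) + (real k + 1 - m) * ln 2 + q) / - ln r \<le>
     (real k * ln (real N + 1) + (real k + 1 - m) * ln 2 + q) / (real k * ln \<beta>)"
  proof (intro divide_left_mono mult_pos_pos)
    have "0 < real k * ln \<beta>" using lb assms(3) by simp
    then show "0 < - ln r" using t by linarith
  qed (use t num lb assms(3) in auto)
  also have "\<dots> \<le> (real k * ln (real N + 1) + (real k + 1 - m) * ln 2 + c) / (real k * ln \<beta>)"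
    using lb assms by (intro divide_right_mono) auto
  also have "\<dots> = ln (real N + 1) / ln \<beta> + ln 2 / ln \<beta> * (1 - m / real k) + (ln 2 + c) / ln \<beta> / real k"
    using lb assms(3) by (simp add: field_simps)
  finally show ?thesis .
qed

text \<open>On scale k one has -ln r < (k + 1) ln \<beta>. Dividing by k + 1 instead of k also costs
  only an error of order 1/k.\<close>

lemma quot_lower:
  assumes "0 \<le> q" "1 \<le> k" "0 \<le> m" "m \<le> real k" "inverse \<beta> ^ Suc k < r" "r \<le> inverse \<beta> ^ k" "0 < r"
  shows "ln (real N + 1) / ln \<beta> + ln 2 / ln \<beta> * (1 - m / real k) - (ln (real N + 1) + ln 2) / ln \<beta> / real k
    \<le> (real k * ln (real N + 1) + (real k + 1 - m) * ln 2 + q) / - ln r"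
proof -
  have lb: "ln \<beta> > 0" using beta_gt1 by simp
  have "ln (inverse \<beta> ^ Suc k) < ln r" using assms beta_gt1 by (subst ln_less_cancel_iff) auto
  moreover have "ln (inverse \<beta> ^ Suc k) = - (real (Suc k) * ln \<beta>)" using beta_gt1 by (simp only: power_inverse ln_inverse ln_realpow)
  ultimately have t: "- ln r \<le> (real k + 1) * ln \<beta>" by (simp add: add.commute)
  have "r < 1"
  proof -
    have "inverse \<beta> ^ k \<le> inverse \<beta> ^ 1" using inverse_power_le_iff assms(2) by blast
    also have "\<dots> < 1" using beta_gt1 by (simp add: inverse_less_1_iff)
    finally show ?thesis using assms by simp
  qed
  then have r0: "- ln r > 0" using assms by simp
  define A where "A = ln (real N + 1)"
  define B where "B = ln (2::real)"
  have AB: "A \<ge> 0" "B \<ge> 0" by (auto simp: A_def B_def)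
  let ?V = "real k * A + (real k - m) * B"
  have V: "0 \<le> ?V" "?V \<le> real k * (A + B)" 
  proof -
    show "0 \<le> ?V" using AB assms by (intro add_nonneg_nonneg mult_nonneg_nonneg) auto
    have "0 \<le> m * B" using AB assms by simp
    then show "?V \<le> real k * (A + B)" by (simp add: algebra_simps)
  qed
  have "A / ln \<beta> + B / ln \<beta> * (1 - m / real k) - (A + B) / ln \<beta> / real k = ?V / (real k * ln \<beta>) - (A + B) / (real k * ln \<beta>)"
    using lb assms(2) by (simp add: field_simps)
  \<comment> \<open>Uses ?V \<le> k(A + B): replacing k by k + 1 in the denominator lowers the
    quotient by at most (A + B)/k before division by ln \<beta>.\<close>
  also have "\<dots> \<le> ?V / ((real k + 1) * ln \<beta>)"
  proof -
    have "?V * (real k + 1) - (A + B) * (real k + 1) \<le> ?V * real k" using V AB by (simp add: algebra_simps)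
    then have "(?V - (A + B)) / real k \<le> ?V / (real k + 1)"
      using assms(2) by (simp add: pos_divide_le_eq pos_le_divide_eq left_diff_distrib)
    then have "(?V - (A + B)) / real k / ln \<beta> \<le> ?V / (real k + 1) / ln \<beta>" using lb by (intro divide_right_mono) auto
    then show ?thesis by (simp add: diff_divide_distrib)
  qed
  also have "\<dots> \<le> ?V / - ln r" using t r0 V lb by (intro divide_left_mono mult_pos_pos) auto
  also have "\<dots> \<le> (real k * A + (real k + 1 - m) * B + q) / - ln r"
    using r0 AB assms by (intro divide_right_mono) (auto simp: algebra_simps)
  finally show ?thesis unfolding A_def B_def .
qed

lemma local_dim_bounds:
  assumes z: "z \<in> coding_X \<beta>"
  shows "ereal (ln (real N + 1) / ln \<beta>)
           + ereal (ln 2 / ln \<beta>) * (1 - limsup (\<lambda>k. ereal (real (visits \<beta> k z) / real k)))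
         \<le> lower_local_dim (coding_X \<beta>) (rho \<beta>) (nu \<beta>) z" (is ?thesis1)
    and "upper_local_dim (coding_X \<beta>) (rho \<beta>) (nu \<beta>) z
         \<le> ereal (ln (real N + 1) / ln \<beta>)
           + ereal (ln 2 / ln \<beta>) * (1 - liminf (\<lambda>k. ereal (real (visits \<beta> k z) / real k)))" (is ?thesis2)
proof -
  let ?\<theta> = "\<lambda>k. real (visits \<beta> k z) / real k"
  let ?A = "ln (real N + 1) / ln \<beta>" and ?B = "ln 2 / ln \<beta>"
  have B: "?B > 0" using beta_gt1 by simp
  have th: "0 \<le> ?\<theta> k" "?\<theta> k \<le> 1" for k using visits_le[of k z] by (auto simp: divide_le_eq_1)
  \<comment> \<open>Visit frequencies lie in [0, 1], so their lower and upper limits are real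
    numbers and the extended subtraction reduces to a real one.\<close>
  have fin: "\<exists>l. f = ereal l" if "0 \<le> f" "f \<le> 1" for f :: ereal using that by (cases f) auto
  have li: "0 \<le> liminf (\<lambda>k. ereal (?\<theta> k))" "limsup (\<lambda>k. ereal (?\<theta> k)) \<le> 1"
    using th by (auto intro!: Liminf_bounded Limsup_bounded always_eventually)
  have ls: "liminf (\<lambda>k. ereal (?\<theta> k)) \<le> limsup (\<lambda>k. ereal (?\<theta> k))" by (rule Liminf_le_Limsup) simp
  obtain l where l: "liminf (\<lambda>k. ereal (?\<theta> k)) = ereal l" using fin[OF li(1) order_trans[OF ls li(2)]] by blast
  obtain u where u: "limsup (\<lambda>k. ereal (?\<theta> k)) = ereal u" using fin[OF order_trans[OF li(1) ls] li(2)] by blast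
  obtain c where c: "c > 0" "\<And>k r. inverse \<beta> ^ Suc k < r \<Longrightarrow> r \<le> inverse \<beta> ^ k \<Longrightarrow>
      \<exists>q\<ge>0. q \<le> c \<and> local_dim_quot (coding_X \<beta>) (rho \<beta>) (nu \<beta>) z r =
        ereal ((real k * ln (real N + 1) + (real k + 1 - real (visits \<beta> k z)) * ln 2 + q) / - ln r)"
    using local_dim_quot_eq z by blast
  have small: "eventually (\<lambda>k. x / real k < e) sequentially" if "e > 0" for x e :: real
    using order_tendstoD(2)[OF lim_const_over_n that] .
  have pos: "eventually (\<lambda>k. 1 \<le> k) sequentially" by (rule eventually_ge_at_top)
  show ?thesis2
  proof (rule ereal_le_epsilon2)
    fix e :: real assume e: "e > 0"
    \<comment> \<open>Half of e goes to the visit frequency, where the factor ?B turns e/(2 ?B) into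
      e/2, and half to the error of order 1/k.\<close>
    have "ereal (l - e / (2 * ?B)) < liminf (\<lambda>k. ereal (?\<theta> k))" unfolding l using e beta_gt1 by simp
    then have 1: "eventually (\<lambda>k. l - e / (2 * ?B) < ?\<theta> k) sequentially" by (auto dest: less_LiminfD)
    have "eventually (\<lambda>k. l - e / (2 * ?B) < ?\<theta> k \<and> (ln 2 + c) / ln \<beta> / real k < e / 2 \<and> 1 \<le> k) sequentially"
      using 1 small[of "e / 2" "(ln 2 + c) / ln \<beta>"] e pos by (intro eventually_conj) auto
    then have "eventually (\<lambda>r. local_dim_quot (coding_X \<beta>) (rho \<beta>) (nu \<beta>) z r \<le> ereal (?A + ?B * (1 - l) + e)) (at_right 0)"
    proof (rule eventually_scale)
      fix k r assume r: "0 < r" "inverse \<beta> ^ Suc k < r" "r \<le> inverse \<beta> ^ k"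
        and k: "l - e / (2 * ?B) < ?\<theta> k \<and> (ln 2 + c) / ln \<beta> / real k < e / 2 \<and> 1 \<le> k"
      obtain q where q: "q \<ge> 0" "q \<le> c" "local_dim_quot (coding_X \<beta>) (rho \<beta>) (nu \<beta>) z r =
        ereal ((real k * ln (real N + 1) + (real k + 1 - real (visits \<beta> k z)) * ln 2 + q) / - ln r)"
        using c(2)[OF r(2,3)] by blast
      have "?B * (1 - ?\<theta> k) \<le> ?B * (1 - l + e / (2 * ?B))" using k B by (intro mult_left_mono) auto
      also have "\<dots> = ?B * (1 - l) + e / 2" using beta_gt1 by (simp add: distrib_left)
      finally have "?A + ?B * (1 - ?\<theta> k) + (ln 2 + c) / ln \<beta> / real k \<le> ?A + ?B * (1 - l) + e" using k by linarith
      moreover have "(real k * ln (real N + 1) + (real k + 1 - real (visits \<beta> k z)) * ln 2 + q) / - ln r \<le>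
         ?A + ?B * (1 - ?\<theta> k) + (ln 2 + c) / ln \<beta> / real k"
        by (rule quot_upper) (use q k r visits_le[of k z] in auto)
      ultimately show "local_dim_quot (coding_X \<beta>) (rho \<beta>) (nu \<beta>) z r \<le> ereal (?A + ?B * (1 - l) + e)"
        unfolding q(3) ereal_less_eq by linarith
    qed
    then have "upper_local_dim (coding_X \<beta>) (rho \<beta>) (nu \<beta>) z \<le> ereal (?A + ?B * (1 - l) + e)"
      unfolding upper_local_dim_def by (rule Limsup_bounded)
    then show "upper_local_dim (coding_X \<beta>) (rho \<beta>) (nu \<beta>) z \<le> ereal ?A + ereal ?B * (1 - liminf (\<lambda>k. ereal (?\<theta> k))) + ereal e"
      unfolding l by (simp add: one_ereal_def)
  qed
  have "ereal (?A + ?B * (1 - u)) \<le> lower_local_dim (coding_X \<beta>) (rho \<beta>) (nu \<beta>) z"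
  proof (rule ereal_le_epsilon2)
    fix e :: real assume e: "e > 0"
    let ?C = "(ln (real N + 1) + ln 2) / ln \<beta>"
    have "limsup (\<lambda>k. ereal (?\<theta> k)) < ereal (u + e / (2 * ?B))" unfolding u using e beta_gt1 by simp
    then have 1: "eventually (\<lambda>k. ?\<theta> k < u + e / (2 * ?B)) sequentially" by (auto dest: Limsup_lessD)
    have "eventually (\<lambda>k. ?\<theta> k < u + e / (2 * ?B) \<and> ?C / real k < e / 2 \<and> 1 \<le> k) sequentially"
      using 1 small[of "e / 2" ?C] e pos by (intro eventually_conj) auto
    then have "eventually (\<lambda>r. ereal (?A + ?B * (1 - u) - e) \<le> local_dim_quot (coding_X \<beta>) (rho \<beta>) (nu \<beta>) z r) (at_right 0)"
    proof (rule eventually_scale)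
      fix k r assume r: "0 < r" "inverse \<beta> ^ Suc k < r" "r \<le> inverse \<beta> ^ k"
        and k: "?\<theta> k < u + e / (2 * ?B) \<and> ?C / real k < e / 2 \<and> 1 \<le> k"
      obtain q where q: "q \<ge> 0" "q \<le> c" "local_dim_quot (coding_X \<beta>) (rho \<beta>) (nu \<beta>) z r =
        ereal ((real k * ln (real N + 1) + (real k + 1 - real (visits \<beta> k z)) * ln 2 + q) / - ln r)"
        using c(2)[OF r(2,3)] by blast
      have "?B * (1 - u) - e / 2 = ?B * (1 - u - e / (2 * ?B))" using beta_gt1 by (simp add: right_diff_distrib)
      also have "\<dots> \<le> ?B * (1 - ?\<theta> k)" using k B by (intro mult_left_mono) auto
      finally have "?A + ?B * (1 - u) - e \<le> ?A + ?B * (1 - ?\<theta> k) - ?C / real k" using k by linarith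
      moreover have "?A + ?B * (1 - ?\<theta> k) - ?C / real k \<le>
         (real k * ln (real N + 1) + (real k + 1 - real (visits \<beta> k z)) * ln 2 + q) / - ln r"
        by (rule quot_lower) (use q k r visits_le[of k z] in auto)
      ultimately show "ereal (?A + ?B * (1 - u) - e) \<le> local_dim_quot (coding_X \<beta>) (rho \<beta>) (nu \<beta>) z r"
        unfolding q(3) ereal_less_eq by linarith
    qed
    then have "ereal (?A + ?B * (1 - u) - e) \<le> lower_local_dim (coding_X \<beta>) (rho \<beta>) (nu \<beta>) z"
      unfolding lower_local_dim_def by (rule Liminf_bounded)
    then show "ereal (?A + ?B * (1 - u)) \<le> lower_local_dim (coding_X \<beta>) (rho \<beta>) (nu \<beta>) z + ereal e"
      by (cases "lower_local_dim (coding_X \<beta>) (rho \<beta>) (nu \<beta>) z") auto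
  qed
  then show ?thesis1 unfolding u by (simp add: one_ereal_def)
qed

end

theorem theorem3p1:
  fixes \<beta> :: real and \<omega> :: "nat \<Rightarrow> bool" and x :: real
  assumes "\<beta> > 1" and "gen_multinacci \<beta>" and "(\<omega>, x) \<in> coding_X \<beta>"
  shows "ereal (ln (real_of_int \<lceil>\<beta>\<rceil>) / ln \<beta>)
           + ereal (ln 2 / ln \<beta>) * (1 - limsup (\<lambda>k. ereal (real (visits \<beta> k (\<omega>, x)) / real k)))
         \<le> lower_local_dim (coding_X \<beta>) (rho \<beta>) (nu \<beta>) (\<omega>, x)
       \<and> lower_local_dim (coding_X \<beta>) (rho \<beta>) (nu \<beta>) (\<omega>, x)
         \<le> upper_local_dim (coding_X \<beta>) (rho \<beta>) (nu \<beta>) (\<omega>, x)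
       \<and> upper_local_dim (coding_X \<beta>) (rho \<beta>) (nu \<beta>) (\<omega>, x)
         \<le> ereal (ln (real_of_int \<lceil>\<beta>\<rceil>) / ln \<beta>)
           + ereal (ln 2 / ln \<beta>) * (1 - liminf (\<lambda>k. ereal (real (visits \<beta> k (\<omega>, x)) / real k)))"
proof -
  interpret multinacci \<beta> by unfold_locales (rule assms(2))
  have "lower_local_dim (coding_X \<beta>) (rho \<beta>) (nu \<beta>) (\<omega>, x) \<le> upper_local_dim (coding_X \<beta>) (rho \<beta>) (nu \<beta>) (\<omega>, x)"
    unfolding lower_local_dim_def upper_local_dim_def by (rule Liminf_le_Limsup) simp
  then show ?thesis using local_dim_bounds[OF assms(3)] unfolding ceil_beta by blast
qed

end
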